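(* There exist constants $c,C>0$, independent of $n$ and $\tau$, such that for all $n\in\{2,3,\ldots\}$ and all $\tau>0$, $$\min\left\{cn\tau^2,\ \frac{\mathcal{F}}{2}\right\}\le\inf_{\mathbf{x}\in\mathcal{A}_n}\mathcal{E}_\tau[\mathbf{x}]\le\min\left\{Cn^2\tau^2,\ \mathcal{F}\right\}.$$
   Context: Fix $0<r_0<1$ and let $B=\{(x,y)\in\mathbb{R}^2:\ r_0<\sqrt{x^2+y^2}<1\}$, with polar coordinates $(r,\theta)$. Fix a Poisson ratio $\nu$ ($-1<\nu\le 1/2$). The admissible set is $\mathcal{A}=W^{1,2}(B,\mathbb{R}^2)\times W^{2,2}(B,\mathbb{R})$; an element $\mathbf{x}=(\chi,\eta)\in\mathcal{A}$ is called a deformation with in-plane displacement $\chi$ and out-of-plane displacement $\eta$. The in-plane strain is the symmetric matrix field $$\gamma=(D\chi)^T+D\chi+(D\eta)^T D\eta-\mathbf{g}_1,\qquad \mathbf{g}_1=\frac13\begin{pmatrix}y^2&-xy\\-xy&x^2\end{pmatrix},$$ where $D\eta$ is the row vector of first derivatives. The energies are $$\mathcal{S}[\mathbf{x}]=\int_B\Big(\frac{1}{1-\nu}\mathrm{tr}(\gamma)^2-2\det\gamma\Big)\,dx\,dy,\quad \mathcal{B}[\mathbf{x}]=\int_B\Big(\frac{1}{1-\nu}\mathrm{tr}(D^2\eta)^2-2\det(D^2\eta)\Big)\,dx\,dy,\quad \mathcal{E}_\tau=\mathcal{S}+\tau^2\mathcal{B}.$$ For $n\in\{2,3,\ldots\}$,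 $\mathcal{A}_n\subset\mathcal{A}$ is the set of $(\chi,\eta)\in\mathcal{A}$ such that, in polar coordinates, (i) $\eta$ is periodic in $\theta$ with period $2\pi/n$; (ii) $\eta$ vanishes along the lines $\theta=0$ and $\theta=\pi/n$; (iii) $\eta(r,\theta-\pi/n)=-\eta(r,\theta)$. The set of flat deformations is $\mathcal{A}_f=\{(\chi,\eta)\in\mathcal{A}:\eta=0\}$, and $\mathcal{F}=\inf_{\mathbf{x}\in\mathcal{A}_f}\mathcal{E}_\tau[\mathbf{x}]$ (which does not depend on $\tau$). Constants may depend on the fixed parameters $r_0$ and $\nu$. *)

theory Defs
  imports "HOL-Analysis.Analysis"
begin

section \<open>Weak derivatives and Sobolev spaces\<close>

definition partial :: "'n \<Rightarrow> (real^'n \<Rightarrow> real) \<Rightarrow> real^'n \<Rightarrow> real" where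
  "partial i f = (\<lambda>x. frechet_derivative f (at x) (axis i 1))"

primrec Ck :: "nat \<Rightarrow> (real^'n \<Rightarrow> real) \<Rightarrow> bool" where
  "Ck 0 f \<longleftrightarrow> continuous_on UNIV f"
| "Ck (Suc k) f \<longleftrightarrow> (\<forall>x. f differentiable (at x)) \<and> (\<forall>i. Ck k (partial i f))"

definition test_functions :: "(real^'n) set \<Rightarrow> (real^'n \<Rightarrow> real) set" where
  "test_functions \<Omega> =
     {\<phi>. (\<forall>k. Ck k \<phi>) \<and> compact (closure {x. \<phi> x \<noteq> 0}) \<and> closure {x. \<phi> x \<noteq> 0} \<subseteq> \<Omega>}"

definition locally_integrable_on :: "(real^'n \<Rightarrow> real) \<Rightarrow> (real^'n) set \<Rightarrow> bool" where
  "locally_integrable_on u \<Omega> \<longleftrightarrow> (\<forall>K. compact K \<longrightarrow> K \<subseteq> \<Omega> \<longrightarrow> set_integrable lebesgue K u)"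

definition has_weak_partial ::
  "(real^'n) set \<Rightarrow> 'n \<Rightarrow> (real^'n \<Rightarrow> real) \<Rightarrow> (real^'n \<Rightarrow> real) \<Rightarrow> bool" where
  "has_weak_partial \<Omega> i u v \<longleftrightarrow>
     locally_integrable_on u \<Omega> \<and> locally_integrable_on v \<Omega> \<and>
     (\<forall>\<phi>\<in>test_functions \<Omega>.
        (LINT x:\<Omega>|lebesgue. u x * partial i \<phi> x) = - (LINT x:\<Omega>|lebesgue. v x * \<phi> x))"

text \<open>Weak derivatives are unique only up to null sets; \<open>weak_partial\<close> picks one
  representative. It is used below only on functions that have a weak derivative and only
  under integrals, which do not depend on the choice.\<close>

definition weak_partial ::
  "(real^'n) set \<Rightarrow> 'n \<Rightarrow> (real^'n \<Rightarrow> real) \<Rightarrow> real^'n \<Rightarrow> real" where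
  "weak_partial \<Omega> i u = (SOME v. has_weak_partial \<Omega> i u v)"

definition L2 :: "(real^'n) set \<Rightarrow> (real^'n \<Rightarrow> real) set" where
  "L2 \<Omega> = {u. u \<in> borel_measurable (lebesgue_on \<Omega>) \<and> integrable (lebesgue_on \<Omega>) (\<lambda>x. (u x)\<^sup>2)}"

text \<open>\<open>Sobolev k \<Omega>\<close> is \<open>W\<^sup>k\<^sup>,\<^sup>2(\<Omega>)\<close>, consisting of functions rather than of classes modulo
  null sets; the values outside \<open>\<Omega>\<close> are irrelevant.\<close>

primrec Sobolev :: "nat \<Rightarrow> (real^'n) set \<Rightarrow> (real^'n \<Rightarrow> real) set" where
  "Sobolev 0 \<Omega> = L2 \<Omega>"
| "Sobolev (Suc k) \<Omega> = {u \<in> L2 \<Omega>. \<forall>i. \<exists>v\<in>Sobolev k \<Omega>. has_weak_partial \<Omega> i u v}"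

definition weak_gradient :: "(real^'n) set \<Rightarrow> (real^'n \<Rightarrow> real) \<Rightarrow> real^'n \<Rightarrow> real^'n" where
  "weak_gradient \<Omega> u x = (\<chi> i. weak_partial \<Omega> i u x)"

definition weak_jacobian ::
  "(real^'n) set \<Rightarrow> (real^'n \<Rightarrow> real^'m) \<Rightarrow> real^'n \<Rightarrow> real^'n^'m" where
  "weak_jacobian \<Omega> u x = (\<chi> i j. weak_partial \<Omega> j (\<lambda>y. u y $ i) x)"

definition weak_hessian :: "(real^'n) set \<Rightarrow> (real^'n \<Rightarrow> real) \<Rightarrow> real^'n \<Rightarrow> real^'n^'n" where
  "weak_hessian \<Omega> u x = (\<chi> i j. weak_partial \<Omega> j (weak_partial \<Omega> i u) x)"

section \<open>The elastic annulus\<close>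

definition annulus :: "real \<Rightarrow> (real^2) set" where
  "annulus r0 = {p. r0 < norm p \<and> norm p < 1}"

definition polar :: "real \<Rightarrow> real \<Rightarrow> real^2" where
  "polar r \<theta> = vector [r * cos \<theta>, r * sin \<theta>]"

type_synonym deformation = "(real^2 \<Rightarrow> real^2) \<times> (real^2 \<Rightarrow> real)"

definition admissible :: "real \<Rightarrow> deformation set" where
  "admissible r0 = {(u, \<eta>).
     (\<forall>i. (\<lambda>p. u p $ i) \<in> Sobolev 1 (annulus r0)) \<and> \<eta> \<in> Sobolev 2 (annulus r0)}"

definition g1 :: "real^2 \<Rightarrow> real^2^2" where
  "g1 p = (1/3) *\<^sub>R vector [vector [(p$2)\<^sup>2, - (p$1 * p$2)], vector [- (p$1 * p$2), (p$1)\<^sup>2]]"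

definition strain :: "real \<Rightarrow> deformation \<Rightarrow> real^2 \<Rightarrow> real^2^2" where
  "strain r0 = (\<lambda>(u, \<eta>) p.
     let Du = weak_jacobian (annulus r0) u p;
         D\<eta> = (rowvector (weak_gradient (annulus r0) \<eta> p) :: real^2^1)
     in transpose Du + Du + transpose D\<eta> ** D\<eta> - g1 p)"

definition energy_density :: "real \<Rightarrow> real^2^2 \<Rightarrow> real" where
  "energy_density \<nu> M = 1 / (1 - \<nu>) * (trace M)\<^sup>2 - 2 * det M"

text \<open>The density is nonnegative on symmetric matrices, so the energies below are Lebesgue
  integrals of functions that are nonnegative almost everywhere (the weak Hessian is symmetric
  almost everywhere). Taking them in \<open>[0,\<infinity>]\<close> loses nothing, and avoids the convention
  that the integral of a nonintegrable function is zero.\<close>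

lemma energy_density_nonneg:
  assumes "-1 < \<nu>" "\<nu> \<le> 1/2" and "transpose M = M"
  shows "energy_density \<nu> M \<ge> 0"
proof -
  define a b c where "a = M$1$1" and "b = M$2$2" and "c = M$1$2"
  have "M$2$1 = c"
    using arg_cong[OF assms(3), of "\<lambda>A. A$2$1"] by (simp add: c_def transpose_def)
  then have E: "energy_density \<nu> M = 1 / (1 - \<nu>) * (a + b)\<^sup>2 - 2 * (a * b - c * c)"
    by (simp add: energy_density_def trace_def det_2 sum_2 flip: a_def b_def c_def)
  have "1 / 2 \<le> 1 / (1 - \<nu>)"
    using assms by (simp add: field_simps)
  then have "1 / 2 * (a + b)\<^sup>2 \<le> 1 / (1 - \<nu>) * (a + b)\<^sup>2"
    by (intro mult_right_mono) auto
  moreover have "1 / 2 * (a + b)\<^sup>2 - 2 * (a * b - c * c) = (a - b)\<^sup>2 / 2 + 2 * c\<^sup>2"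
    by (simp add: power2_eq_square field_simps)
  moreover have "(a - b)\<^sup>2 / 2 + 2 * c\<^sup>2 \<ge> 0"
    by simp
  ultimately show ?thesis
    unfolding E by linarith
qed

definition stretching_energy :: "real \<Rightarrow> real \<Rightarrow> deformation \<Rightarrow> ennreal" where
  "stretching_energy r0 \<nu> X =
     (\<integral>\<^sup>+ p \<in> annulus r0. ennreal (energy_density \<nu> (strain r0 X p)) \<partial>lebesgue)"

definition bending_energy :: "real \<Rightarrow> real \<Rightarrow> deformation \<Rightarrow> ennreal" where
  "bending_energy r0 \<nu> = (\<lambda>(u, \<eta>).
     (\<integral>\<^sup>+ p \<in> annulus r0. ennreal (energy_density \<nu> (weak_hessian (annulus r0) \<eta> p)) \<partial>lebesgue))"

definition energy :: "real \<Rightarrow> real \<Rightarrow> real \<Rightarrow> deformation \<Rightarrow> ennreal" where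
  "energy r0 \<nu> \<tau> X = stretching_energy r0 \<nu> X + ennreal (\<tau>\<^sup>2) * bending_energy r0 \<nu> X"

text \<open>Elements of \<open>W\<^sup>2\<^sup>,\<^sup>2\<close> of a planar annulus have a continuous representative, which is what
  the pointwise conditions, in particular the one on the lines \<open>\<theta> = 0\<close> and \<open>\<theta> = \<pi>/n\<close>,
  refer to.\<close>

definition admissible_sym :: "real \<Rightarrow> nat \<Rightarrow> deformation set" where
  "admissible_sym r0 n = {(u, \<eta>). (u, \<eta>) \<in> admissible r0 \<and>
     (\<exists>h. continuous_on (annulus r0) h \<and> (AE p in lebesgue_on (annulus r0). \<eta> p = h p) \<and>
       (\<forall>r\<in>{r0<..<1}.
          (\<forall>\<theta>. h (polar r (\<theta> + 2 * pi / real n)) = h (polar r \<theta>)) \<and>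
          h (polar r 0) = 0 \<and> h (polar r (pi / real n)) = 0 \<and>
          (\<forall>\<theta>. h (polar r (\<theta> - pi / real n)) = - h (polar r \<theta>))))}"

definition admissible_flat :: "real \<Rightarrow> deformation set" where
  "admissible_flat r0 = {(u, \<eta>). (u, \<eta>) \<in> admissible r0 \<and>
     (AE p in lebesgue_on (annulus r0). \<eta> p = 0)}"

text \<open>The bending energy vanishes on flat deformations, so the value does not depend on
  \<open>\<tau>\<close>.\<close>

definition flat_energy :: "real \<Rightarrow> real \<Rightarrow> real \<Rightarrow> ennreal" where
  "flat_energy r0 \<nu> \<tau> = (INF X\<in>admissible_flat r0. energy r0 \<nu> \<tau> X)"

end

theory Submission
  imports Defs
begin

text \<open>Lower bound. The stretching energy is convex in the strain, so it is bounded below by testing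
  the strain with the stress \<open>\<sigma>\<close> of the optimal flat deformation. That deformation is radial and
  explicit; \<open>\<sigma>\<close> is divergence free with vanishing normal component on the boundary, so the in-plane
  displacement drops out and \<open>S \<ge> F - C \<integral>|D\<eta>|\<^sup>2\<close>. The rotation by \<open>\<pi>/n\<close> changes the sign of \<open>\<eta>\<close> and
  hence turns \<open>D\<eta>\<close> by the angle \<open>\<pi> + \<pi>/n\<close>, which is bounded away from \<open>2\<pi>\<close>; estimating the rotation
  difference of \<open>D\<eta>\<close> by its angular derivative gives \<open>\<integral>|D\<eta>|\<^sup>2 \<le> C n\<^sup>-\<^sup>2 \<integral>|D\<^sup>2\<eta>|\<^sup>2\<close>. If \<open>S < F/2\<close>, this
  forces the bending energy to be at least \<open>c n\<^sup>2 F\<close>, which is even better than \<open>c n F\<close>.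

  Upper bound. On the sector \<open>0 \<le> \<theta> \<le> \<pi>/n\<close> take \<open>\<eta> = xy - y\<^sup>2 cot (\<pi>/n)\<close> and extend by odd reflection.
  The result has a Lipschitz gradient and is, away from finitely many rays, locally a quadratic form
  with Hessian of determinant \<open>-1\<close> and trace \<open>\<plusminus>2 cot (\<pi>/n)\<close>. For such forms the displacement
  \<open>\<chi> = - \<eta> D\<eta> / 3\<close> makes the strain vanish identically.\<close>

section \<open>Smooth functions\<close>

text \<open>Why a saddle: applying the double curl to the equation of zero strain removes \<chi> and
  leaves det D^2 \<eta> = -1. On a sector the form y (x - y cot (\<pi>/n)) has this determinant and
  vanishes on both edges, as odd reflection requires for a continuous gradient. Its Hessian is of
  size cot (\<pi>/n) \<le> n/\<pi>, and the square of this is the n^2 of the upper bound. The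
  obstacle in the lower bound is the boundary, since displacements are only Sobolev functions of the
  open annulus. The stress is multiplied by cutoffs whose gradients grow like m near the boundary;
  the normal stress vanishes there to first order and compensates exactly this growth. The number F
  enters through two inequalities around the explicit energy \<open>flat_value\<close>: the explicit
  flat deformation shows F \<le> \<open>flat_value\<close>, and testing with its stress bounds
  \<open>flat_value\<close> by S plus the gradient term. Weak derivatives are arbitrary
  representatives, so the identities are statements almost everywhere; Borel representatives that
  vanish off the annulus are used where rotations and Fubini come in.\<close>

lemma has_derivative_imp_partial:
  "(f has_derivative f') (at x) \<Longrightarrow> partial i f x = f' (axis i 1)"
  unfolding partial_def by (simp add: frechet_derivative_at[symmetric])

lemma partial_cong_eventually:
  assumes "eventually (\<lambda>y. f y = g y) (nhds x)"
  shows "partial i f x = partial i g x"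
proof -
  have "(f has_derivative D) (at x) \<longleftrightarrow> (g has_derivative D) (at x)" for D
  proof
    have ev: "eventually (\<lambda>y. f y = g y) (at x)" "f x = g x"
      using assms by (auto simp: eventually_nhds_conv_at)
    then have ev': "eventually (\<lambda>y. g y = f y) (at x)" by (auto elim: eventually_mono)
    show "(f has_derivative D) (at x) \<Longrightarrow> (g has_derivative D) (at x)"
      using ev has_derivative_transform_eventually[of f D x UNIV g] by auto
    show "(g has_derivative D) (at x) \<Longrightarrow> (f has_derivative D) (at x)"
      using ev ev' has_derivative_transform_eventually[of g D x UNIV f] by auto
  qed
  then show ?thesis by (simp add: partial_def frechet_derivative_def)
qed

lemma differentiable_imp_has_derivative_partial:
  fixes f :: "real^'n \<Rightarrow> real"
  assumes "f differentiable (at x)"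
  shows "(f has_derivative (\<lambda>h. \<Sum>i\<in>UNIV. h $ i * partial i f x)) (at x)"
proof -
  let ?D = "frechet_derivative f (at x)"
  have D: "(f has_derivative ?D) (at x)" using assms frechet_derivative_works by blast
  then interpret linear ?D by (rule has_derivative_linear)
  have "?D h = (\<Sum>i\<in>UNIV. h $ i * partial i f x)" for h
  proof -
    have "?D h = ?D (\<Sum>i\<in>UNIV. h $ i *\<^sub>R axis i 1)"
      using basis_expansion[of h] by (simp add: scalar_mult_eq_scaleR)
    also have "\<dots> = (\<Sum>i\<in>UNIV. h $ i * ?D (axis i 1))"
      by (simp add: sum scaleR)
    finally show ?thesis by (simp add: partial_def)
  qed
  then have "?D = (\<lambda>h. \<Sum>i\<in>UNIV. h $ i * partial i f x)" by (rule ext)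
  with D show ?thesis by simp
qed

lemma partial_eventually:
  fixes f g :: "real^'n \<Rightarrow> real"
  assumes "eventually (\<lambda>p. f p = g p) (nhds p0)" "\<And>p. partial i g p = h p"
  shows "eventually (\<lambda>p. partial i f p = h p) (nhds p0)"
proof -
  have "eventually (\<lambda>p. eventually (\<lambda>q. f q = g q) (nhds p)) (nhds p0)"
    using assms(1) by (simp add: eventually_eventually)
  then show ?thesis
    by eventually_elim (simp add: partial_cong_eventually assms(2))
qed

lemma differentiable_eventually:
  fixes f g :: "real^'n \<Rightarrow> real"
  assumes "eventually (\<lambda>p. f p = g p) (nhds p0)" "g differentiable (at p0)"
  shows "f differentiable (at p0)"
proof -
  have "eventually (\<lambda>q. g q = f q) (at p0)" "g p0 = f p0"
    using assms(1) by (auto simp: eventually_nhds_conv_at elim!: eventually_mono)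
  moreover obtain D where "(g has_derivative D) (at p0)" using assms(2) by (auto simp: differentiable_def)
  ultimately have "(f has_derivative D) (at p0)"
    using has_derivative_transform_eventually[of g D p0 UNIV f] by auto
  then show ?thesis by (auto simp: differentiable_def)
qed

lemma partial_const [simp]: "partial i (\<lambda>x. c) = (\<lambda>x. 0)"
  by (rule ext, rule has_derivative_imp_partial[THEN trans], rule has_derivative_const, simp)

lemma partial_add:
  "f differentiable (at x) \<Longrightarrow> g differentiable (at x) \<Longrightarrow>
    partial i (\<lambda>x. f x + g x) x = partial i f x + partial i g x"
  using has_derivative_imp_partial[OF has_derivative_add[of f "frechet_derivative f (at x)" "at x" g "frechet_derivative g (at x)"]]
  by (simp add: partial_def frechet_derivative_works)

lemma partial_mult:
  fixes f g :: "real^'n \<Rightarrow> real"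
  shows "f differentiable (at x) \<Longrightarrow> g differentiable (at x) \<Longrightarrow>
    partial i (\<lambda>x. f x * g x) x = partial i f x * g x + f x * partial i g x"
  using has_derivative_imp_partial[OF has_derivative_mult[of f "frechet_derivative f (at x)" x UNIV g "frechet_derivative g (at x)"]]
  by (simp add: partial_def frechet_derivative_works)

lemma partial_compose_real:
  fixes f :: "real^'n \<Rightarrow> real"
  assumes "f differentiable (at x)" "(g has_real_derivative d) (at (f x))"
  shows "partial i (\<lambda>x. g (f x)) x = d * partial i f x"
proof -
  have "((\<lambda>x. g (f x)) has_derivative (\<lambda>h. d * frechet_derivative f (at x) h)) (at x)"
    using has_derivative_compose[of f "frechet_derivative f (at x)" x UNIV g "(*) d"] assms
    by (auto simp: frechet_derivative_works has_field_derivative_def)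
  from has_derivative_imp_partial[OF this] show ?thesis by (simp add: partial_def)
qed

lemma Ck_Suc_imp: "Ck (Suc k) f \<Longrightarrow> Ck k f"
proof (induction k arbitrary: f)
  case 0
  then show ?case
    by (auto simp: continuous_on_eq_continuous_at intro: differentiable_imp_continuous_within)
next
  case (Suc k)
  then show ?case by (metis Ck.simps(2))
qed

lemma Ck_const [simp]: "Ck k (\<lambda>x. c)"
  by (induction k arbitrary: c) auto

lemma Ck_component [simp]: "Ck k (\<lambda>x. x $ i)"
proof (cases k)
  case (Suc l)
  have d: "((\<lambda>x::real^'a. x $ i) has_derivative (\<lambda>h. h $ i)) (at x)" for x
    by (rule bounded_linear_imp_has_derivative, rule bounded_linear_vec_nth)
  have "partial j (\<lambda>x::real^'a. x $ i) = (\<lambda>x. axis j 1 $ i)" for j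
    using has_derivative_imp_partial[OF d] by auto
  then show ?thesis using Suc d by (auto simp: differentiable_def)
qed (auto intro: continuous_intros)

lemma Ck_add: "Ck k f \<Longrightarrow> Ck k g \<Longrightarrow> Ck k (\<lambda>x. f x + g x)"
proof (induction k arbitrary: f g)
  case (Suc k)
  then have "partial i (\<lambda>x. f x + g x) = (\<lambda>x. partial i f x + partial i g x)" for i
    by (auto simp: partial_add)
  with Suc show ?case by auto
qed (auto intro: continuous_intros)

lemma Ck_mult: "Ck k f \<Longrightarrow> Ck k g \<Longrightarrow> Ck k (\<lambda>x. f x * g x)"
proof (induction k arbitrary: f g)
  case (Suc k)
  then have "partial i (\<lambda>x. f x * g x) = (\<lambda>x. partial i f x * g x + f x * partial i g x)" for i
    by (auto simp: partial_mult)
  with Suc show ?case using Ck_Suc_imp[OF Suc.prems(1)] Ck_Suc_imp[OF Suc.prems(2)]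
    by (auto intro!: Ck_add Suc.IH)
qed (auto intro: continuous_intros)

lemma Ck_uminus: "Ck k f \<Longrightarrow> Ck k (\<lambda>x. - f x)"
  using Ck_mult[OF Ck_const[of k "-1"], of f] by simp

lemma Ck_diff: "Ck k f \<Longrightarrow> Ck k g \<Longrightarrow> Ck k (\<lambda>x. f x - g x)"
  using Ck_add[OF _ Ck_uminus, of k f g] by simp

lemma Ck_sum: "finite A \<Longrightarrow> (\<And>i. i \<in> A \<Longrightarrow> Ck k (f i)) \<Longrightarrow> Ck k (\<lambda>x. \<Sum>i\<in>A. f i x)"
  by (induction A rule: finite_induct) (auto intro: Ck_add)

lemma Ck_prod: "finite A \<Longrightarrow> (\<And>i. i \<in> A \<Longrightarrow> Ck k (f i)) \<Longrightarrow> Ck k (\<lambda>x. \<Prod>i\<in>A. f i x)"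
  by (induction A rule: finite_induct) (auto intro: Ck_mult)

text \<open>The hypothesis supplies the whole sequence of derivatives because the induction on
  \<open>k\<close> has to run for all \<open>n\<close> at once: one differentiation replaces
  \<open>\<Psi> n\<close> by \<open>\<Psi> (Suc n)\<close>, times a partial derivative of
  \<open>f\<close>.\<close>

lemma Ck_compose_real:
  fixes \<Psi> :: "nat \<Rightarrow> real \<Rightarrow> real"
  assumes \<Psi>: "\<And>n t. (\<Psi> n has_real_derivative \<Psi> (Suc n) t) (at t)"
  shows "Ck k f \<Longrightarrow> Ck k (\<lambda>x. \<Psi> n (f x))"
proof (induction k arbitrary: n)
  case 0
  have "continuous_on UNIV (\<Psi> n)"
    using \<Psi> by (auto intro!: continuous_at_imp_continuous_on DERIV_isCont)
  with 0 show ?case by (auto intro: continuous_on_compose2)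
next
  case (Suc k)
  then have "partial i (\<lambda>x. \<Psi> n (f x)) = (\<lambda>x. \<Psi> (Suc n) (f x) * partial i f x)" for i
    by (auto simp: partial_compose_real[OF _ \<Psi>])
  moreover have "(\<lambda>x. \<Psi> n (f x)) differentiable at x" for x
    using Suc.prems differentiable_chain_at[of f x "\<Psi> n"]
      real_differentiable_def[of "\<Psi> n" "f x" UNIV, THEN iffD2, OF exI, OF \<Psi>[of n "f x"]]
    by (auto simp: o_def)
  ultimately show ?case
    using Suc.prems Suc.IH[OF Ck_Suc_imp[OF Suc.prems]] by (auto intro!: Ck_mult)
qed

lemma Ck_inverse: "(\<And>x. f x \<noteq> 0) \<Longrightarrow> Ck k f \<Longrightarrow> Ck k (\<lambda>x. inverse (f x))"
proof (induction k)
  case (Suc k)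
  have "((\<lambda>t. inverse t) has_real_derivative - (inverse (f x))\<^sup>2) (at (f x))" for x
    using DERIV_inverse[of "f x"] Suc.prems(1) by (simp add: power2_eq_square)
  with Suc.prems have "partial i (\<lambda>x. inverse (f x)) =
      (\<lambda>x. (- (inverse (f x) * inverse (f x))) * partial i f x)" for i
    by (intro ext, subst partial_compose_real) (auto simp: power2_eq_square)
  moreover have "(\<lambda>x. inverse (f x)) differentiable at x" for x
    using Suc.prems by (auto intro!: differentiable_inverse)
  ultimately show ?case
    using Suc.prems Suc.IH[OF _ Ck_Suc_imp[OF Suc.prems(2)]] by (auto intro!: Ck_mult Ck_uminus)
qed (auto intro: continuous_intros)

lemma partial_compose_linear:
  fixes f :: "real^'n \<Rightarrow> real" and A :: "real^'n^'n"
  assumes "f differentiable (at (A *v x))"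
  shows "partial i (\<lambda>x. f (A *v x)) x = (\<Sum>j\<in>UNIV. A $ j $ i * partial j f (A *v x))"
    "(\<lambda>x. f (A *v x)) differentiable (at x)"
proof -
  have "((\<lambda>x. A *v x) has_derivative (\<lambda>h. A *v h)) (at x)"
    by (rule bounded_linear_imp_has_derivative) simp
  from has_derivative_compose[OF this differentiable_imp_has_derivative_partial[OF assms]]
  have D: "((\<lambda>x. f (A *v x)) has_derivative (\<lambda>h. \<Sum>j\<in>UNIV. (A *v h) $ j * partial j f (A *v x))) (at x)" .
  from has_derivative_imp_partial[OF this]
  show "partial i (\<lambda>x. f (A *v x)) x = (\<Sum>j\<in>UNIV. A $ j $ i * partial j f (A *v x))"
    by (simp add: matrix_vector_mult_basis column_def)
  show "(\<lambda>x. f (A *v x)) differentiable (at x)"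
    using D by (auto simp: differentiable_def)
qed

lemma Ck_compose_linear:
  fixes f :: "real^'n \<Rightarrow> real" and A :: "real^'n^'n"
  shows "Ck k f \<Longrightarrow> Ck k (\<lambda>x. f (A *v x))"
proof (induction k arbitrary: f)
  case 0
  then show ?case
    by (auto intro!: continuous_on_compose2[of UNIV f] matrix_vector_mult_linear_continuous_on)
next
  case (Suc k)
  then have "partial i (\<lambda>x. f (A *v x)) = (\<lambda>x. \<Sum>j\<in>UNIV. A $ j $ i * partial j f (A *v x))" for i
    by (auto simp: partial_compose_linear)
  moreover have "(\<lambda>x. f (A *v x)) differentiable (at x)" for x
    using Suc.prems by (auto intro: partial_compose_linear)
  ultimately show ?case using Suc
    by (auto intro!: Ck_sum Ck_mult)
qed

section \<open>Smooth functions built from exp (-1/t)\<close>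

definition expfun :: "real poly \<Rightarrow> real \<Rightarrow> real" where
  "expfun P t = (if t > 0 then poly P (1/t) * exp (- (1/t)) else 0)"

lemma tendsto_poly_exp_at_top: "((\<lambda>t. poly P t * exp (- t)) \<longlongrightarrow> 0) at_top" for P :: "real poly"
proof -
  \<comment> \<open>The extra power \<open>t ^ k\<close> makes the induction work:
    \<open>pCons a P\<close> stands for a + t P, and the factor t is absorbed into the
    power.\<close>
  have "((\<lambda>t. t ^ k * (poly P t * exp (- t))) \<longlongrightarrow> 0) at_top" for k :: nat
  proof (induction P arbitrary: k rule: pCons_induct)
    case (pCons a P)
    have "((\<lambda>t. a * (t ^ k / exp t) + t ^ Suc k * (poly P t * exp (- t))) \<longlongrightarrow> a * 0 + 0) at_top"
      by (intro tendsto_intros pCons.IH tendsto_power_div_exp_0)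
    then show ?case by (simp add: field_simps exp_minus)
  qed simp
  from this[of 0] show ?thesis by simp
qed

text \<open>This is the difference quotient at 0. On the right it is again a polynomial in 1/t, of
  one degree more, times exp (-1/t); on the left it is 0.\<close>

lemma tendsto_expfun_at_0: "((\<lambda>t. expfun P t / t) \<longlongrightarrow> 0) (at 0)"
proof -
  have "((\<lambda>t. poly (pCons 0 P) (inverse t) * exp (- inverse t)) \<longlongrightarrow> 0) (at_right 0)"
    by (rule filterlim_compose[OF tendsto_poly_exp_at_top filterlim_inverse_at_top_right])
  then have 1: "((\<lambda>t. expfun P t / t) \<longlongrightarrow> 0) (at_right 0)"
    by (rule Lim_transform_eventually)
       (auto simp: expfun_def eventually_at_filter field_simps)
  have 2: "((\<lambda>t. expfun P t / t) \<longlongrightarrow> 0) (at_left 0)"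
    by (rule Lim_transform_eventually[OF tendsto_const])
       (auto simp: expfun_def eventually_at_filter)
  from 1 2 show ?thesis by (simp add: filterlim_split_at)
qed

text \<open>The family is closed under differentiation: with s = 1/t the derivative is -s^2 d/ds,
  and it sends P(s) exp (-s) to s^2 (P - P')(s) exp (-s). Smoothness of every member therefore
  follows from this one statement of first order.\<close>

lemma DERIV_expfun: "(expfun P has_real_derivative expfun ([:0, 0, 1:] * (P - pderiv P)) t) (at t)"
proof -
  consider "t > 0" | "t < 0" | "t = 0" by linarith
  then show ?thesis
  proof cases
    case 1
    have "((\<lambda>t. poly P (1/t) * exp (- (1/t))) has_real_derivative
        expfun ([:0, 0, 1:] * (P - pderiv P)) t) (at t)"
      using 1 by (auto intro!: derivative_eq_intros simp: expfun_def field_simps power2_eq_square)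
    then show ?thesis
      by (rule DERIV_cong_ev[OF refl _ refl, THEN iffD1, rotated])
         (use 1 in \<open>auto simp: expfun_def eventually_nhds_metric dist_real_def intro!: exI[of _ t]\<close>)
  next
    case 2
    have "((\<lambda>t. 0) has_real_derivative
        expfun ([:0, 0, 1:] * (P - pderiv P)) t) (at t)"
      using 2 by (auto intro!: derivative_eq_intros simp: expfun_def)
    then show ?thesis
      by (rule DERIV_cong_ev[OF refl _ refl, THEN iffD1, rotated])
         (use 2 in \<open>auto simp: expfun_def eventually_nhds_metric dist_real_def intro!: exI[of _ "-t"]\<close>)
  next
    case 3
    have "expfun Q 0 = 0" for Q by (simp add: expfun_def)
    with 3 show ?thesis using tendsto_expfun_at_0[of P]
      by (simp add: DERIV_def)
  qed
qed

abbreviation bump :: "real \<Rightarrow> real" where "bump \<equiv> expfun 1"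

lemma bump_eq: "bump t = (if t > 0 then exp (- (1/t)) else 0)"
  by (simp add: expfun_def)

lemma Ck_expfun: "Ck k f \<Longrightarrow> Ck k (\<lambda>x. expfun P (f x))"
  using Ck_compose_real[of "\<lambda>n. expfun (((\<lambda>P. [:0, 0, 1:] * (P - pderiv P)) ^^ n) P)" k f 0]
  using DERIV_expfun by simp

section \<open>The fundamental lemma of the calculus of variations\<close>

text \<open>Boxes form an intersection-stable generator of the Borel sets, so vanishing integrals
  spread from boxes to all Borel sets, and a density whose integrals all vanish is zero almost
  everywhere. The induction runs on a Borel version \<open>g\<close> of \<open>f\<close>.\<close>

lemma AE_eq_0_if_box_integrals:
  fixes f :: "'a::euclidean_space \<Rightarrow> real"
  assumes int: "integrable lebesgue f"
    and box: "\<And>a b. (LINT x:box a b|lebesgue. f x) = 0"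
  shows "AE x in lebesgue. f x = 0"
proof -
  obtain g where g [measurable]: "g \<in> borel_measurable lborel" and fg: "AE x in lborel. f x = g x"
    using completion_ex_borel_measurable_real[of f lborel] borel_measurable_integrable[OF int] by auto
  have fg': "AE x in lebesgue. f x = g x"
    using fg by (rule AE_completion)
  have "integrable lebesgue g"
    by (rule integrable_cong_AE_imp[OF int]) (use fg' in \<open>auto intro: measurable_completion\<close>)
  then have g_int: "integrable lborel g"
    by (simp add: integrable_completion)
  have g_set: "set_integrable lborel A g" if "A \<in> sets borel" for A
    using that g_int integrable_mult_indicator[of A lborel g] by (auto simp: set_integrable_def)
  have g_box: "(LINT x:box a b|lborel. g x) = 0" for a b
  proof -
    have "(LINT x:box a b|lborel. g x) = (LINT x:box a b|lebesgue. g x)"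
      unfolding set_lebesgue_integral_def by (rule integral_completion[symmetric]) auto
    also have "\<dots> = (LINT x:box a b|lebesgue. f x)"
      unfolding set_lebesgue_integral_def
      by (rule integral_cong_AE)
        (use fg' in \<open>auto intro!: borel_measurable_times borel_measurable_integrable[OF int]
          intro: measurable_completion\<close>)
    finally show ?thesis using box by simp
  qed
  let ?E = "range (\<lambda>(a, b). box a b::'a set)"
  let ?A = "\<lambda>n::nat. box (- (real n *\<^sub>R One)) (real n *\<^sub>R One) :: 'a set"
  \<comment> \<open>The complement step of the induction needs the integral over the whole space,
    which is an increasing union of boxes.\<close>
  have "(\<lambda>n. LINT x:?A n|lborel. g x) \<longlonglongrightarrow> (LINT x:(\<Union>n. ?A n)|lborel. g x)"
  proof (rule set_integral_cont_up)
    show "incseq ?A"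
      by (auto simp: incseq_def mem_box; smt (verit) of_nat_mono inner_sum_left_Basis)
    show "set_integrable lborel (\<Union>n. ?A n) g" by (rule g_set) auto
  qed auto
  then have g_UNIV: "(LINT x:UNIV|lborel. g x) = 0"
    by (simp add: g_box UN_box_eq_UNIV LIMSEQ_const_iff)
  have "(LINT x:A|lborel. g x) = 0" if "A \<in> sets borel" for A
  proof -
    have "Int_stable ?E" by (auto simp: Int_stable_def box_Int_box)
    moreover have "?E \<subseteq> Pow UNIV" by auto
    moreover have "A \<in> sigma_sets UNIV ?E"
      using that by (simp add: borel_eq_box)
    ultimately show ?thesis
    proof (induct rule: sigma_sets_induct_disjoint)
      case (basic A)
      then show ?case using g_box by auto
    next
      case empty
      then show ?case by (simp add: set_lebesgue_integral_def)
    next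
      case (compl A)
      then have A: "A \<in> sets borel" by (simp add: borel_eq_box)
      have "(LINT x:A \<union> (UNIV - A)|lborel. g x) = (LINT x:A|lborel. g x) + (LINT x:UNIV - A|lborel. g x)"
        by (rule set_integral_Un) (use A in \<open>auto intro: g_set\<close>)
      then show ?case using g_UNIV compl by simp
    next
      case (union A)
      then have A: "range A \<subseteq> sets borel" by (simp add: borel_eq_box image_subset_iff)
      have "(LINT x:(\<Union>i. A i)|lborel. g x) = (\<Sum>i. (LINT x:(A i)|lborel. g x))"
        by (rule lebesgue_integral_countable_add)
          (use A union in \<open>auto simp: disjoint_family_on_def intro!: g_set\<close>)
      then show ?case using union by simp
    qed
  qed
  then have "AE x in lborel. g x = 0"
    by (intro density_unique_real[OF g_int]) auto
  with fg show ?thesis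
    by (intro AE_completion) auto
qed

text \<open>As \<open>m\<close> grows these smooth functions with values in [0, 1] tend to the
  indicator of the open box, so integrals against them determine integrals over boxes.\<close>

definition bump_box :: "nat \<Rightarrow> real^'n \<Rightarrow> real^'n \<Rightarrow> real^'n \<Rightarrow> real" where
  "bump_box m a b x = (\<Prod>i\<in>UNIV. bump (real (Suc m) * (x $ i - a $ i)) * bump (real (Suc m) * (b $ i - x $ i)))"

lemma bump_nonneg: "0 \<le> bump t" and bump_le_1: "bump t \<le> 1"
  by (auto simp: bump_eq)

lemma bump_box_bounds: "0 \<le> bump_box m a b x" "bump_box m a b x \<le> 1"
  by (auto simp: bump_box_def bump_nonneg bump_le_1 intro!: prod_nonneg prod_le_1 mult_le_one)

lemma bump_box_eq_0_iff: "bump_box m a b x = 0 \<longleftrightarrow> x \<notin> box a b"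
proof -
  have "real (Suc m) * t > 0 \<longleftrightarrow> t > 0" for t
    by (simp add: zero_less_mult_iff)
  then show ?thesis
    by (auto simp: bump_box_def bump_eq mem_box_cart)
qed

lemma Ck_bump_box: "Ck k (bump_box m a b)"
  unfolding bump_box_def[abs_def]
  by (intro Ck_prod Ck_mult Ck_expfun Ck_diff Ck_const Ck_component) auto

lemma test_functionsI:
  assumes "\<And>k. Ck k \<phi>" "compact K" "K \<subseteq> \<Omega>" "\<And>x. x \<notin> K \<Longrightarrow> \<phi> x = 0"
  shows "\<phi> \<in> test_functions \<Omega>"
proof -
  have "closure {x. \<phi> x \<noteq> 0} \<subseteq> K"
    by (rule closure_minimal) (use assms in \<open>auto intro: compact_imp_closed\<close>)
  moreover from this have "compact (closure {x. \<phi> x \<noteq> 0})"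
    using assms(2) by (meson bounded_subset closed_closure compact_eq_bounded_closed)
  ultimately show ?thesis
    using assms by (auto simp: test_functions_def)
qed

lemma bump_box_test: "cbox a b \<subseteq> \<Omega> \<Longrightarrow> bump_box m a b \<in> test_functions \<Omega>"
  using box_subset_cbox[of a b]
  by (intro test_functionsI[of _ "cbox a b"] Ck_bump_box) (auto simp: bump_box_eq_0_iff)

lemma bump_tendsto: "t > 0 \<Longrightarrow> (\<lambda>m. bump (real (Suc m) * t)) \<longlonglongrightarrow> 1"
proof -
  assume t: "t > 0"
  have "(\<lambda>m. exp (- (inverse (real (Suc m)) * (1 / t)))) \<longlonglongrightarrow> exp (- (0 * (1 / t)))"
    by (intro tendsto_intros LIMSEQ_inverse_real_of_nat)
  then show ?thesis
    using t by (auto simp: bump_eq field_simps add_pos_nonneg)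
qed

lemma bump_box_tendsto: "(\<lambda>m. bump_box m a b x) \<longlonglongrightarrow> indicator (box a b) x"
proof (cases "x \<in> box a b")
  case True
  then have "(\<lambda>m. bump_box m a b x) \<longlonglongrightarrow> (\<Prod>i\<in>(UNIV::'a set). 1 * 1)"
    unfolding bump_box_def by (intro tendsto_intros bump_tendsto) (auto simp: mem_box_cart)
  with True show ?thesis by simp
next
  case False
  then have "bump_box m a b x = 0" for m by (simp add: bump_box_eq_0_iff)
  with False show ?thesis by simp
qed

text \<open>Only product test functions occur in the hypothesis: their mixed partial derivatives
  visibly commute.\<close>

lemma fundamental_lemma:
  fixes w :: "real^'n \<Rightarrow> real"
  assumes \<Omega>: "open \<Omega>" and w: "locally_integrable_on w \<Omega>"
    and zero: "\<And>m a b. cbox a b \<subseteq> \<Omega> \<Longrightarrow> (LINT x:\<Omega>|lebesgue. w x * bump_box m a b x) = 0"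
  shows "AE x in lebesgue. x \<in> \<Omega> \<longrightarrow> w x = 0"
proof -
  have cb: "AE x in lebesgue. x \<in> cbox a b \<longrightarrow> w x = 0" if ab: "cbox a b \<subseteq> \<Omega>" for a b
  proof -
    let ?f = "\<lambda>x. indicator (cbox a b) x * w x"
    have f_int: "integrable lebesgue ?f"
      using w ab by (auto simp: locally_integrable_on_def set_integrable_def)
    have AEb: "AE x in lebesgue. x \<in> cbox a b \<longrightarrow> x \<in> box a b"
      using AE_not_in[OF negligible_frontier_interval[of a b, unfolded negligible_iff_null_sets]]
      by eventually_elim auto
    have fb0: "(LINT x:box c d|lebesgue. ?f x) = 0" if cd: "cbox c d \<subseteq> cbox a b" for c d
    proof -
      have "(\<lambda>m. LINT x|lebesgue. bump_box m c d x * ?f x) \<longlonglongrightarrow> (LINT x|lebesgue. indicator (box c d) x * ?f x)"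
      proof (rule integral_dominated_convergence[where w = "\<lambda>x. norm (?f x)"])
        show "(\<lambda>x. indicator (box c d) x * ?f x) \<in> borel_measurable lebesgue"
          by (intro borel_measurable_times borel_measurable_indicator borel_measurable_integrable[OF f_int]) auto
        have "bump_box m c d \<in> borel_measurable borel" for m
          using Ck_bump_box[of 0] by (auto intro: borel_measurable_continuous_onI)
        then have [measurable]: "bump_box m c d \<in> borel_measurable lebesgue" for m
          by (auto intro: measurable_completion)
        show "(\<lambda>x. bump_box m c d x * ?f x) \<in> borel_measurable lebesgue" for m
          by (intro borel_measurable_times borel_measurable_integrable[OF f_int]) simp
        show "AE x in lebesgue. (\<lambda>m. bump_box m c d x * ?f x) \<longlonglongrightarrow> indicator (box c d) x * ?f x"
          by (intro AE_I2 tendsto_mult bump_box_tendsto tendsto_const)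
        show "integrable lebesgue (\<lambda>x. norm (?f x))"
          using f_int by (rule integrable_norm)
        show "AE x in lebesgue. norm (bump_box m c d x * ?f x) \<le> norm (?f x)" for m
          using bump_box_bounds[of m c d]
          by (intro AE_I2) (simp add: abs_mult mult_left_le_one_le)
      qed
      moreover have "(LINT x|lebesgue. bump_box m c d x * ?f x) = 0" for m
      proof -
        have "bump_box m c d x * ?f x = indicator \<Omega> x *\<^sub>R (w x * bump_box m c d x)" for x
          using ab cd box_subset_cbox[of c d] by (auto simp: indicator_def bump_box_eq_0_iff)
        then have eq: "(\<lambda>x. bump_box m c d x * ?f x) = (\<lambda>x. indicator \<Omega> x *\<^sub>R (w x * bump_box m c d x))"
          by (rule ext)
        show ?thesis
          unfolding eq using zero[of c d m] ab cd unfolding set_lebesgue_integral_def by (meson order_trans)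
      qed
      ultimately show ?thesis
        by (simp add: set_lebesgue_integral_def LIMSEQ_const_iff)
    qed
    \<comment> \<open>So far only boxes inside \<open>cbox a b\<close> are covered. An arbitrary box
      may be intersected with \<open>box a b\<close>, because \<open>?f\<close> vanishes off
      \<open>cbox a b\<close> and the frontier is a null set.\<close>
    have "(LINT x:box c d|lebesgue. ?f x) = 0" for c d
    proof -
      obtain c' d' where *: "box c d \<inter> box a b = box c' d'"
        by (rule that[OF box_Int_box])
      have "(LINT x:box c d|lebesgue. ?f x) = (LINT x:box c' d'|lebesgue. ?f x)"
        unfolding set_lebesgue_integral_def
      proof (rule integral_cong_AE)
        show "AE x in lebesgue. indicat_real (box c d) x *\<^sub>R ?f x = indicat_real (box c' d') x *\<^sub>R ?f x"
          using AEb by eventually_elim (use * in \<open>auto simp: indicator_def\<close>)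
      qed (auto intro!: borel_measurable_times borel_measurable_indicator borel_measurable_integrable[OF f_int, simplified])
      also have "\<dots> = 0"
      proof (cases "box c' d' = {}")
        case False
        then have "cbox c' d' \<subseteq> cbox a b"
          using * closure_box[of c' d'] closure_mono[of "box c' d'" "cbox a b"] box_subset_cbox[of a b]
          by (metis closed_cbox closure_closed inf.cobounded2 order_trans)
        then show ?thesis by (rule fb0)
      qed (simp add: set_lebesgue_integral_def)
      finally show ?thesis .
    qed
    from AE_eq_0_if_box_integrals[OF f_int this]
    show ?thesis by eventually_elim (auto simp: indicator_def)
  qed
  obtain D where D: "countable D" "D \<subseteq> Pow \<Omega>" "\<And>X. X \<in> D \<Longrightarrow> \<exists>a b. X = cbox a b" "\<Union>D = \<Omega>"
    using open_countable_Union_open_cbox[OF \<Omega>] by blast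
  have "AE x in lebesgue. \<forall>X\<in>D. x \<in> X \<longrightarrow> w x = 0"
    unfolding AE_ball_countable[OF D(1)]
  proof
    fix X assume "X \<in> D"
    then obtain a b where "X = cbox a b" "cbox a b \<subseteq> \<Omega>" using D by blast
    with cb show "AE x in lebesgue. x \<in> X \<longrightarrow> w x = 0" by auto
  qed
  then show ?thesis by eventually_elim (use D in auto)
qed

section \<open>Weak derivatives\<close>

lemma DERIV_prod_components:
  fixes h h' :: "'n::finite \<Rightarrow> real \<Rightarrow> real"
  assumes "\<And>k t. (h k has_real_derivative h' k t) (at t)"
  shows "(\<lambda>x::real^'n. \<Prod>k\<in>UNIV. h k (x $ k)) differentiable (at x)"
    and "partial i (\<lambda>x::real^'n. \<Prod>k\<in>UNIV. h k (x $ k)) x = (\<Prod>k\<in>UNIV. (h(i := h' i)) k (x $ k))"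
proof -
  have c: "((\<lambda>x::real^'n. x $ k) has_derivative (\<lambda>y. y $ k)) (at x)" for k
    by (rule bounded_linear_imp_has_derivative, rule bounded_linear_vec_nth)
  have "((\<lambda>x::real^'n. h k (x $ k)) has_derivative (\<lambda>y. h' k (x $ k) * y $ k)) (at x)" for k
    using has_derivative_compose[OF c assms[of k "x $ k", unfolded has_field_derivative_def]] .
  then have D: "((\<lambda>x::real^'n. \<Prod>k\<in>UNIV. h k (x $ k)) has_derivative
      (\<lambda>y. \<Sum>k\<in>UNIV. h' k (x $ k) * y $ k * (\<Prod>j\<in>UNIV - {k}. h j (x $ j)))) (at x)"
    by (intro has_derivative_prod)
  then show "(\<lambda>x::real^'n. \<Prod>k\<in>UNIV. h k (x $ k)) differentiable (at x)"
    by (auto simp: differentiable_def)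
  have "partial i (\<lambda>x::real^'n. \<Prod>k\<in>UNIV. h k (x $ k)) x =
      (\<Sum>k\<in>UNIV. (if k = i then h' k (x $ k) * (\<Prod>j\<in>UNIV - {k}. h j (x $ j)) else 0))"
    unfolding has_derivative_imp_partial[OF D] by (rule sum.cong) (auto simp: axis_def)
  also have "\<dots> = h' i (x $ i) * (\<Prod>j\<in>UNIV - {i}. h j (x $ j))"
    by simp
  also have "\<dots> = (\<Prod>k\<in>UNIV. (h(i := h' i)) k (x $ k))"
    by (subst prod.remove[of UNIV i]) auto
  finally show "partial i (\<lambda>x::real^'n. \<Prod>k\<in>UNIV. h k (x $ k)) x = \<dots>" .
qed

text \<open>A partial derivative replaces one factor of the product by its derivative. For distinct
  indices two different factors are replaced, and function updates at different places
  commute.\<close>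

lemma partial_commute_prod_components:
  fixes h h' h'' :: "'n::finite \<Rightarrow> real \<Rightarrow> real"
  assumes h': "\<And>k t. (h k has_real_derivative h' k t) (at t)"
    and h'': "\<And>k t. (h' k has_real_derivative h'' k t) (at t)"
  shows "partial i (partial j (\<lambda>x::real^'n. \<Prod>k\<in>UNIV. h k (x $ k))) =
    partial j (partial i (\<lambda>x::real^'n. \<Prod>k\<in>UNIV. h k (x $ k)))"
proof (cases "i = j")
  case False
  have *: "partial i (partial j (\<lambda>x::real^'n. \<Prod>k\<in>UNIV. h k (x $ k))) =
    (\<lambda>x. \<Prod>k\<in>UNIV. (h(j := h' j, i := h' i)) k (x $ k))" if "i \<noteq> j" for i j
  proof -
    have "partial j (\<lambda>x::real^'n. \<Prod>k\<in>UNIV. h k (x $ k)) = (\<lambda>x. \<Prod>k\<in>UNIV. (h(j := h' j)) k (x $ k))"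
      using DERIV_prod_components(2)[of h h', OF h'] by auto
    moreover have "((h(j := h' j)) k has_real_derivative (h'(j := h'' j)) k t) (at t)" for k t
      using h' h'' by auto
    from DERIV_prod_components(2)[of "h(j := h' j)", OF this]
    have "partial i (\<lambda>x. \<Prod>k\<in>UNIV. (h(j := h' j)) k (x $ k)) =
      (\<lambda>x. \<Prod>k\<in>UNIV. (h(j := h' j, i := (h'(j := h'' j)) i)) k (x $ k))"
      by auto
    ultimately show ?thesis using that by simp
  qed
  show ?thesis using *[OF False] *[of j i] False by (auto simp: fun_upd_twist)
qed simp

lemma partial_commute_bump_box:
  "partial i (partial j (bump_box m a b)) = partial j (partial i (bump_box m a b))"
proof -
  define c where "c = real (Suc m)"
  define e1 e2 where "e1 = expfun ([:0, 0, 1:] * (1 - pderiv 1))"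
    and "e2 = expfun ([:0, 0, 1:] * (([:0, 0, 1:] * (1 - pderiv 1)) - pderiv ([:0, 0, 1:] * (1 - pderiv 1))))"
  have d: "(bump has_real_derivative e1 t) (at t)" "(e1 has_real_derivative e2 t) (at t)" for t
    unfolding e1_def e2_def by (rule DERIV_expfun)+
  note d' = DERIV_chain2[OF d(1)] DERIV_chain2[OF d(2)]
  show ?thesis
    unfolding bump_box_def[abs_def] c_def[symmetric]
    by (rule partial_commute_prod_components[where
      h' = "\<lambda>k t. c * e1 (c * (t - a $ k)) * bump (c * (b $ k - t)) - c * bump (c * (t - a $ k)) * e1 (c * (b $ k - t))"
      and h'' = "\<lambda>k t. c * (c * e2 (c * (t - a $ k)) * bump (c * (b $ k - t)) - c * e1 (c * (t - a $ k)) * e1 (c * (b $ k - t)))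
        - c * (c * e1 (c * (t - a $ k)) * e1 (c * (b $ k - t)) - c * bump (c * (t - a $ k)) * e2 (c * (b $ k - t)))"])
      (auto intro!: derivative_eq_intros d' simp: algebra_simps)
qed

lemma test_functionsE:
  assumes "\<phi> \<in> test_functions \<Omega>"
  obtains K where "compact K" "K \<subseteq> \<Omega>" "\<And>x. x \<notin> K \<Longrightarrow> \<phi> x = 0"
    "\<And>x. x \<notin> K \<Longrightarrow> eventually (\<lambda>y. \<phi> y = 0) (nhds x)"
proof
  let ?K = "closure {x. \<phi> x \<noteq> 0}"
  show "compact ?K" "?K \<subseteq> \<Omega>" using assms by (auto simp: test_functions_def)
  show *: "\<phi> x = 0" if "x \<notin> ?K" for x
    using that closure_subset[of "{x. \<phi> x \<noteq> 0}"] by auto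
  show "eventually (\<lambda>y. \<phi> y = 0) (nhds x)" if "x \<notin> ?K" for x
  proof -
    have "eventually (\<lambda>y. y \<in> - ?K) (nhds x)"
      by (rule eventually_nhds_in_open) (use that in \<open>simp_all add: open_Compl\<close>)
    then show ?thesis by (rule eventually_mono) (rule *, simp)
  qed
qed

lemma test_functions_Ck: "\<phi> \<in> test_functions \<Omega> \<Longrightarrow> Ck k \<phi>"
  by (auto simp: test_functions_def)

lemma test_functions_differentiable: "\<phi> \<in> test_functions \<Omega> \<Longrightarrow> \<phi> differentiable (at x)"
  using test_functions_Ck[of \<phi> \<Omega> 1] by simp

lemma test_functions_partial:
  assumes "\<phi> \<in> test_functions \<Omega>"
  shows "partial i \<phi> \<in> test_functions \<Omega>"
proof -
  obtain K where K: "compact K" "K \<subseteq> \<Omega>" "\<And>x. x \<notin> K \<Longrightarrow> eventually (\<lambda>y. \<phi> y = 0) (nhds x)"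
    using test_functionsE[OF assms] by metis
  show ?thesis
  proof (rule test_functionsI[OF _ K(1,2)])
    show "Ck k (partial i \<phi>)" for k using test_functions_Ck[OF assms, of "Suc k"] by simp
    show "partial i \<phi> x = 0" if "x \<notin> K" for x
      using partial_cong_eventually[OF K(3)[OF that], of i] by simp
  qed
qed

lemma test_functions_mult:
  assumes "\<phi> \<in> test_functions \<Omega>" "\<And>k. Ck k g"
  shows "(\<lambda>x. g x * \<phi> x) \<in> test_functions \<Omega>"
proof -
  obtain K where K: "compact K" "K \<subseteq> \<Omega>" "\<And>x. x \<notin> K \<Longrightarrow> \<phi> x = 0"
    using test_functionsE[OF assms(1)] by metis
  then show ?thesis
    using assms by (intro test_functionsI[OF _ K(1,2)]) (auto intro: Ck_mult test_functions_Ck)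
qed

lemma test_functions_bounded:
  assumes "\<phi> \<in> test_functions \<Omega>"
  obtains B where "B > 0" "\<And>x. \<bar>\<phi> x\<bar> \<le> B"
proof -
  obtain K where K: "compact K" "K \<subseteq> \<Omega>" "\<And>x. x \<notin> K \<Longrightarrow> \<phi> x = 0"
    using test_functionsE[OF assms(1)] by metis
  have "continuous_on K \<phi>"
    using test_functions_Ck[OF assms, of 0] by (auto intro: continuous_on_subset)
  then have "bounded (\<phi> ` K)"
    using K(1) by (intro compact_imp_bounded compact_continuous_image)
  then obtain B where "B > 0" "\<And>x. x \<in> K \<Longrightarrow> \<bar>\<phi> x\<bar> \<le> B"
    unfolding bounded_pos by auto
  with K(3) show ?thesis by (intro that[of B]) force+
qed

lemma test_functions_measurable [measurable_dest]:
  assumes "\<phi> \<in> test_functions \<Omega>"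
  shows "\<phi> \<in> borel_measurable borel"
  using test_functions_Ck[OF assms, of 0] by (auto intro: borel_measurable_continuous_onI)

lemma set_integrable_bounded_mult:
  fixes u g :: "real^'n \<Rightarrow> real"
  assumes "set_integrable lebesgue K u" "g \<in> borel_measurable lebesgue" "\<And>x. \<bar>g x\<bar> \<le> B"
  shows "set_integrable lebesgue K (\<lambda>x. u x * g x)"
  unfolding set_integrable_def
proof (rule Bochner_Integration.integrable_bound)
  show "integrable lebesgue (\<lambda>x. B * (indicator K x * u x))"
    using assms(1) by (auto simp: set_integrable_def)
  have "(\<lambda>x. (indicator K x * u x) * g x) \<in> borel_measurable lebesgue"
    by (rule borel_measurable_times)
      (use assms(1,2) in \<open>auto simp: set_integrable_def intro: borel_measurable_integrable\<close>)
  then show "(\<lambda>x. indicat_real K x *\<^sub>R (u x * g x)) \<in> borel_measurable lebesgue"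
    by (simp add: mult.assoc)
  show "AE x in lebesgue. norm (indicat_real K x *\<^sub>R (u x * g x)) \<le> norm (B * (indicat_real K x * u x))"
  proof (rule AE_I2)
    fix x
    have "0 \<le> B" using assms(3)[of x] by linarith
    then show "norm (indicat_real K x *\<^sub>R (u x * g x)) \<le> norm (B * (indicat_real K x * u x))"
      using mult_right_mono[OF assms(3)[of x], of "\<bar>indicat_real K x * u x\<bar>"]
      by (simp only: abs_mult abs_of_nonneg real_norm_def real_scaleR_def mult_ac mult_nonneg_nonneg abs_ge_zero if_True simp_thms)
  qed
qed

lemma locally_integrable_test_integrable:
  fixes u :: "real^'n \<Rightarrow> real"
  assumes "locally_integrable_on u \<Omega>" "\<phi> \<in> test_functions \<Omega>"
  shows "set_integrable lebesgue \<Omega> (\<lambda>x. u x * \<phi> x)"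
proof -
  obtain K where K: "compact K" "K \<subseteq> \<Omega>" "\<And>x. x \<notin> K \<Longrightarrow> \<phi> x = 0"
    using test_functionsE[OF assms(2)] by metis
  obtain B where "\<And>x. \<bar>\<phi> x\<bar> \<le> B" using assms(2) test_functions_bounded by blast
  then have "set_integrable lebesgue K (\<lambda>x. u x * \<phi> x)"
    using assms K by (intro set_integrable_bounded_mult)
      (auto simp: locally_integrable_on_def intro!: measurable_completion test_functions_measurable)
  moreover have "indicat_real \<Omega> x *\<^sub>R (u x * \<phi> x) = indicat_real K x *\<^sub>R (u x * \<phi> x)" for x
    using K by (auto simp: indicator_def)
  then have "(\<lambda>x. indicat_real \<Omega> x *\<^sub>R (u x * \<phi> x)) = (\<lambda>x. indicat_real K x *\<^sub>R (u x * \<phi> x))"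
    by (rule ext)
  ultimately show ?thesis unfolding set_integrable_def by (simp only:)
qed

lemma has_weak_partialD:
  assumes "has_weak_partial \<Omega> i u v"
  shows "locally_integrable_on u \<Omega>" "locally_integrable_on v \<Omega>"
    "\<phi> \<in> test_functions \<Omega> \<Longrightarrow>
      (LINT x:\<Omega>|lebesgue. u x * partial i \<phi> x) = - (LINT x:\<Omega>|lebesgue. v x * \<phi> x)"
  using assms unfolding has_weak_partial_def by blast+

lemma locally_integrable_on_diff:
  "locally_integrable_on u \<Omega> \<Longrightarrow> locally_integrable_on v \<Omega> \<Longrightarrow> locally_integrable_on (\<lambda>x. u x - v x) \<Omega>"
  unfolding locally_integrable_on_def by (blast intro: set_integral_diff)

lemma weak_partial_unique:
  assumes "open \<Omega>" "has_weak_partial \<Omega> i u v" "has_weak_partial \<Omega> i u v'"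
  shows "AE x in lebesgue. x \<in> \<Omega> \<longrightarrow> v x = v' x"
proof -
  have li: "locally_integrable_on v \<Omega>" "locally_integrable_on v' \<Omega>"
    using assms has_weak_partialD(1,2) by blast+
  have "AE x in lebesgue. x \<in> \<Omega> \<longrightarrow> v x - v' x = 0"
  proof (rule fundamental_lemma[OF assms(1)])
    show "locally_integrable_on (\<lambda>x. v x - v' x) \<Omega>"
      using li by (rule locally_integrable_on_diff)
    fix m a b assume "cbox a b \<subseteq> \<Omega>"
    then have t: "bump_box m a b \<in> test_functions \<Omega>" by (rule bump_box_test)
    have "(LINT x:\<Omega>|lebesgue. v x * bump_box m a b x - v' x * bump_box m a b x) = 0"
      using has_weak_partialD(3)[OF assms(2) t] has_weak_partialD(3)[OF assms(3) t] t li
      by (subst set_integral_diff) (simp_all add: locally_integrable_test_integrable)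
    then show "(LINT x:\<Omega>|lebesgue. (v x - v' x) * bump_box m a b x) = 0"
      by (simp add: algebra_simps)
  qed
  then show ?thesis by eventually_elim auto
qed

lemma weak_partial_works:
  assumes "has_weak_partial \<Omega> i u v"
  shows "has_weak_partial \<Omega> i u (weak_partial \<Omega> i u)"
  unfolding weak_partial_def using assms by (rule someI[of "has_weak_partial \<Omega> i u"])

lemma weak_partial_AE_eq:
  assumes "open \<Omega>" "has_weak_partial \<Omega> i u v"
  shows "AE x in lebesgue. x \<in> \<Omega> \<longrightarrow> weak_partial \<Omega> i u x = v x"
  using weak_partial_unique[OF assms(1) weak_partial_works[OF assms(2)] assms(2)] .

lemma set_integral_cong_AE':
  fixes u v g :: "'a::euclidean_space \<Rightarrow> real"
  assumes "AE x in lebesgue. x \<in> \<Omega> \<longrightarrow> u x = v x"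
    "set_integrable lebesgue \<Omega> (\<lambda>x. u x * g x)" "set_integrable lebesgue \<Omega> (\<lambda>x. v x * g x)"
  shows "(LINT x:\<Omega>|lebesgue. u x * g x) = (LINT x:\<Omega>|lebesgue. v x * g x)"
  unfolding set_lebesgue_integral_def
proof (rule integral_cong_AE)
  show "AE x in lebesgue. indicat_real \<Omega> x *\<^sub>R (u x * g x) = indicat_real \<Omega> x *\<^sub>R (v x * g x)"
    using assms(1) by eventually_elim (auto simp: indicator_def)
qed (use assms in \<open>auto simp: set_integrable_def intro: borel_measurable_integrable\<close>)

text \<open>The link between the arbitrary representative chosen by \<open>weak_partial\<close> and
  the explicit or Borel representatives with which the computations are made.\<close>

lemma has_weak_partial_cong_AE:
  assumes "has_weak_partial \<Omega> i u v" "locally_integrable_on u' \<Omega>" "locally_integrable_on v' \<Omega>"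
    and u: "AE x in lebesgue. x \<in> \<Omega> \<longrightarrow> u x = u' x" and v: "AE x in lebesgue. x \<in> \<Omega> \<longrightarrow> v x = v' x"
  shows "has_weak_partial \<Omega> i u' v'"
  unfolding has_weak_partial_def
proof (intro conjI ballI assms(2,3))
  fix \<phi> assume \<phi>: "\<phi> \<in> test_functions \<Omega>"
  then have \<phi>': "partial i \<phi> \<in> test_functions \<Omega>" by (rule test_functions_partial)
  have li: "locally_integrable_on u \<Omega>" "locally_integrable_on v \<Omega>"
    using assms has_weak_partialD(1,2) by blast+
  note int = locally_integrable_test_integrable
  have "(LINT x:\<Omega>|lebesgue. u' x * partial i \<phi> x) = (LINT x:\<Omega>|lebesgue. u x * partial i \<phi> x)"
    by (rule set_integral_cong_AE'[OF u int int, symmetric]; fact)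
  also have "\<dots> = - (LINT x:\<Omega>|lebesgue. v x * \<phi> x)"
    by (rule has_weak_partialD(3); fact)
  also have "(LINT x:\<Omega>|lebesgue. v x * \<phi> x) = (LINT x:\<Omega>|lebesgue. v' x * \<phi> x)"
    by (rule set_integral_cong_AE'[OF v int int]; fact)
  finally show "(LINT x:\<Omega>|lebesgue. u' x * partial i \<phi> x) = - (LINT x:\<Omega>|lebesgue. v' x * \<phi> x)" .
qed

text \<open>Two integrations by parts move both derivatives onto the same bump, whose mixed partial
  derivatives commute. This yields the symmetry of the weak Hessian, without which the bending
  density has no lower bound.\<close>

lemma weak_partial_commute:
  assumes "open \<Omega>" "has_weak_partial \<Omega> i u a" "has_weak_partial \<Omega> j a b"
    "has_weak_partial \<Omega> j u a'" "has_weak_partial \<Omega> i a' b'"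
  shows "AE x in lebesgue. x \<in> \<Omega> \<longrightarrow> b x = b' x"
proof -
  have li: "locally_integrable_on b \<Omega>" "locally_integrable_on b' \<Omega>"
    using assms has_weak_partialD(1,2) by blast+
  have "AE x in lebesgue. x \<in> \<Omega> \<longrightarrow> b x - b' x = 0"
  proof (rule fundamental_lemma[OF assms(1)])
    show "locally_integrable_on (\<lambda>x. b x - b' x) \<Omega>"
      using li by (rule locally_integrable_on_diff)
    fix m c d assume "cbox c d \<subseteq> \<Omega>"
    then have t: "bump_box m c d \<in> test_functions \<Omega>" by (rule bump_box_test)
    let ?t = "bump_box m c d"
    have "(LINT x:\<Omega>|lebesgue. b x * ?t x) = (LINT x:\<Omega>|lebesgue. u x * partial i (partial j ?t) x)"
      using has_weak_partialD(3)[OF assms(3) t]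
        has_weak_partialD(3)[OF assms(2) test_functions_partial[OF t]] by simp
    moreover have "(LINT x:\<Omega>|lebesgue. b' x * ?t x) = (LINT x:\<Omega>|lebesgue. u x * partial j (partial i ?t) x)"
      using has_weak_partialD(3)[OF assms(5) t]
        has_weak_partialD(3)[OF assms(4) test_functions_partial[OF t]] by simp
    ultimately have "(LINT x:\<Omega>|lebesgue. b x * ?t x - b' x * ?t x) = 0"
      using t li by (subst set_integral_diff)
        (simp_all add: locally_integrable_test_integrable partial_commute_bump_box[of i j])
    then show "(LINT x:\<Omega>|lebesgue. (b x - b' x) * ?t x) = 0"
      by (simp add: algebra_simps)
  qed
  then show ?thesis by eventually_elim auto
qed

section \<open>Sobolev spaces and square integrability\<close>

lemma SobolevE:
  assumes "u \<in> Sobolev (Suc k) \<Omega>"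
  obtains v where "v \<in> Sobolev k \<Omega>" "has_weak_partial \<Omega> i u v"
  using assms by auto

lemma Sobolev_subset_L2: "Sobolev k \<Omega> \<subseteq> L2 \<Omega>"
  by (cases k) auto

lemma L2_mult_integrable:
  assumes "u \<in> L2 \<Omega>" "v \<in> L2 \<Omega>"
  shows "integrable (lebesgue_on \<Omega>) (\<lambda>x. u x * v x)"
proof (rule Bochner_Integration.integrable_bound)
  show "integrable (lebesgue_on \<Omega>) (\<lambda>x. (u x)\<^sup>2 + (v x)\<^sup>2)"
    using assms by (auto simp: L2_def)
  show "(\<lambda>x. u x * v x) \<in> borel_measurable (lebesgue_on \<Omega>)"
    using assms by (auto simp: L2_def)
  have "\<bar>a * b\<bar> \<le> a\<^sup>2 + b\<^sup>2" for a b :: real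
    using sum_squares_bound[of a b] sum_squares_bound[of a "-b"] zero_le_power2[of a] zero_le_power2[of b]
    by (simp add: abs_le_iff)
  then show "AE x in lebesgue_on \<Omega>. norm (u x * v x) \<le> norm ((u x)\<^sup>2 + (v x)\<^sup>2)"
    by (auto intro: AE_I2)
qed

lemma const_L2: "\<Omega> \<in> lmeasurable \<Longrightarrow> (\<lambda>x. c) \<in> L2 \<Omega>"
  using finite_measure.integrable_const[OF finite_measure_lebesgue_on, of \<Omega> "c\<^sup>2"]
  by (auto simp: L2_def)

lemma L2_integrable: "\<Omega> \<in> lmeasurable \<Longrightarrow> u \<in> L2 \<Omega> \<Longrightarrow> integrable (lebesgue_on \<Omega>) u"
  using L2_mult_integrable[OF _ const_L2, of u \<Omega> 1] by simp

lemma bounded_L2: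
  assumes "\<Omega> \<in> lmeasurable" "u \<in> borel_measurable (lebesgue_on \<Omega>)"
    "AE x in lebesgue_on \<Omega>. \<bar>u x\<bar> \<le> B"
  shows "u \<in> L2 \<Omega>"
proof -
  have "integrable (lebesgue_on \<Omega>) (\<lambda>x. (u x)\<^sup>2)"
  proof (rule Bochner_Integration.integrable_bound)
    show "integrable (lebesgue_on \<Omega>) (\<lambda>x. B\<^sup>2)"
      using const_L2[OF assms(1), of B] by (simp add: L2_def)
    show "(\<lambda>x. (u x)\<^sup>2) \<in> borel_measurable (lebesgue_on \<Omega>)"
      using assms(2) by measurable
    show "AE x in lebesgue_on \<Omega>. norm ((u x)\<^sup>2) \<le> norm (B\<^sup>2)"
      using assms(3) by eventually_elim (auto simp: abs_le_square_iff[symmetric])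
  qed
  with assms(2) show ?thesis by (simp add: L2_def)
qed

lemma set_integrable_iff_lebesgue_on:
  "\<Omega> \<in> sets lebesgue \<Longrightarrow> set_integrable lebesgue \<Omega> u \<longleftrightarrow> integrable (lebesgue_on \<Omega>) u"
  for u :: "'a::euclidean_space \<Rightarrow> real"
  by (simp add: set_integrable_def integrable_restrict_space)

lemma set_integral_eq_lebesgue_on:
  "\<Omega> \<in> sets lebesgue \<Longrightarrow> (LINT x:\<Omega>|lebesgue. u x) = integral\<^sup>L (lebesgue_on \<Omega>) u"
  for u :: "'a::euclidean_space \<Rightarrow> real"
  by (simp add: set_lebesgue_integral_def integral_restrict_space)

lemma AE_lebesgue_on_iff:
  "\<Omega> \<in> sets lebesgue \<Longrightarrow> (AE x in lebesgue_on \<Omega>. P x) \<longleftrightarrow> (AE x in lebesgue. x \<in> \<Omega> \<longrightarrow> P x)"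
  by (simp add: AE_restrict_space_iff)

section \<open>Locally Lipschitz functions\<close>

text \<open>The local form is stable under products without bounds on the factors; a uniform
  constant on compact sets is recovered in \<open>loc_lip_compact\<close>.\<close>

definition loc_lip :: "('a::metric_space \<Rightarrow> real) \<Rightarrow> 'a \<Rightarrow> bool" where
  "loc_lip f x \<longleftrightarrow> (\<exists>e>0. \<exists>L. L-lipschitz_on (ball x e) f)"

lemma loc_lip_const [simp]: "loc_lip (\<lambda>x. c) x"
  unfolding loc_lip_def by (intro exI[of _ "1::real"] exI[of _ "0::real"] conjI lipschitz_on_constant) auto

lemma loc_lip_cong:
  assumes "loc_lip f x" "eventually (\<lambda>y. g y = f y) (nhds x)"
  shows "loc_lip g x"
proof -
  obtain e L where e: "e > 0" "L-lipschitz_on (ball x e) f"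
    using assms(1) by (auto simp: loc_lip_def)
  obtain d where d: "d > 0" "\<And>y. dist y x < d \<Longrightarrow> g y = f y"
    using assms(2) by (auto simp: eventually_nhds_metric)
  have "L-lipschitz_on (ball x (min d e)) f"
    using e(2) by (rule lipschitz_on_mono) auto
  then have "L-lipschitz_on (ball x (min d e)) g"
    by (rule lipschitz_on_transform) (use d in \<open>auto simp: dist_commute\<close>)
  with d e show ?thesis
    unfolding loc_lip_def by (intro exI[of _ "min d e"] exI[of _ L]) auto
qed

lemma loc_lip_add:
  assumes "loc_lip f x" "loc_lip g x"
  shows "loc_lip (\<lambda>y. f y + g y) x"
proof -
  obtain e L where e: "e > 0" "L-lipschitz_on (ball x e) f"
    using assms(1) by (auto simp: loc_lip_def)
  obtain d M where d: "d > 0" "M-lipschitz_on (ball x d) g"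
    using assms(2) by (auto simp: loc_lip_def)
  have "(L + M)-lipschitz_on (ball x (min d e)) (\<lambda>y. f y + g y)"
    by (intro lipschitz_on_add lipschitz_on_mono[OF e(2)] lipschitz_on_mono[OF d(2)]) auto
  with d e show ?thesis
    unfolding loc_lip_def by (intro exI[of _ "min d e"] exI[of _ "L + M"]) auto
qed

lemma loc_lip_mult:
  assumes "loc_lip f x" "loc_lip g x"
  shows "loc_lip (\<lambda>y. f y * g y) x"
proof -
  obtain e L where e: "e > 0" "L-lipschitz_on (ball x e) f"
    using assms(1) by (auto simp: loc_lip_def)
  obtain d M where d: "d > 0" "M-lipschitz_on (ball x d) g"
    using assms(2) by (auto simp: loc_lip_def)
  let ?r = "min d e"
  have L: "L \<ge> 0" "M \<ge> 0" using e d lipschitz_on_nonneg by blast+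
  have bf: "\<bar>f y\<bar> \<le> \<bar>f x\<bar> + L * ?r" if "y \<in> ball x ?r" for y
  proof -
    have "\<bar>f y - f x\<bar> \<le> L * dist y x"
      using lipschitz_onD[OF e(2), of y x] that e by (auto simp: dist_real_def)
    also have "\<dots> \<le> L * ?r" using that L by (intro mult_left_mono) (auto simp: dist_commute)
    finally show ?thesis by linarith
  qed
  have bg: "\<bar>g y\<bar> \<le> \<bar>g x\<bar> + M * ?r" if "y \<in> ball x ?r" for y
  proof -
    have "\<bar>g y - g x\<bar> \<le> M * dist y x"
      using lipschitz_onD[OF d(2), of y x] that d by (auto simp: dist_real_def)
    also have "\<dots> \<le> M * ?r" using that L by (intro mult_left_mono) (auto simp: dist_commute)
    finally show ?thesis by linarith
  qed
  let ?A = "\<bar>f x\<bar> + L * ?r" and ?B = "\<bar>g x\<bar> + M * ?r"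
  have AB: "?A \<ge> 0" "?B \<ge> 0" using L d e by auto
  have "(?A * M + L * ?B)-lipschitz_on (ball x ?r) (\<lambda>y. f y * g y)"
  proof (rule lipschitz_onI)
    fix y z assume yz: "y \<in> ball x ?r" "z \<in> ball x ?r"
    have "\<bar>f y * g y - f z * g z\<bar> \<le> \<bar>f y\<bar> * \<bar>g y - g z\<bar> + \<bar>f y - f z\<bar> * \<bar>g z\<bar>"
    proof -
      have "f y * g y - f z * g z = f y * (g y - g z) + (f y - f z) * g z"
        by (simp add: algebra_simps)
      then show ?thesis using abs_triangle_ineq[of "f y * (g y - g z)" "(f y - f z) * g z"]
        by (simp add: abs_mult)
    qed
    also have "\<dots> \<le> ?A * (M * dist y z) + (L * dist y z) * ?B"
    proof (intro add_mono mult_mono)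
      show "\<bar>g y - g z\<bar> \<le> M * dist y z" "\<bar>f y - f z\<bar> \<le> L * dist y z"
        using lipschitz_onD[OF e(2), of y z] lipschitz_onD[OF d(2), of y z] yz by (simp_all add: dist_real_def)
    qed (fact bf[OF yz(1)] bg[OF yz(2)] AB | use L in simp)+
    finally show "dist (f y * g y) (f z * g z) \<le> (?A * M + L * ?B) * dist y z"
      by (simp add: dist_real_def algebra_simps)
  qed (use AB L in auto)
  with d e show ?thesis
    unfolding loc_lip_def by (intro exI[of _ "min d e"] exI) auto
qed

lemma loc_lip_uminus: "loc_lip f x \<Longrightarrow> loc_lip (\<lambda>y. - f y) x"
  using loc_lip_mult[OF loc_lip_const[of "-1" x], of f] by simp

lemma loc_lip_diff: "loc_lip f x \<Longrightarrow> loc_lip g x \<Longrightarrow> loc_lip (\<lambda>y. f y - g y) x"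
  using loc_lip_add[OF _ loc_lip_uminus, of f x g] by simp

lemma loc_lip_abs: "loc_lip f x \<Longrightarrow> loc_lip (\<lambda>y. \<bar>f y\<bar>) x"
  unfolding loc_lip_def lipschitz_on_def dist_real_def
  by (meson abs_triangle_ineq3 order_trans)

lemma loc_lip_component: "loc_lip (\<lambda>y::real^'n. y $ i) x"
  unfolding loc_lip_def
  by (intro exI[of _ "1::real"] conjI lipschitz_onI) (auto simp: dist_vec_nth_le)

lemma loc_lip_imp_isCont: 
  assumes "loc_lip f x"
  shows "isCont f x"
proof -
  obtain e L where e: "e > 0" "L-lipschitz_on (ball x e) f"
    using assms(1) by (auto simp: loc_lip_def)
  from lipschitz_on_continuous_on[OF e(2)] e(1) show ?thesis
    by (simp add: continuous_on_eq_continuous_at)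
qed

lemma loc_lip_compact:
  assumes "compact X" "\<And>x. x \<in> X \<Longrightarrow> loc_lip f x"
  obtains L where "L-lipschitz_on X f"
proof -
  \<comment> \<open>The compactness theorem concerns families of maps depending on time; it is
    applied to the constant family over a single instant.\<close>
  have "local_lipschitz {0::real} X (\<lambda>_. f)"
    unfolding local_lipschitz_def
  proof (intro ballI)
    fix x t assume "x \<in> X"
    then obtain e L where e: "e > 0" "L-lipschitz_on (ball x e) f"
      using assms(2)[of x] by (auto simp: loc_lip_def)
    have "L-lipschitz_on (cball x (e/2) \<inter> X) f"
      by (rule lipschitz_on_mono[OF e(2)]) (use e in auto)
    with e show "\<exists>u>0. \<exists>L. \<forall>t\<in>cball t u \<inter> {0::real}. L-lipschitz_on (cball x u \<inter> X) f"
      by (intro exI[of _ "e/2"]) auto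
  qed
  from local_lipschitz_compact_implies_lipschitz[OF this assms(1)] that show ?thesis
    by (metis compact_sing continuous_on_const singletonI)
qed

lemma Ck_imp_loc_lip:
  fixes f :: "real^'n \<Rightarrow> real"
  assumes "Ck 1 f"
  shows "loc_lip f x"
proof -
  have diff: "f differentiable (at y)" and cont: "continuous_on UNIV (partial i f)" for y i
    using assms by auto
  let ?S = "\<lambda>y. \<Sum>i\<in>UNIV. \<bar>partial i f y\<bar>"
  have "continuous_on (cball x 1) ?S"
    by (intro continuous_intros) (auto intro: continuous_on_subset[OF cont])
  then have "bounded (?S ` cball x 1)"
    by (intro compact_imp_bounded compact_continuous_image) auto
  then obtain B where B: "\<forall>y\<in>cball x 1. \<bar>?S y\<bar> \<le> B"
    unfolding bounded_iff by (auto simp del: mem_cball)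
  have "B-lipschitz_on (ball x 1) f"
  proof (rule bounded_derivative_imp_lipschitz)
    show "(f has_derivative (\<lambda>h. \<Sum>i\<in>UNIV. h $ i * partial i f y)) (at y within ball x 1)" for y
      using differentiable_imp_has_derivative_partial[OF diff] by (rule has_derivative_at_withinI)
    show "onorm (\<lambda>h. \<Sum>i\<in>UNIV. h $ i * partial i f y) \<le> B" if "y \<in> ball x 1" for y
    proof (rule onorm_le)
      fix h :: "real^'n"
      have "norm (\<Sum>i\<in>UNIV. h $ i * partial i f y) \<le> (\<Sum>i\<in>UNIV. \<bar>h $ i * partial i f y\<bar>)"
        using sum_abs by auto
      also have "\<dots> \<le> (\<Sum>i\<in>UNIV. norm h * \<bar>partial i f y\<bar>)"
        by (intro sum_mono) (auto simp: abs_mult intro!: mult_right_mono component_le_norm_cart)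
      also have "\<dots> \<le> norm h * B"
        using B[rule_format, of y] that by (auto simp: sum_distrib_left[symmetric] intro!: mult_left_mono)
      finally show "norm (\<Sum>i\<in>UNIV. h $ i * partial i f y) \<le> B * norm h" by (simp add: mult.commute)
    qed
    show "0 \<le> B" using order_trans[OF abs_ge_zero B[rule_format, of x]] by simp
  qed auto
  then show ?thesis unfolding loc_lip_def by (intro exI[of _ "1::real"]) auto
qed

section \<open>Classical and weak derivatives of Lipschitz functions\<close>

lemma borel_measurable_AE_limit:
  fixes f :: "nat \<Rightarrow> 'a \<Rightarrow> real"
  assumes f: "\<And>m. f m \<in> borel_measurable (completion M)"
    and lim: "AE x in completion M. (\<lambda>m. f m x) \<longlonglongrightarrow> g x"
  shows "g \<in> borel_measurable (completion M)"
proof (rule measurableI)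
  let ?g = "\<lambda>x. lim (\<lambda>m. f m x)"
  have g: "?g \<in> borel_measurable (completion M)"
    using f by (rule borel_measurable_lim_metric)
  fix A :: "real set" assume A: "A \<in> sets borel"
  show "g -` A \<inter> space (completion M) \<in> sets (completion M)"
  proof (rule completion.in_sets_AE)
    show "?g -` A \<inter> space (completion M) \<in> sets (completion M)"
      using g A by (rule measurable_sets)
    show "AE x in completion M. (x \<in> ?g -` A \<inter> space (completion M)) = (x \<in> g -` A \<inter> space (completion M))"
      using lim by eventually_elim (auto simp: limI)
  qed auto
qed auto

lemma partial_quotient_tendsto:
  fixes u :: "real^'n \<Rightarrow> real"
  assumes "u differentiable (at x)"
  shows "(\<lambda>m. (u (x + inverse (real (Suc m)) *\<^sub>R axis i 1) - u x) / inverse (real (Suc m))) \<longlonglongrightarrow> partial i u x"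
proof -
  let ?D = "frechet_derivative u (at x)"
  have D: "(u has_derivative ?D) (at x)" using assms frechet_derivative_works by blast
  then interpret linear ?D by (rule has_derivative_linear)
  have "((\<lambda>t. x + t *\<^sub>R axis i 1) has_derivative (\<lambda>t. t *\<^sub>R axis i 1)) (at 0)"
    by (auto intro!: derivative_eq_intros)
  then have "((\<lambda>t. u (x + t *\<^sub>R axis i 1)) has_derivative (\<lambda>t. ?D (t *\<^sub>R axis i 1))) (at 0)"
    by (rule has_derivative_compose) (simp add: D)
  moreover have "(\<lambda>t. ?D (t *\<^sub>R axis i 1)) = (*) (partial i u x)"
    by (auto simp: scaleR partial_def mult.commute)
  ultimately have "((\<lambda>t. u (x + t *\<^sub>R axis i 1)) has_field_derivative partial i u x) (at 0)"
    by (simp add: has_field_derivative_def)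
  then have lim: "((\<lambda>h. (u (x + h *\<^sub>R axis i 1) - u x) / h) \<longlongrightarrow> partial i u x) (at 0)"
    by (simp add: DERIV_def)
  have "filterlim (\<lambda>m. inverse (real (Suc m))) (at 0) sequentially"
    unfolding filterlim_at by (intro conjI LIMSEQ_inverse_real_of_nat) auto
  from filterlim_compose[OF lim this] show ?thesis .
qed

text \<open>Where \<open>u\<close> is not differentiable, \<open>partial\<close> has an unspecified
  value, so measurability comes from the difference quotients: they converge almost everywhere, and
  Lebesgue measure is complete. Extending \<open>u\<close> by 0 makes them defined everywhere, and
  for small increments they are quotients of \<open>u\<close> because \<Omega> is open.\<close>

lemma partial_borel_measurable:
  fixes u :: "real^'n \<Rightarrow> real"
  assumes \<Omega>: "open \<Omega>" and cont: "continuous_on \<Omega> u"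
    and diff: "AE x in lebesgue. x \<in> \<Omega> \<longrightarrow> u differentiable (at x)"
  shows "partial i u \<in> borel_measurable (lebesgue_on \<Omega>)"
proof -
  let ?u = "\<lambda>x. indicator \<Omega> x *\<^sub>R u x"
  let ?h = "\<lambda>m. inverse (real (Suc m)) *\<^sub>R axis i (1::real) :: real^'n"
  have u: "?u \<in> borel_measurable borel"
    by (rule borel_measurable_continuous_on_indicator) (use \<Omega> cont in auto)
  have "(\<lambda>x. indicator \<Omega> x * partial i u x) \<in> borel_measurable lebesgue"
  proof (rule borel_measurable_AE_limit)
    show "(\<lambda>x. indicator \<Omega> x * ((?u (x + ?h m) - ?u x) / inverse (real (Suc m)))) \<in> borel_measurable lebesgue" for m
    proof (rule measurable_completion)
      have "(\<lambda>x. ?u (x + ?h m)) \<in> borel_measurable borel"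
        by (rule measurable_compose[OF _ u]) measurable
      moreover have "indicat_real \<Omega> \<in> borel_measurable borel" using \<Omega> by simp
      ultimately show "(\<lambda>x. indicator \<Omega> x * ((?u (x + ?h m) - ?u x) / inverse (real (Suc m)))) \<in> borel_measurable lborel"
        using u by measurable
    qed
    show "AE x in lebesgue. (\<lambda>m. indicator \<Omega> x * ((?u (x + ?h m) - ?u x) / inverse (real (Suc m))))
        \<longlonglongrightarrow> indicator \<Omega> x * partial i u x"
      using diff
    proof eventually_elim
      case (elim x)
      show ?case
      proof (cases "x \<in> \<Omega>")
        case True
        have "?h \<longlonglongrightarrow> 0 *\<^sub>R axis i 1"
          by (intro tendsto_intros LIMSEQ_inverse_real_of_nat)
        then have "(\<lambda>m. x + ?h m) \<longlonglongrightarrow> x + 0 *\<^sub>R axis i 1"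
          by (rule tendsto_add[OF tendsto_const])
        then have ev: "eventually (\<lambda>m. x + ?h m \<in> \<Omega>) sequentially"
          using topological_tendstoD[of "\<lambda>m. x + ?h m" x sequentially \<Omega>] \<Omega> True by simp
        have "(\<lambda>m. (u (x + ?h m) - u x) / inverse (real (Suc m))) \<longlonglongrightarrow> partial i u x"
          using elim True by (intro partial_quotient_tendsto) auto
        then have "(\<lambda>m. (u (x + ?h m) - u x) / inverse (real (Suc m))) \<longlonglongrightarrow> indicator \<Omega> x * partial i u x"
          using True by simp
        then show ?thesis
          by (rule Lim_transform_eventually)
            (use ev True in \<open>auto elim!: eventually_mono\<close>)
      qed simp
    qed
  qed
  then show ?thesis
    using \<Omega> by (subst borel_measurable_restrict_space_iff) auto
qed

text \<open>The difference quotients of w = u \<phi> have integral zero by translation invariance. A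
  Lipschitz constant on a ball dominates them, and almost everywhere they converge to the
  product-rule expression for the derivative of w. The limit of the zero integrals is integration by
  parts.\<close>

lemma loc_lip_weak_partial:
  fixes u :: "real^'n \<Rightarrow> real"
  assumes \<Omega>: "open \<Omega>" "bounded \<Omega>" and lip: "\<And>x. x \<in> \<Omega> \<Longrightarrow> loc_lip u x"
    and diff: "AE x in lebesgue. x \<in> \<Omega> \<longrightarrow> u differentiable (at x)"
    and bound: "\<And>x. x \<in> \<Omega> \<Longrightarrow> \<bar>u x\<bar> \<le> B" "AE x in lebesgue. x \<in> \<Omega> \<longrightarrow> \<bar>partial i u x\<bar> \<le> B"
  shows "has_weak_partial \<Omega> i u (partial i u)" "u \<in> L2 \<Omega>" "partial i u \<in> L2 \<Omega>"
proof -
  have lm: "\<Omega> \<in> lmeasurable"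
    using \<Omega> by (simp add: lmeasurable_open)
  have cont: "continuous_on \<Omega> u"
    using lip loc_lip_imp_isCont by (intro continuous_at_imp_continuous_on) auto
  have "u \<in> borel_measurable (lebesgue_on \<Omega>)"
    using cont \<Omega> by (intro continuous_imp_measurable_on_sets_lebesgue) auto
  then show uL2: "u \<in> L2 \<Omega>"
    using bound(1) lm by (intro bounded_L2[of _ _ B]) (auto intro!: AE_I2)
  have "partial i u \<in> borel_measurable (lebesgue_on \<Omega>)"
    by (rule partial_borel_measurable[OF \<Omega>(1) cont diff])
  then show vL2: "partial i u \<in> L2 \<Omega>"
    using bound(2) lm \<Omega> by (intro bounded_L2[of _ _ B]) (auto simp: AE_lebesgue_on_iff)
  have li: "locally_integrable_on f \<Omega>" if "f \<in> L2 \<Omega>" for f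
    unfolding locally_integrable_on_def
  proof (intro allI impI)
    fix K assume K: "compact K" "K \<subseteq> \<Omega>"
    have "set_integrable lebesgue \<Omega> f"
      using L2_integrable[OF lm that] \<Omega> by (simp add: set_integrable_iff_lebesgue_on)
    then show "set_integrable lebesgue K f"
      by (rule set_integrable_subset) (use K in \<open>auto intro: lmeasurable_compact fmeasurableD\<close>)
  qed
  show "has_weak_partial \<Omega> i u (partial i u)"
    unfolding has_weak_partial_def
  proof (intro conjI ballI li uL2 vL2)
    fix \<phi> assume \<phi>: "\<phi> \<in> test_functions \<Omega>"
    obtain K where K: "compact K" "K \<subseteq> \<Omega>" "\<And>x. x \<notin> K \<Longrightarrow> \<phi> x = 0"
      "\<And>x. x \<notin> K \<Longrightarrow> eventually (\<lambda>y. \<phi> y = 0) (nhds x)"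
      using test_functionsE[OF \<phi>] by metis
    define w where "w = (\<lambda>x. u x * \<phi> x)"
    have w0: "w x = 0" if "x \<notin> K" for x using K that by (simp add: w_def)
    have wlip: "loc_lip w x" for x
    proof (cases "x \<in> K")
      case True
      then show ?thesis
        unfolding w_def using K(2) lip test_functions_Ck[OF \<phi>] by (blast intro: loc_lip_mult Ck_imp_loc_lip[of \<phi>])
    next
      case False
      show ?thesis
        by (rule loc_lip_cong[OF loc_lip_const[of 0]])
          (use K(4)[OF False] in \<open>auto elim!: eventually_mono simp: w_def\<close>)
    qed
    obtain R where R: "R > 0" "K \<subseteq> cball 0 R"
      using compact_imp_bounded[OF K(1)] by (auto simp: bounded_pos subset_iff)
    \<comment> \<open>The increments have length at most 1, so a quotient can differ from 0 only
      when both of its points lie in the ball of radius R + 1.\<close>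
    obtain L where L: "L-lipschitz_on (cball 0 (R + 1)) w"
      using loc_lip_compact[of "cball 0 (R + 1)" w] wlip by auto
    have wcont: "continuous_on UNIV w"
      using wlip loc_lip_imp_isCont by (intro continuous_at_imp_continuous_on) auto
    then have wm [measurable]: "w \<in> borel_measurable borel"
      by (rule borel_measurable_continuous_onI)
    let ?e = "axis i (1::real) :: real^'n"
    let ?d = "\<lambda>m. inverse (real (Suc m))"
    have d01: "0 < ?d m" "?d m \<le> 1" for m by (auto simp: field_simps)
    have quot: "\<bar>(w (x + ?d m *\<^sub>R ?e) - w x) / ?d m\<bar> \<le> L * indicator (cball 0 (R + 1)) x" for m x
    proof -
      have L0: "L \<ge> 0" using L lipschitz_on_nonneg by blast
      have n1: "norm (x + ?d m *\<^sub>R ?e) \<le> norm x + 1" "norm x \<le> norm (x + ?d m *\<^sub>R ?e) + 1"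
        using norm_triangle_ineq[of x "?d m *\<^sub>R ?e"] norm_triangle_ineq4[of "x + ?d m *\<^sub>R ?e" "?d m *\<^sub>R ?e"] d01(2)[of m]
        by (simp_all del: of_nat_Suc)
      show ?thesis
      proof (cases "w x = 0 \<and> w (x + ?d m *\<^sub>R ?e) = 0")
        case True
        then show ?thesis using L0 by simp
      next
        case False
        then have "x \<in> K \<or> x + ?d m *\<^sub>R ?e \<in> K" using w0 by blast
        then have "norm x \<le> R \<or> norm (x + ?d m *\<^sub>R ?e) \<le> R" using R by auto
        then have in1: "x \<in> cball 0 (R + 1)" and "x + ?d m *\<^sub>R ?e \<in> cball 0 (R + 1)"
          using n1 by auto
        then have "\<bar>w (x + ?d m *\<^sub>R ?e) - w x\<bar> \<le> L * dist (x + ?d m *\<^sub>R ?e) x"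
          using lipschitz_onD[OF L] by (auto simp: dist_real_def)
        also have "dist (x + ?d m *\<^sub>R ?e) x = ?d m"
          using d01(1)[of m] by (simp add: dist_norm del: of_nat_Suc)
        finally have "\<bar>w (x + ?d m *\<^sub>R ?e) - w x\<bar> / ?d m \<le> L"
          using d01(1)[of m] by (subst pos_divide_le_eq) auto
        then show ?thesis using in1 d01(1)[of m] by (simp add: abs_divide del: of_nat_Suc)
      qed
    qed
    have wint: "integrable lborel w"
    proof -
      have "bounded (w ` K)"
        using K(1) by (intro compact_imp_bounded compact_continuous_image continuous_on_subset[OF wcont]) auto
      then obtain M where M: "\<And>x. x \<in> K \<Longrightarrow> \<bar>w x\<bar> \<le> M"
        unfolding bounded_iff by auto
      show ?thesis
      proof (rule Bochner_Integration.integrable_bound)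
      show "integrable lborel (\<lambda>x. indicat_real K x * M)"
        using K(1) by (intro integrable_mult_left integrable_real_indicator)
          (use emeasure_bounded_finite[OF compact_imp_bounded[OF K(1)]] in \<open>auto intro: borel_compact simp: less_top\<close>)
      show "AE x in lborel. norm (w x) \<le> norm (indicat_real K x * M)"
        using M w0 by (intro AE_I2) (auto simp: indicator_def intro: order_trans[OF M])
      qed simp
    qed
    have shift: "integrable lborel (\<lambda>x. w (x + h))" "(LINT x|lborel. w (x + h)) = (LINT x|lborel. w x)" for h
    proof -
      have *: "distr lborel borel (\<lambda>x. h + x) = lborel" by (rule lborel_distr_plus)
      have "integrable (distr lborel borel (\<lambda>x. h + x)) w" unfolding * by (rule wint)
      then show "integrable lborel (\<lambda>x. w (x + h))"
        by (subst (asm) integrable_distr_eq) (auto simp: add.commute)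
      have "(LINT x|distr lborel borel (\<lambda>x. h + x). w x) = (LINT x|lborel. w (h + x))"
        by (rule integral_distr) auto
      then show "(LINT x|lborel. w (x + h)) = (LINT x|lborel. w x)"
        unfolding * by (simp add: add.commute)
    qed
    let ?q = "\<lambda>m x. (w (x + ?d m *\<^sub>R ?e) - w x) / ?d m"
    have q0: "(LINT x|lborel. ?q m x) = 0" for m
      using shift[of "?d m *\<^sub>R ?e"] wint by (subst integral_divide_zero) auto
    let ?g = "\<lambda>x. indicator \<Omega> x * (u x * partial i \<phi> x + partial i u x * \<phi> x)"
    have qm: "?q m \<in> borel_measurable borel" for m
      by measurable
    have lim: "AE x in lebesgue. (\<lambda>m. ?q m x) \<longlonglongrightarrow> ?g x"
      using diff
    proof eventually_elim
      case (elim x)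
      show ?case
      proof (cases "x \<in> \<Omega>")
        case True
        then have "w differentiable (at x)" "partial i w x = u x * partial i \<phi> x + partial i u x * \<phi> x"
          unfolding w_def using elim test_functions_differentiable[OF \<phi>]
          by (auto simp: partial_mult)
        with partial_quotient_tendsto[of w x i] True show ?thesis by simp
      next
        case False
        \<comment> \<open>Off \<Omega> the function \<open>w\<close> vanishes in a whole
          neighbourhood, so the quotients tend to 0 even at boundary points, where nothing is known
          about \<open>u\<close>.\<close>
        have "eventually (\<lambda>y. w y = 0) (nhds x)"
        proof (rule eventually_mono)
          show "eventually (\<lambda>y. \<phi> y = 0) (nhds x)" using K(4)[of x] False K(2) by blast
        qed (simp add: w_def)
        then have "eventually (\<lambda>y. 0 = w y) (nhds x)" by (auto elim!: eventually_mono)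
        moreover have "((\<lambda>y. 0) has_derivative (\<lambda>y. 0)) (at x)" by simp
        moreover have "w x = 0" using w0 K(2) False by blast
        ultimately have "(w has_derivative (\<lambda>y. 0)) (at x)"
          using has_derivative_transform_eventually[of "\<lambda>y. 0" "\<lambda>y. 0" x UNIV w]
          by (auto simp: eventually_nhds_conv_at)
        then have "w differentiable (at x)" "partial i w x = 0"
          by (auto simp: differentiable_def has_derivative_imp_partial)
        with partial_quotient_tendsto[of w x i] False show ?thesis by simp
      qed
    qed
    have gm: "?g \<in> borel_measurable lebesgue"
      by (rule borel_measurable_AE_limit[OF _ lim]) (use qm in \<open>auto intro: measurable_completion\<close>)
    have "(\<lambda>m. LINT x|lebesgue. ?q m x) \<longlonglongrightarrow> (LINT x|lebesgue. ?g x)"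
    proof (rule integral_dominated_convergence[OF gm _ _ lim])
      show "?q m \<in> borel_measurable lebesgue" for m using qm by (auto intro: measurable_completion)
      have "integrable lborel (\<lambda>x::real^'n. L * indicator (cball 0 (R + 1)) x)"
        by (intro integrable_mult_right integrable_real_indicator) (use emeasure_bounded_finite[OF bounded_cball] in \<open>auto simp: less_top\<close>)
      then show "integrable lebesgue (\<lambda>x::real^'n. L * indicator (cball 0 (R + 1)) x)"
        by (subst integrable_completion) auto
      show "AE x in lebesgue. norm (?q m x) \<le> L * indicator (cball 0 (R + 1)) x" for m
        using quot by (intro AE_I2) (simp only: real_norm_def)
    qed
    moreover have "(LINT x|lebesgue. ?q m x) = 0" for m
      using q0[of m] integral_completion[of "?q m" lborel] qm[of m] by simp
    ultimately have "(LINT x|lebesgue. ?g x) = 0"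
      by (simp add: LIMSEQ_const_iff)
    then have "(LINT x:\<Omega>|lebesgue. u x * partial i \<phi> x + partial i u x * \<phi> x) = 0"
      by (simp add: set_lebesgue_integral_def)
    then show "(LINT x:\<Omega>|lebesgue. u x * partial i \<phi> x) = - (LINT x:\<Omega>|lebesgue. partial i u x * \<phi> x)"
      using locally_integrable_test_integrable[OF li[OF uL2] test_functions_partial[OF \<phi>]]
        locally_integrable_test_integrable[OF li[OF vL2] \<phi>]
      by (subst (asm) set_integral_add) auto
  qed
qed

section \<open>Rotations\<close>

definition rot :: "real \<Rightarrow> real^2^2" where
  "rot t = vector [vector [cos t, - sin t], vector [sin t, cos t]]"

lemma rot_component [simp]:
  "(rot t *v p) $ 1 = cos t * p $ 1 - sin t * p $ 2"
  "(rot t *v p) $ 2 = sin t * p $ 1 + cos t * p $ 2"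
  by (simp_all add: rot_def matrix_vector_mult_def sum_2)

lemma rot_entries [simp]:
  "rot t $ 1 $ 1 = cos t" "rot t $ 1 $ 2 = - sin t" "rot t $ 2 $ 1 = sin t" "rot t $ 2 $ 2 = cos t"
  by (simp_all add: rot_def)

lemma rot_add: "rot s *v (rot t *v p) = rot (s + t) *v p"
  by (simp add: vec_eq_iff forall_2 cos_add sin_add algebra_simps)

lemma rot_0 [simp]: "rot 0 *v p = p"
  by (simp add: vec_eq_iff forall_2)

lemma rot_cancel [simp]: "rot (- t) *v (rot t *v p) = p" "rot t *v (rot (- t) *v p) = p"
  by (simp_all add: rot_add)

lemma norm_vec2: "norm (p :: real^2) = sqrt ((p $ 1)\<^sup>2 + (p $ 2)\<^sup>2)"
  by (simp add: norm_vec_def L2_set_def sum_2)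

lemma norm_rot [simp]: "norm (rot t *v p) = norm p"
proof -
  have "(cos t * p $ 1 - sin t * p $ 2)\<^sup>2 + (sin t * p $ 1 + cos t * p $ 2)\<^sup>2
    = ((sin t)\<^sup>2 + (cos t)\<^sup>2) * ((p $ 1)\<^sup>2 + (p $ 2)\<^sup>2)"
    unfolding power2_eq_square by (simp only: algebra_simps)
  then show ?thesis by (simp add: norm_vec2)
qed

lemma rot_measurable [measurable]: "(*v) (rot t) \<in> borel_measurable borel"
  by (intro borel_measurable_continuous_onI matrix_vector_mult_linear_continuous_on)

text \<open>A rotation has determinant 1 and so preserves the measure of boxes, which characterizes
  Lebesgue measure.\<close>

lemma distr_rot: "distr lborel borel ((*v) (rot t)) = lborel"
proof (rule lborel_eqI[symmetric])
  fix l u :: "real^2" assume lu: "\<And>b. b \<in> Basis \<Longrightarrow> l \<bullet> b \<le> u \<bullet> b"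
  have "(*v) (rot t) -` box l u = (*v) (rot (- t)) ` box l u"
    by (force simp: image_iff)
  moreover have "measure lebesgue ((*v) (rot (- t)) ` box l u) = measure lebesgue (box l u)"
    using measure_linear_image[of "(*v) (rot (- t))" "box l u"]
    by (simp add: det_2 power2_eq_square[symmetric])
  moreover have "(*v) (rot (- t)) ` box l u \<in> lmeasurable"
    by (rule measurable_linear_image) auto
  ultimately have "emeasure lebesgue ((*v) (rot t) -` box l u) = emeasure lebesgue (box l u)"
    by (simp add: emeasure_eq_measure2 lmeasurable_box)
  moreover have "(*v) (rot t) -` box l u \<in> sets lborel"
    using measurable_sets[OF rot_measurable, of "box l u" t] by simp
  ultimately have "emeasure lborel ((*v) (rot t) -` box l u) = emeasure lborel (box l u)"
    by simp
  with lu show "emeasure (distr lborel borel ((*v) (rot t))) (box l u) = (\<Prod>b\<in>Basis. (u - l) \<bullet> b)"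
    by (subst emeasure_distr) (auto simp: emeasure_lborel_box)
qed simp

lemma AE_rot:
  assumes "AE p in lebesgue. P p"
  shows "AE p in lebesgue. P (rot t *v p)"
proof -
  have "AE p in distr lborel borel ((*v) (rot t)). P p"
    unfolding distr_rot using assms by (simp add: AE_completion_iff)
  then have "AE p in lborel. P (rot t *v p)"
    by (rule AE_distrD[rotated]) simp
  then show ?thesis by (rule AE_completion)
qed

lemma integral_rot:
  fixes f :: "real^2 \<Rightarrow> real"
  assumes "f \<in> borel_measurable borel"
  shows "(LINT p|lborel. f (rot t *v p)) = (LINT p|lborel. f p)"
  using integral_distr[of "(*v) (rot t)" lborel borel f] assms by (simp add: distr_rot)

lemma nn_integral_rot:
  assumes "f \<in> borel_measurable borel"
  shows "(\<integral>\<^sup>+p. f (rot t *v p) \<partial>lborel) = (\<integral>\<^sup>+p. f p \<partial>lborel)"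
  using nn_integral_distr[of "(*v) (rot t)" lborel borel f] assms by (simp add: distr_rot)

lemma integrable_rot:
  fixes f :: "real^2 \<Rightarrow> real"
  assumes "f \<in> borel_measurable borel"
  shows "integrable lborel (\<lambda>p. f (rot t *v p)) \<longleftrightarrow> integrable lborel f"
  using integrable_distr_eq[of "(*v) (rot t)" lborel borel f] assms by (simp add: distr_rot)

text \<open>Joint continuity in angle and point is what measurability on the product space requires.
  The factor \<open>c\<close> covers both directions: 1 for the rotated derivative, -1 for the
  rotated test function.\<close>

lemma continuous_rot: "continuous_on UNIV (\<lambda>(t, p). rot (c * t) *v p)"
proof -
  have "rot (c * t) *v p = (cos (c * t) * p $ 1 - sin (c * t) * p $ 2) *\<^sub>R axis 1 1
    + (sin (c * t) * p $ 1 + cos (c * t) * p $ 2) *\<^sub>R axis 2 1" for t p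
    by (simp add: vec_eq_iff forall_2 axis_def)
  then show ?thesis
    by (auto simp: case_prod_beta intro!: continuous_intros)
qed

lemma rot_pair_measurable [measurable]:
  "(\<lambda>(t, p). rot (c * t) *v p) \<in> borel_measurable (lborel \<Otimes>\<^sub>M lborel)"
  using borel_measurable_continuous_onI[OF continuous_rot[of c]] by (simp add: lborel_prod)

text \<open>A bound on the slices that is uniform in t gives integrability over an interval of
  angles times the plane; this justifies the exchanges of integrals in
  \<open>rotation_difference_borel\<close>.\<close>

lemma integrable_slab:
  fixes h :: "real \<Rightarrow> real^2 \<Rightarrow> real"
  assumes m [measurable]: "(\<lambda>(t, p). h t p) \<in> borel_measurable (lborel \<Otimes>\<^sub>M lborel)"
    and b: "\<And>t. (\<integral>\<^sup>+p. ennreal (norm (h t p)) \<partial>lborel) \<le> ennreal C"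
  shows "integrable (lborel \<Otimes>\<^sub>M lborel) (\<lambda>(t, p). indicator {0..\<alpha>} t * h t p)"
proof (rule integrableI_bounded)
  have "(\<integral>\<^sup>+x. ennreal (norm (case x of (t, p) \<Rightarrow> indicator {0..\<alpha>} t * h t p)) \<partial>(lborel \<Otimes>\<^sub>M lborel))
     = (\<integral>\<^sup>+t. \<integral>\<^sup>+p. ennreal (norm (indicator {0..\<alpha>} t * h t p)) \<partial>lborel \<partial>lborel)"
    by (subst lborel.nn_integral_fst[symmetric]) (auto simp: case_prod_beta)
  also have "\<dots> \<le> (\<integral>\<^sup>+t. ennreal C * indicator {0..\<alpha>} t \<partial>lborel)"
  proof (rule nn_integral_mono)
    fix t :: real
    show "(\<integral>\<^sup>+p. ennreal (norm (indicator {0..\<alpha>} t * h t p)) \<partial>lborel) \<le> ennreal C * indicator {0..\<alpha>} t"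
      using b[of t] by (auto simp: indicator_def)
  qed
  also have "\<dots> < \<infinity>"
    by (subst nn_integral_cmult_indicator) (auto simp: ennreal_mult_less_top emeasure_lborel_Icc_eq)
  finally show "(\<integral>\<^sup>+x. ennreal (norm (case x of (t, p) \<Rightarrow> indicator {0..\<alpha>} t * h t p)) \<partial>(lborel \<Otimes>\<^sub>M lborel)) < \<infinity>" .
qed (simp add: case_prod_beta)

section \<open>Angular derivatives and rotation differences\<close>

definition angular :: "(real^2 \<Rightarrow> real) \<Rightarrow> real^2 \<Rightarrow> real" where
  "angular \<phi> p = p $ 1 * partial 2 \<phi> p - p $ 2 * partial 1 \<phi> p"

text \<open>\<open>angular\<close> is d/d\<theta>, the generator of the rotations, and therefore
  commutes with each of them.\<close>

lemma angular_rot: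
  assumes "\<phi> differentiable (at (rot t *v p))"
  shows "angular (\<lambda>p. \<phi> (rot t *v p)) p = angular \<phi> (rot t *v p)"
  unfolding angular_def partial_compose_linear(1)[OF assms] by (simp add: sum_2 algebra_simps)

lemma DERIV_rot:
  assumes "\<And>q. \<phi> differentiable (at q)"
  shows "((\<lambda>t. \<phi> (rot (- t) *v p)) has_real_derivative - angular \<phi> (rot (- t) *v p)) (at t)"
proof -
  let ?q = "rot (- t) *v p"
  have "((\<lambda>t. rot (- t) *v p) has_derivative (\<lambda>h. h *\<^sub>R vector [?q $ 2, - ?q $ 1])) (at t)"
    unfolding has_derivative_componentwise_within[of "\<lambda>t. rot (- t) *v p"]
    by (auto simp: Basis_vec_def inner_axis forall_2 intro!: derivative_eq_intros)
       (auto intro!: derivative_eq_intros simp: algebra_simps)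
  from has_derivative_compose[OF this differentiable_imp_has_derivative_partial[OF assms]]
  show ?thesis
    unfolding has_field_derivative_def
    by (rule has_derivative_eq_rhs) (auto simp: fun_eq_iff sum_2 angular_def algebra_simps)
qed

lemma test_functions_rot:
  assumes "\<phi> \<in> test_functions \<Omega>" and \<Omega>: "\<And>t p. rot t *v p \<in> \<Omega> \<longleftrightarrow> p \<in> \<Omega>"
  shows "(\<lambda>p. \<phi> (rot t *v p)) \<in> test_functions \<Omega>"
proof -
  obtain K where K: "compact K" "K \<subseteq> \<Omega>" "\<And>x. x \<notin> K \<Longrightarrow> \<phi> x = 0"
    using test_functionsE[OF assms(1)] by metis
  show ?thesis
  proof (rule test_functionsI)
    show "Ck k (\<lambda>p. \<phi> (rot t *v p))" for k
      by (rule Ck_compose_linear[OF test_functions_Ck[OF assms(1)]])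
    show "compact ((*v) (rot (- t)) ` K)"
      by (intro compact_continuous_image K matrix_vector_mult_linear_continuous_on)
    show "(*v) (rot (- t)) ` K \<subseteq> \<Omega>" using K \<Omega> by auto
    show "\<phi> (rot t *v p) = 0" if "p \<notin> (*v) (rot (- t)) ` K" for p
      using that K(3)[of "rot t *v p"] by (metis image_eqI rot_cancel(1))
  qed
qed

lemma integrable_bounded_mult:
  fixes f h :: "'a::euclidean_space \<Rightarrow> real"
  assumes "integrable lborel f" "h \<in> borel_measurable borel" "\<And>p. f p \<noteq> 0 \<Longrightarrow> \<bar>h p\<bar> \<le> N"
  shows "integrable lborel (\<lambda>p. f p * h p)"
proof (rule Bochner_Integration.integrable_bound)
  show "integrable lborel (\<lambda>p. N * f p)" using assms by simp
  show "(\<lambda>p. f p * h p) \<in> borel_measurable lborel"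
    using borel_measurable_integrable[OF assms(1)] assms(2) by simp
  have "\<bar>f p * h p\<bar> \<le> \<bar>N * f p\<bar>" for p
    using mult_left_mono[OF assms(3)[of p], of "\<bar>f p\<bar>"] assms(3)[of p]
    by (cases "f p = 0") (simp_all add: abs_mult mult.commute)
  then show "AE p in lborel. norm (f p * h p) \<le> norm (N * f p)" by auto
qed

lemma integrable_imp_locally_integrable:
  fixes w :: "real^'n \<Rightarrow> real"
  assumes "integrable lborel w"
  shows "locally_integrable_on w \<Omega>"
  unfolding locally_integrable_on_def set_integrable_def
proof (intro allI impI)
  fix K assume "compact K" "K \<subseteq> \<Omega>"
  have "integrable lebesgue w"
    using assms by (subst integrable_completion) auto
  then show "integrable lebesgue (\<lambda>p. indicat_real K p *\<^sub>R w p)"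
    by (rule integrable_mult_indicator[rotated]) (use \<open>compact K\<close> in \<open>auto intro: lmeasurable_compact fmeasurableD\<close>)
qed

lemma set_integral_eq_lborel:
  fixes g \<psi> :: "real^'n \<Rightarrow> real"
  assumes "g \<in> borel_measurable borel" "\<psi> \<in> borel_measurable borel" "\<And>p. p \<notin> \<Omega> \<Longrightarrow> g p * \<psi> p = 0"
  shows "(LINT p:\<Omega>|lebesgue. g p * \<psi> p) = (LINT p|lborel. g p * \<psi> p)"
proof -
  have "(\<lambda>p. indicator \<Omega> p *\<^sub>R (g p * \<psi> p)) = (\<lambda>p. g p * \<psi> p)"
  proof
    fix p show "indicator \<Omega> p *\<^sub>R (g p * \<psi> p) = g p * \<psi> p"
      using assms(3)[of p] by (cases "p \<in> \<Omega>") auto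
  qed
  then show ?thesis
    unfolding set_lebesgue_integral_def using assms by (simp add: integral_completion)
qed

text \<open>The rotation field (- p2, p1) is divergence free, so the coordinates can be moved inside
  the derivatives of the test function without producing a term of order zero.\<close>

lemma weak_angular:
  assumes w: "has_weak_partial \<Omega> 1 g d1" "has_weak_partial \<Omega> 2 g d2"
    and \<psi>: "\<psi> \<in> test_functions \<Omega>"
  shows "(LINT p:\<Omega>|lebesgue. g p * angular \<psi> p) = - (LINT p:\<Omega>|lebesgue. (p $ 1 * d2 p - p $ 2 * d1 p) * \<psi> p)"
proof -
  have x: "(\<lambda>p. p $ i * \<psi> p) \<in> test_functions \<Omega>" for i
    by (rule test_functions_mult[OF \<psi>]) simp
  have comp: "((\<lambda>p::real^2. p $ i) has_derivative (\<lambda>h. h $ i)) (at p)" for i p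
    by (rule bounded_linear_imp_has_derivative, rule bounded_linear_vec_nth)
  have pc: "partial j (\<lambda>p::real^2. p $ i) p = axis j 1 $ i" for i j p
    using has_derivative_imp_partial[OF comp] .
  have "partial j (\<lambda>p. p $ i * \<psi> p) p = axis j 1 $ i * \<psi> p + p $ i * partial j \<psi> p" for i j p
    using test_functions_differentiable[OF \<psi>] comp
    by (subst partial_mult) (auto simp: pc differentiable_def)
  then have ang: "angular \<psi> p = partial 2 (\<lambda>p. p $ 1 * \<psi> p) p - partial 1 (\<lambda>p. p $ 2 * \<psi> p) p" for p
    by (simp add: angular_def axis_def)
  have li: "locally_integrable_on g \<Omega>" "locally_integrable_on d1 \<Omega>" "locally_integrable_on d2 \<Omega>"
    using has_weak_partialD w by blast+
  note int = locally_integrable_test_integrable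
  have "(LINT p:\<Omega>|lebesgue. g p * angular \<psi> p) =
      (LINT p:\<Omega>|lebesgue. g p * partial 2 (\<lambda>p. p $ 1 * \<psi> p) p) - (LINT p:\<Omega>|lebesgue. g p * partial 1 (\<lambda>p. p $ 2 * \<psi> p) p)"
    unfolding ang right_diff_distrib
    by (rule set_integral_diff(2)) (intro int li test_functions_partial x)+
  also have "\<dots> = - ((LINT p:\<Omega>|lebesgue. d2 p * (p $ 1 * \<psi> p)) - (LINT p:\<Omega>|lebesgue. d1 p * (p $ 2 * \<psi> p)))"
    by (simp add: has_weak_partialD(3)[OF w(1) x] has_weak_partialD(3)[OF w(2) x])
  also have "(LINT p:\<Omega>|lebesgue. d2 p * (p $ 1 * \<psi> p)) - (LINT p:\<Omega>|lebesgue. d1 p * (p $ 2 * \<psi> p))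
    = (LINT p:\<Omega>|lebesgue. d2 p * (p $ 1 * \<psi> p) - d1 p * (p $ 2 * \<psi> p))"
    by (rule set_integral_diff(2)[symmetric]) (intro int li x)+
  also have "\<dots> = (LINT p:\<Omega>|lebesgue. (p $ 1 * d2 p - p $ 2 * d1 p) * \<psi> p)"
    by (simp add: algebra_simps)
  finally show ?thesis .
qed

text \<open>The fundamental theorem of calculus along circles, in weak form. The rotation is shifted
  to the test function, where the theorem holds classically; Fubini isolates each angle t,
  \<open>weak_angular\<close> moves the derivative to \<open>g\<close>, and a rotation moves the
  angle back. Since the functions are Borel and vanish off \<Omega>, all integrals run over the
  whole plane.\<close>

lemma rotation_difference_borel:
  fixes g d1 d2 :: "real^2 \<Rightarrow> real"
  defines "T \<equiv> \<lambda>p. p $ 1 * d2 p - p $ 2 * d1 p"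
  assumes \<Omega>: "open \<Omega>" "\<And>t p. rot t *v p \<in> \<Omega> \<longleftrightarrow> p \<in> \<Omega>"
    and w: "has_weak_partial \<Omega> 1 g d1" "has_weak_partial \<Omega> 2 g d2"
    and meas [measurable]: "g \<in> borel_measurable borel" "T \<in> borel_measurable borel"
    and zero: "\<And>p. p \<notin> \<Omega> \<Longrightarrow> g p = 0" "\<And>p. p \<notin> \<Omega> \<Longrightarrow> T p = 0"
    and int: "integrable lborel g" "integrable lborel T"
    and \<alpha>: "\<alpha> \<ge> 0"
  shows "AE p in lebesgue. p \<in> \<Omega> \<longrightarrow> g (rot \<alpha> *v p) - g p = (LINT t:{0..\<alpha>}|lborel. T (rot t *v p))"
proof -
  let ?I = "\<lambda>p. LINT t|lborel. indicator {0..\<alpha>} t * T (rot t *v p)"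
  have T_slab: "integrable (lborel \<Otimes>\<^sub>M lborel) (\<lambda>(t, p). indicator {0..\<alpha>} t * T (rot t *v p))"
  proof (rule integrable_slab)
    have "(\<lambda>x. T (case x of (t, p) \<Rightarrow> rot (1 * t) *v p)) \<in> borel_measurable (lborel \<Otimes>\<^sub>M lborel)"
      by (rule measurable_compose[OF rot_pair_measurable meas(2)])
    then show "(\<lambda>(t, p). T (rot t *v p)) \<in> borel_measurable (lborel \<Otimes>\<^sub>M lborel)"
      by (simp add: case_prod_beta)
    show "(\<integral>\<^sup>+p. ennreal (norm (T (rot t *v p))) \<partial>lborel) \<le> ennreal (LINT p|lborel. norm (T p))" for t
      using int(2) nn_integral_rot[of "\<lambda>p. ennreal (norm (T p))" t]
      by (subst nn_integral_eq_integral[symmetric]) auto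
  qed
  have I_int: "integrable lborel ?I"
    using lborel_pair.integrable_snd[OF T_slab] .
  have I_meas [measurable]: "?I \<in> borel_measurable borel"
    using borel_measurable_integrable[OF I_int] by simp
  let ?w = "\<lambda>p. g (rot \<alpha> *v p) - g p - ?I p"
  have g_rot: "integrable lborel (\<lambda>p. g (rot \<alpha> *v p))"
    using int(1) integrable_rot[OF meas(1)] by simp
  have w_int: "integrable lborel ?w"
    using int(1) g_rot I_int by auto
  have li: "locally_integrable_on ?w \<Omega>"
    using w_int by (rule integrable_imp_locally_integrable)
  have "AE p in lebesgue. p \<in> \<Omega> \<longrightarrow> ?w p = 0"
  proof (rule fundamental_lemma[OF \<Omega>(1) li])
    fix m a b assume "cbox a b \<subseteq> \<Omega>"
    define \<phi> where "\<phi> = bump_box m a b"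
    have \<phi>: "\<phi> \<in> test_functions \<Omega>" unfolding \<phi>_def by (rule bump_box_test) fact
    note [measurable] = test_functions_measurable[OF \<phi>]
    have \<phi>0: "p \<notin> \<Omega> \<Longrightarrow> \<phi> p = 0" for p using \<phi> test_functionsE by (metis subsetD)
    have \<phi>t: "(\<lambda>p. \<phi> (rot t *v p)) \<in> test_functions \<Omega>" for t
      by (rule test_functions_rot[OF \<phi> \<Omega>(2)])
    have diff: "\<phi> differentiable (at q)" for q by (rule test_functions_differentiable[OF \<phi>])
    obtain M where M: "M > 0" "\<And>p. \<bar>\<phi> p\<bar> \<le> M" using test_functions_bounded[OF \<phi>] by metis
    let ?a = "angular \<phi>"
    have a_cont: "continuous_on UNIV ?a"
      unfolding angular_def[abs_def] using test_functions_Ck[OF \<phi>, of 1]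
      by (intro continuous_intros) auto
    then have a_meas [measurable]: "?a \<in> borel_measurable borel"
      by (rule borel_measurable_continuous_onI)
    have a_test: "?a \<in> test_functions \<Omega>"
    proof -
      obtain K where K: "compact K" "K \<subseteq> \<Omega>" "\<And>x. x \<notin> K \<Longrightarrow> eventually (\<lambda>y. \<phi> y = 0) (nhds x)"
        using test_functionsE[OF \<phi>] by metis
      show ?thesis
      proof (rule test_functionsI[OF _ K(1,2)])
        show "Ck k ?a" for k
          unfolding angular_def[abs_def] using test_functions_Ck[OF \<phi>, of "Suc k"]
          by (intro Ck_diff Ck_mult Ck_component) auto
        show "?a x = 0" if "x \<notin> K" for x
          using partial_cong_eventually[OF K(3)[OF that]] by (simp add: angular_def)
      qed
    qed
    obtain B where B: "B > 0" "\<And>p. \<bar>?a p\<bar> \<le> B" using test_functions_bounded[OF a_test] by metis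
    have bint: "integrable lborel (\<lambda>p. F p * h p)"
      if "integrable lborel F" "h \<in> borel_measurable borel" "\<And>p. \<bar>h p\<bar> \<le> N" for F h :: "real^2 \<Rightarrow> real" and N
      using integrable_bounded_mult[OF that(1,2)] that(3) by blast
    have g_slab: "integrable (lborel \<Otimes>\<^sub>M lborel) (\<lambda>(t, p). indicator {0..\<alpha>} t * (g p * ?a (rot (- t) *v p)))"
    proof (rule integrable_slab)
      have "(\<lambda>x. ?a (case x of (t, p) \<Rightarrow> rot ((-1) * t) *v p)) \<in> borel_measurable (lborel \<Otimes>\<^sub>M lborel)"
        by (rule measurable_compose[OF rot_pair_measurable a_meas])
      then show "(\<lambda>(t, p). g p * ?a (rot (- t) *v p)) \<in> borel_measurable (lborel \<Otimes>\<^sub>M lborel)"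
        by (simp add: case_prod_beta)
      show "(\<integral>\<^sup>+p. ennreal (norm (g p * ?a (rot (- t) *v p))) \<partial>lborel) \<le> ennreal (LINT p|lborel. norm (B * g p))" for t
      proof -
        have "(\<integral>\<^sup>+p. ennreal (norm (g p * ?a (rot (- t) *v p))) \<partial>lborel) \<le> (\<integral>\<^sup>+p. ennreal (norm (B * g p)) \<partial>lborel)"
        proof (intro nn_integral_mono ennreal_leI)
          fix p
          show "norm (g p * ?a (rot (- t) *v p)) \<le> norm (B * g p)"
            using mult_left_mono[OF B(2)[of "rot (- t) *v p"], of "\<bar>g p\<bar>"] B(1)
            by (simp add: abs_mult mult.commute)
        qed
        also have "\<dots> = ennreal (LINT p|lborel. norm (B * g p))"
          using int(1) by (intro nn_integral_eq_integral) auto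
        finally show ?thesis .
      qed
    qed
    have ftc: "\<phi> (rot (- \<alpha>) *v p) - \<phi> p = (LINT t|lborel. indicator {0..\<alpha>} t * - ?a (rot (- t) *v p))" for p
    proof -
      have "(LINT t|lborel. indicator {0..\<alpha>} t *\<^sub>R (- ?a (rot (- t) *v p))) = \<phi> (rot (- \<alpha>) *v p) - \<phi> (rot (- 0) *v p)"
      proof (rule integral_FTC_Icc)
        show "((\<lambda>t. \<phi> (rot (- t) *v p)) has_vector_derivative - ?a (rot (- t) *v p)) (at t within {0..\<alpha>})" for t
          using DERIV_rot[of \<phi> p t, OF diff]
          by (simp add: has_real_derivative_iff_has_vector_derivative has_vector_derivative_at_within)
        have "continuous_on UNIV (\<lambda>t::real. (t, p))" by (intro continuous_intros)
        then have "continuous_on UNIV (\<lambda>t. rot ((-1) * t) *v p)"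
          using continuous_on_compose2[OF continuous_rot[of "-1"], of UNIV "\<lambda>t. (t, p)"] by simp
        then show "continuous_on {0..\<alpha>} (\<lambda>t. - ?a (rot (- t) *v p))"
          by (intro continuous_on_minus continuous_on_compose2[OF a_cont]) (auto intro: continuous_on_subset)
      qed (use \<alpha> in auto)
      then show ?thesis by simp
    qed
    have "(LINT p|lborel. g (rot \<alpha> *v p) * \<phi> p) = (LINT p|lborel. g p * \<phi> (rot (- \<alpha>) *v p))"
      using integral_rot[of "\<lambda>p. g p * \<phi> (rot (- \<alpha>) *v p)" \<alpha>] by simp
    then have "(LINT p|lborel. g (rot \<alpha> *v p) * \<phi> p) - (LINT p|lborel. g p * \<phi> p)
      = (LINT p|lborel. g p * (\<phi> (rot (- \<alpha>) *v p) - \<phi> p))"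
      using bint[OF int(1), of "\<lambda>p. \<phi> (rot (- \<alpha>) *v p)" M] bint[OF int(1), of \<phi> M] M(2)
      by (simp add: right_diff_distrib)
    also have "\<dots> = (LINT p|lborel. LINT t|lborel. indicator {0..\<alpha>} t * (- (g p * ?a (rot (- t) *v p))))"
      unfolding ftc by (subst integral_mult_right_zero[symmetric]) (simp add: mult_ac)
    also have "\<dots> = (LINT t|lborel. LINT p|lborel. indicator {0..\<alpha>} t * (- (g p * ?a (rot (- t) *v p))))"
    proof (rule lborel_pair.Fubini_integral)
      show "integrable (lborel \<Otimes>\<^sub>M lborel) (\<lambda>(t, p). indicator {0..\<alpha>} t * (- (g p * ?a (rot (- t) *v p))))"
        using integrable_minus[OF g_slab] by (simp add: case_prod_beta')
    qed
    also have "\<dots> = (LINT t|lborel. LINT p|lborel. indicator {0..\<alpha>} t * (T (rot t *v p) * \<phi> p))"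
    proof (rule Bochner_Integration.integral_cong[OF refl])
      fix t :: real
      have "(LINT p|lborel. g p * ?a (rot (- t) *v p)) = (LINT p|lborel. g p * angular (\<lambda>p. \<phi> (rot (- t) *v p)) p)"
        by (simp add: angular_rot diff)
      also have "\<dots> = (LINT p:\<Omega>|lebesgue. g p * angular (\<lambda>p. \<phi> (rot (- t) *v p)) p)"
        by (rule set_integral_eq_lborel[symmetric]) (use zero in \<open>auto simp: angular_rot diff\<close>)
      also have "\<dots> = - (LINT p:\<Omega>|lebesgue. T p * \<phi> (rot (- t) *v p))"
        unfolding T_def by (rule weak_angular[OF w \<phi>t])
      also have "(LINT p:\<Omega>|lebesgue. T p * \<phi> (rot (- t) *v p)) = (LINT p|lborel. T p * \<phi> (rot (- t) *v p))"
        by (rule set_integral_eq_lborel) (use zero in auto)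
      also have "\<dots> = (LINT p|lborel. T (rot t *v p) * \<phi> p)"
        using integral_rot[of "\<lambda>p. T p * \<phi> (rot (- t) *v p)" t] by simp
      finally show "(LINT p|lborel. indicator {0..\<alpha>} t * (- (g p * ?a (rot (- t) *v p)))) =
          (LINT p|lborel. indicator {0..\<alpha>} t * (T (rot t *v p) * \<phi> p))"
        by simp
    qed
    also have "\<dots> = (LINT p|lborel. LINT t|lborel. indicator {0..\<alpha>} t * (T (rot t *v p) * \<phi> p))"
    proof (rule lborel_pair.Fubini_integral[symmetric])
      show "integrable (lborel \<Otimes>\<^sub>M lborel) (\<lambda>(t, p). indicator {0..\<alpha>} t * (T (rot t *v p) * \<phi> p))"
      proof (rule Bochner_Integration.integrable_bound)
        show "integrable (lborel \<Otimes>\<^sub>M lborel) (\<lambda>x. M * (case x of (t, p) \<Rightarrow> indicator {0..\<alpha>} t * T (rot t *v p)))"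
          using T_slab by simp
        have "(\<lambda>x. (case x of (t, p) \<Rightarrow> indicator {0..\<alpha>} t * T (rot t *v p)) * \<phi> (snd x)) \<in> borel_measurable (lborel \<Otimes>\<^sub>M lborel)"
          using borel_measurable_integrable[OF T_slab] by measurable
        then show "(\<lambda>(t, p). indicator {0..\<alpha>} t * (T (rot t *v p) * \<phi> p)) \<in> borel_measurable (lborel \<Otimes>\<^sub>M lborel)"
          by (simp add: case_prod_beta mult.assoc)
        show "AE x in lborel \<Otimes>\<^sub>M lborel. norm (case x of (t, p) \<Rightarrow> indicator {0..\<alpha>} t * (T (rot t *v p) * \<phi> p))
          \<le> norm (M * (case x of (t, p) \<Rightarrow> indicator {0..\<alpha>} t * T (rot t *v p)))"
        proof (rule AE_I2)
          fix x :: "real \<times> (real^2)"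
          show "norm (case x of (t, p) \<Rightarrow> indicator {0..\<alpha>} t * (T (rot t *v p) * \<phi> p))
          \<le> norm (M * (case x of (t, p) \<Rightarrow> indicator {0..\<alpha>} t * T (rot t *v p)))"
            using mult_left_mono[OF M(2)[of "snd x"], of "\<bar>T (rot (fst x) *v snd x)\<bar>"] M(1)
            by (auto simp: case_prod_beta abs_mult mult_ac indicator_def)
        qed
      qed
    qed
    also have "\<dots> = (LINT p|lborel. ?I p * \<phi> p)"
      by (subst integral_mult_left_zero[symmetric]) (simp add: mult_ac)
    finally have "(LINT p|lborel. g (rot \<alpha> *v p) * \<phi> p) - (LINT p|lborel. g p * \<phi> p) - (LINT p|lborel. ?I p * \<phi> p) = 0"
      by simp
    then have "(LINT p|lborel. ?w p * \<phi> p) = 0"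
      using bint[OF int(1), of \<phi> M] bint[OF g_rot, of \<phi> M] bint[OF I_int, of \<phi> M] M(2)
      by (simp add: left_diff_distrib)
    moreover have "(LINT p:\<Omega>|lebesgue. ?w p * \<phi> p) = (LINT p|lborel. ?w p * \<phi> p)"
      by (rule set_integral_eq_lborel) (use \<phi>0 in auto)
    ultimately show "(LINT p:\<Omega>|lebesgue. ?w p * bump_box m a b p) = 0"
      by (simp add: \<phi>_def)
  qed
  then show ?thesis
    by eventually_elim (auto simp: set_lebesgue_integral_def)
qed

text \<open>Nonnegativity of the variance: expand the integral of (f - m)^2, where m is the mean of
  \<open>f\<close> over the interval.\<close>

lemma Cauchy_Schwarz_Icc:
  fixes f :: "real \<Rightarrow> real"
  assumes [measurable]: "f \<in> borel_measurable borel" and \<alpha>: "\<alpha> > 0"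
  shows "ennreal ((LINT t:{0..\<alpha>}|lborel. f t)\<^sup>2) \<le> ennreal \<alpha> * (\<integral>\<^sup>+t\<in>{0..\<alpha>}. ennreal ((f t)\<^sup>2) \<partial>lborel)"
proof (cases "set_integrable lborel {0..\<alpha>} f \<and> set_integrable lborel {0..\<alpha>} (\<lambda>t. (f t)\<^sup>2)")
  case True
  then have int: "set_integrable lborel {0..\<alpha>} f" "set_integrable lborel {0..\<alpha>} (\<lambda>t. (f t)\<^sup>2)" by auto
  define J where "J = (LINT t:{0..\<alpha>}|lborel. f t)"
  define m where "m = J / \<alpha>"
  have const: "set_integrable lborel {0..\<alpha>} (\<lambda>t. c)" "(LINT t:{0..\<alpha>}|lborel. c) = \<alpha> * c" for c :: real
    using \<alpha> by (simp_all add: set_integrable_def set_lebesgue_integral_def)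
  have i2: "set_integrable lborel {0..\<alpha>} (\<lambda>t. (2 * m) * f t)" using int(1) by simp
  have "0 \<le> (LINT t:{0..\<alpha>}|lborel. (f t - m)\<^sup>2)"
    unfolding set_lebesgue_integral_def by (rule Bochner_Integration.integral_nonneg) auto
  also have "\<dots> = (LINT t:{0..\<alpha>}|lborel. ((f t)\<^sup>2 - (2 * m) * f t) + m\<^sup>2)"
    by (simp add: power2_diff algebra_simps)
  also have "\<dots> = (LINT t:{0..\<alpha>}|lborel. (f t)\<^sup>2) - (2 * m) * J + \<alpha> * m\<^sup>2"
    by (subst set_integral_add(2)[OF set_integral_diff(1)[OF int(2) i2] const(1)],
        subst set_integral_diff(2)[OF int(2) i2]) (simp add: J_def const)
  also have "\<dots> = (LINT t:{0..\<alpha>}|lborel. (f t)\<^sup>2) - J\<^sup>2 / \<alpha>"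
    using \<alpha> by (simp add: m_def power2_eq_square field_simps)
  finally have "J\<^sup>2 \<le> \<alpha> * (LINT t:{0..\<alpha>}|lborel. (f t)\<^sup>2)"
    using \<alpha> by (simp add: field_simps)
  then have "ennreal (J\<^sup>2) \<le> ennreal \<alpha> * ennreal (LINT t:{0..\<alpha>}|lborel. (f t)\<^sup>2)"
    using \<alpha> by (simp add: ennreal_mult'[symmetric] ennreal_leI)
  also have "ennreal (LINT t:{0..\<alpha>}|lborel. (f t)\<^sup>2) = (\<integral>\<^sup>+t\<in>{0..\<alpha>}. ennreal ((f t)\<^sup>2) \<partial>lborel)"
  proof -
    have "(\<integral>\<^sup>+t\<in>{0..\<alpha>}. ennreal ((f t)\<^sup>2) \<partial>lborel) = (\<integral>\<^sup>+t. ennreal (indicat_real {0..\<alpha>} t *\<^sub>R (f t)\<^sup>2) \<partial>lborel)"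
      by (intro nn_integral_cong) (auto simp: indicator_def)
    also have "\<dots> = ennreal (LINT t:{0..\<alpha>}|lborel. (f t)\<^sup>2)"
      using int(2) unfolding set_integrable_def set_lebesgue_integral_def
      by (intro nn_integral_eq_integral) auto
    finally show ?thesis by simp
  qed
  finally show ?thesis by (simp add: J_def)
next
  case False
  \<comment> \<open>If only the square fails to be integrable, the right side is infinite; if
    \<open>f\<close> itself fails, its integral is 0 by convention.\<close>
  show ?thesis
  proof (cases "set_integrable lborel {0..\<alpha>} f")
    case True
    with False have "\<not> set_integrable lborel {0..\<alpha>} (\<lambda>t. (f t)\<^sup>2)" by blast
    moreover have "(\<lambda>t. indicat_real {0..\<alpha>} t *\<^sub>R (f t)\<^sup>2) \<in> borel_measurable lborel" by measurable
    ultimately have "(\<integral>\<^sup>+t. ennreal (norm (indicat_real {0..\<alpha>} t *\<^sub>R (f t)\<^sup>2)) \<partial>lborel) = \<infinity>"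
      unfolding set_integrable_def integrable_iff_bounded by (simp add: less_top[symmetric])
    also have "(\<lambda>t. ennreal (norm (indicat_real {0..\<alpha>} t *\<^sub>R (f t)\<^sup>2))) = (\<lambda>t. ennreal ((f t)\<^sup>2) * indicator {0..\<alpha>} t)"
      by (auto simp: indicator_def)
    finally show ?thesis using \<alpha> by (simp add: ennreal_mult_top)
  next
    case False
    then show ?thesis
      by (simp add: set_integrable_def set_lebesgue_integral_def not_integrable_integral_eq)
  qed
qed

text \<open>One factor \<alpha> comes from Cauchy-Schwarz in the angle. The other is the length of
  the interval of angles: after the exchange of integrals, every angle contributes the same
  rotation-invariant energy of \<open>T\<close>.\<close>

lemma rotation_difference_energy_borel:
  fixes g d1 d2 :: "real^2 \<Rightarrow> real"
  defines "T \<equiv> \<lambda>p. p $ 1 * d2 p - p $ 2 * d1 p"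
  assumes \<Omega>: "open \<Omega>" "\<And>t p. rot t *v p \<in> \<Omega> \<longleftrightarrow> p \<in> \<Omega>"
    and w: "has_weak_partial \<Omega> 1 g d1" "has_weak_partial \<Omega> 2 g d2"
    and meas [measurable]: "g \<in> borel_measurable borel" "T \<in> borel_measurable borel"
    and zero: "\<And>p. p \<notin> \<Omega> \<Longrightarrow> g p = 0" "\<And>p. p \<notin> \<Omega> \<Longrightarrow> T p = 0"
    and int: "integrable lborel g" "integrable lborel T"
    and \<alpha>: "\<alpha> > 0"
  shows "(\<integral>\<^sup>+p. ennreal ((g (rot \<alpha> *v p) - g p)\<^sup>2) \<partial>lborel) \<le> ennreal (\<alpha>\<^sup>2) * (\<integral>\<^sup>+p. ennreal ((T p)\<^sup>2) \<partial>lborel)"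
proof -
  have Tm [measurable]: "(\<lambda>x. T (case x of (t, p) \<Rightarrow> rot (1 * t) *v p)) \<in> borel_measurable (lborel \<Otimes>\<^sub>M lborel)"
    by (rule measurable_compose[OF rot_pair_measurable meas(2)])
  then have Tm' [measurable]: "(\<lambda>(t, p). T (rot t *v p)) \<in> borel_measurable (lborel \<Otimes>\<^sub>M lborel)"
    by (simp add: case_prod_beta')
  have Tt: "(\<lambda>t. T (rot t *v p)) \<in> borel_measurable borel" for p
  proof -
    have "(\<lambda>t. (t, p)) \<in> measurable (lborel :: real measure) (lborel \<Otimes>\<^sub>M lborel)"
      by (rule measurable_Pair2') simp
    from measurable_compose[OF this Tm'] show ?thesis by simp
  qed
  have AE: "AE p in lborel. g (rot \<alpha> *v p) - g p = (LINT t:{0..\<alpha>}|lborel. T (rot t *v p))"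
  proof -
    have "AE p in lebesgue. p \<in> \<Omega> \<longrightarrow> g (rot \<alpha> *v p) - g p = (LINT t:{0..\<alpha>}|lborel. T (rot t *v p))"
      unfolding T_def
      by (rule rotation_difference_borel[OF \<Omega> w]) (use assms in \<open>auto simp: T_def\<close>)
    then have "AE p in lebesgue. g (rot \<alpha> *v p) - g p = (LINT t:{0..\<alpha>}|lborel. T (rot t *v p))"
    proof eventually_elim
      case (elim p)
      then show ?case
        using zero \<Omega>(2) by (cases "p \<in> \<Omega>") (auto simp: set_lebesgue_integral_def)
    qed
    then show ?thesis by (simp add: AE_completion_iff)
  qed
  have "(\<integral>\<^sup>+p. ennreal ((g (rot \<alpha> *v p) - g p)\<^sup>2) \<partial>lborel)
    \<le> (\<integral>\<^sup>+p. ennreal \<alpha> * (\<integral>\<^sup>+t. ennreal ((T (rot t *v p))\<^sup>2) * indicator {0..\<alpha>} t \<partial>lborel) \<partial>lborel)"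
  proof (rule nn_integral_mono_AE)
    show "AE p in lborel. ennreal ((g (rot \<alpha> *v p) - g p)\<^sup>2) \<le> ennreal \<alpha> * (\<integral>\<^sup>+t. ennreal ((T (rot t *v p))\<^sup>2) * indicator {0..\<alpha>} t \<partial>lborel)"
      using AE
    proof eventually_elim
      case (elim p)
      show ?case unfolding elim by (rule Cauchy_Schwarz_Icc[OF Tt \<alpha>])
    qed
  qed
  also have "\<dots> = ennreal \<alpha> * (\<integral>\<^sup>+p. \<integral>\<^sup>+t. ennreal ((T (rot t *v p))\<^sup>2) * indicator {0..\<alpha>} t \<partial>lborel \<partial>lborel)"
  proof (rule nn_integral_cmult)
    have "(\<lambda>(p, t). ennreal ((case_prod (\<lambda>t p. T (rot t *v p)) (t, p))\<^sup>2) * indicator {0..\<alpha>} t) \<in> borel_measurable (lborel \<Otimes>\<^sub>M lborel)"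
      by measurable
    then show "(\<lambda>p. \<integral>\<^sup>+t. ennreal ((T (rot t *v p))\<^sup>2) * indicator {0..\<alpha>} t \<partial>lborel) \<in> borel_measurable lborel"
      using lborel.borel_measurable_nn_integral_fst by (simp add: case_prod_beta') 
  qed
  also have "(\<integral>\<^sup>+p. \<integral>\<^sup>+t. ennreal ((T (rot t *v p))\<^sup>2) * indicator {0..\<alpha>} t \<partial>lborel \<partial>lborel)
    = (\<integral>\<^sup>+t. \<integral>\<^sup>+p. ennreal ((T (rot t *v p))\<^sup>2) * indicator {0..\<alpha>} t \<partial>lborel \<partial>lborel)"
  proof (rule lborel_pair.Fubini'[where f = "\<lambda>t p. ennreal ((T (rot t *v p))\<^sup>2) * indicator {0..\<alpha>} t"])
    have "(\<lambda>x. ennreal ((case_prod (\<lambda>t p. T (rot t *v p)) x)\<^sup>2) * indicator {0..\<alpha>} (fst x)) \<in> borel_measurable (lborel \<Otimes>\<^sub>M lborel)"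
      by measurable
    then show "(\<lambda>(t, p). ennreal ((T (rot t *v p))\<^sup>2) * indicator {0..\<alpha>} t) \<in> borel_measurable (lborel \<Otimes>\<^sub>M lborel)"
      by (simp add: case_prod_beta')
  qed
  also have "\<dots> = (\<integral>\<^sup>+t. (\<integral>\<^sup>+p. ennreal ((T p)\<^sup>2) \<partial>lborel) * indicator {0..\<alpha>} t \<partial>lborel)"
  proof (rule nn_integral_cong)
    fix t
    have "(\<integral>\<^sup>+p. ennreal ((T (rot t *v p))\<^sup>2) * indicator {0..\<alpha>} t \<partial>lborel)
      = (\<integral>\<^sup>+p. ennreal ((T (rot t *v p))\<^sup>2) \<partial>lborel) * indicator {0..\<alpha>} t"
      by (rule nn_integral_multc) measurable
    also have "(\<integral>\<^sup>+p. ennreal ((T (rot t *v p))\<^sup>2) \<partial>lborel) = (\<integral>\<^sup>+p. ennreal ((T p)\<^sup>2) \<partial>lborel)"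
      by (rule nn_integral_rot) measurable
    finally show "(\<integral>\<^sup>+p. ennreal ((T (rot t *v p))\<^sup>2) * indicator {0..\<alpha>} t \<partial>lborel)
      = (\<integral>\<^sup>+p. ennreal ((T p)\<^sup>2) \<partial>lborel) * indicator {0..\<alpha>} t" .
  qed
  also have "\<dots> = (\<integral>\<^sup>+p. ennreal ((T p)\<^sup>2) \<partial>lborel) * ennreal \<alpha>"
    using \<alpha> by (subst nn_integral_cmult_indicator) auto
  finally show ?thesis
    using \<alpha> by (simp add: power2_eq_square ennreal_mult mult_ac)
qed

text \<open>Composition with rotations and measurability on the product space call for Borel
  functions, whereas elements of \<open>L2\<close> are only Lebesgue measurable on \<Omega>.\<close>

lemma L2_borel_version:
  fixes u :: "real^'n \<Rightarrow> real"
  assumes \<Omega>: "open \<Omega>" "bounded \<Omega>" and u: "u \<in> L2 \<Omega>"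
  obtains u' where "u' \<in> borel_measurable borel" "\<And>p. p \<notin> \<Omega> \<Longrightarrow> u' p = 0" "integrable lborel u'"
    "AE p in lebesgue. p \<in> \<Omega> \<longrightarrow> u p = u' p" "locally_integrable_on u' \<Omega>"
proof -
  have lm: "\<Omega> \<in> lmeasurable" using \<Omega> by (simp add: lmeasurable_open)
  have int: "integrable lebesgue (\<lambda>p. indicator \<Omega> p * u p)"
    using L2_integrable[OF lm u] set_integrable_iff_lebesgue_on[of \<Omega> u] \<Omega> by (simp add: set_integrable_def)
  then obtain h where h [measurable]: "h \<in> borel_measurable lborel" and AE: "AE p in lborel. indicator \<Omega> p * u p = h p"
    using completion_ex_borel_measurable_real[of "\<lambda>p. indicator \<Omega> p * u p" lborel] by auto
  define u' where "u' = (\<lambda>p. indicator \<Omega> p * h p)"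
  have "indicat_real \<Omega> \<in> borel_measurable borel" using \<Omega> by simp
  then have m: "u' \<in> borel_measurable borel" using h unfolding u'_def by simp
  have AE': "AE p in lebesgue. p \<in> \<Omega> \<longrightarrow> u p = u' p"
    using AE_completion[OF AE] by eventually_elim (auto simp: u'_def)
  have "integrable lebesgue u'"
    by (rule integrable_cong_AE_imp[OF int])
      (use m AE' in \<open>auto intro: measurable_completion elim!: eventually_mono simp: u'_def indicator_def\<close>)
  moreover have "u' p = 0" if "p \<notin> \<Omega>" for p using that by (simp add: u'_def)
  ultimately show ?thesis
    using that[of u'] m AE' integrable_completion[of u' lborel] integrable_imp_locally_integrable[of u' \<Omega>] by auto
qed

text \<open>Differentiating \<eta> (R p) = - \<eta> p gives R^T v (R p) = - v p, that is, v (R p) =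
  - R v p. The proof is the weak form of this chain rule, with the bump rotated by
  \<open>- \<alpha>\<close>.\<close>

lemma gradient_rot_borel:
  fixes v :: "2 \<Rightarrow> real^2 \<Rightarrow> real"
  assumes \<Omega>: "open \<Omega>" "\<And>t p. rot t *v p \<in> \<Omega> \<longleftrightarrow> p \<in> \<Omega>"
    and w: "\<And>i. has_weak_partial \<Omega> i \<eta> (v i)"
    and meas [measurable]: "\<eta> \<in> borel_measurable borel" "\<And>i. v i \<in> borel_measurable borel"
    and zero: "\<And>p. p \<notin> \<Omega> \<Longrightarrow> \<eta> p = 0" "\<And>i p. p \<notin> \<Omega> \<Longrightarrow> v i p = 0"
    and int: "integrable lborel \<eta>" "\<And>i. integrable lborel (v i)"
    and sym: "AE p in lborel. \<eta> (rot \<alpha> *v p) = - \<eta> p"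
  shows "AE p in lebesgue. p \<in> \<Omega> \<longrightarrow> v i (rot \<alpha> *v p) = - (rot \<alpha> *v (\<chi> j. v j p)) $ i"
proof -
  let ?R = "rot \<alpha>"
  let ?w = "\<lambda>p. v i (?R *v p) + (\<Sum>j\<in>UNIV. ?R $ i $ j * v j p)"
  have v_rot: "integrable lborel (\<lambda>p. v i (?R *v p))"
    using int(2) integrable_rot[OF meas(2)] by simp
  have w_int: "integrable lborel ?w"
    using int v_rot by auto
  have li: "locally_integrable_on ?w \<Omega>"
    using w_int by (rule integrable_imp_locally_integrable)
  have "AE p in lebesgue. p \<in> \<Omega> \<longrightarrow> ?w p = 0"
  proof (rule fundamental_lemma[OF \<Omega>(1) li])
    fix m a b assume "cbox a b \<subseteq> \<Omega>"
    define \<phi> where "\<phi> = bump_box m a b"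
    have \<phi>: "\<phi> \<in> test_functions \<Omega>" unfolding \<phi>_def by (rule bump_box_test) fact
    note pt = test_functions_partial[OF \<phi>]
    note [measurable] = test_functions_measurable[OF \<phi>] test_functions_measurable[OF pt]
    have \<phi>0: "p \<notin> \<Omega> \<Longrightarrow> \<phi> p = 0" for p using \<phi> test_functionsE by (metis subsetD)
    have diff: "\<phi> differentiable (at q)" for q by (rule test_functions_differentiable[OF \<phi>])
    let ?\<psi> = "\<lambda>p. \<phi> (rot (- \<alpha>) *v p)"
    have \<psi>: "?\<psi> \<in> test_functions \<Omega>" by (rule test_functions_rot[OF \<phi> \<Omega>(2)])
    obtain M where M: "\<And>p. \<bar>\<phi> p\<bar> \<le> M" using test_functions_bounded[OF \<phi>] by metis
    have i\<phi>: "integrable lborel (\<lambda>p. f p * \<phi> p)" if "integrable lborel f" for f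
      by (rule integrable_bounded_mult[OF that _ M]) simp
    have i\<eta>: "integrable lborel (\<lambda>p. \<eta> p * partial j \<phi> p)" for j
    proof -
      obtain M where M: "\<And>p. \<bar>partial j \<phi> p\<bar> \<le> M" using test_functions_bounded[OF pt] by metis
      show ?thesis by (rule integrable_bounded_mult[OF int(1) _ M]) simp
    qed
    have "(LINT p|lborel. v i (?R *v p) * \<phi> p) = (LINT p|lborel. v i p * ?\<psi> p)"
      using integral_rot[of "\<lambda>p. v i p * ?\<psi> p" \<alpha>] by simp
    also have "\<dots> = (LINT p:\<Omega>|lebesgue. v i p * ?\<psi> p)"
      by (rule set_integral_eq_lborel[symmetric]) (use zero in auto)
    also have "\<dots> = - (LINT p:\<Omega>|lebesgue. \<eta> p * partial i ?\<psi> p)"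
      using has_weak_partialD(3)[OF w \<psi>, of i] by simp
    also have "(LINT p:\<Omega>|lebesgue. \<eta> p * partial i ?\<psi> p) = (LINT p|lborel. \<eta> p * partial i ?\<psi> p)"
      by (rule set_integral_eq_lborel) (use zero test_functions_measurable[OF test_functions_partial[OF \<psi>]] in auto)
    also have "\<dots> = (LINT p|lborel. \<eta> (?R *v p) * (\<Sum>j\<in>UNIV. rot (- \<alpha>) $ j $ i * partial j \<phi> p))"
      unfolding partial_compose_linear(1)[OF diff]
      using integral_rot[of "\<lambda>p. \<eta> p * (\<Sum>j\<in>UNIV. rot (- \<alpha>) $ j $ i * partial j \<phi> (rot (- \<alpha>) *v p))" \<alpha>] by simp
    also have "\<dots> = (LINT p|lborel. - (\<Sum>j\<in>UNIV. ?R $ i $ j * (\<eta> p * partial j \<phi> p)))"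
    proof (rule integral_cong_AE)
      have "rot (- \<alpha>) $ j $ i = ?R $ i $ j" for j
        using exhaust_2[of i] exhaust_2[of j] by auto
      then show "AE p in lborel. \<eta> (?R *v p) * (\<Sum>j\<in>UNIV. rot (- \<alpha>) $ j $ i * partial j \<phi> p) =
          - (\<Sum>j\<in>UNIV. ?R $ i $ j * (\<eta> p * partial j \<phi> p))"
        using sym by (auto elim!: eventually_mono simp: sum_distrib_left mult_ac sum_negf)
    qed measurable
    also have "\<dots> = - (\<Sum>j\<in>UNIV. ?R $ i $ j * (LINT p|lborel. \<eta> p * partial j \<phi> p))"
      using i\<eta> by simp
    also have "(\<lambda>j. LINT p|lborel. \<eta> p * partial j \<phi> p) = (\<lambda>j. - (LINT p|lborel. v j p * \<phi> p))"
    proof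
      fix j
      have "(LINT p|lborel. \<eta> p * partial j \<phi> p) = (LINT p:\<Omega>|lebesgue. \<eta> p * partial j \<phi> p)"
        by (rule set_integral_eq_lborel[symmetric]) (use zero in auto)
      also have "\<dots> = - (LINT p:\<Omega>|lebesgue. v j p * \<phi> p)"
        by (rule has_weak_partialD(3)[OF w \<phi>])
      also have "(LINT p:\<Omega>|lebesgue. v j p * \<phi> p) = (LINT p|lborel. v j p * \<phi> p)"
        by (rule set_integral_eq_lborel) (use zero in auto)
      finally show "(LINT p|lborel. \<eta> p * partial j \<phi> p) = - (LINT p|lborel. v j p * \<phi> p)" .
    qed
    finally have "(LINT p|lborel. v i (?R *v p) * \<phi> p) = - (\<Sum>j\<in>UNIV. ?R $ i $ j * (LINT p|lborel. v j p * \<phi> p))"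
      by (simp add: sum_negf)
    moreover have "(LINT p|lborel. ?w p * \<phi> p) = (LINT p|lborel. v i (?R *v p) * \<phi> p + (\<Sum>j\<in>UNIV. ?R $ i $ j * (v j p * \<phi> p)))"
      by (simp add: sum_distrib_right distrib_right mult.assoc)
    moreover have "\<dots> = (LINT p|lborel. v i (?R *v p) * \<phi> p) + (\<Sum>j\<in>UNIV. ?R $ i $ j * (LINT p|lborel. v j p * \<phi> p))"
      using i\<phi>[OF v_rot] i\<phi>[OF int(2)] by simp
    ultimately have "(LINT p|lborel. ?w p * \<phi> p) = 0"
      by linarith
    moreover have "(LINT p:\<Omega>|lebesgue. ?w p * \<phi> p) = (LINT p|lborel. ?w p * \<phi> p)"
      by (rule set_integral_eq_lborel) (use \<phi>0 in auto)
    ultimately show "(LINT p:\<Omega>|lebesgue. ?w p * bump_box m a b p) = 0"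
      by (simp add: \<phi>_def)
  qed
  then show ?thesis
    by eventually_elim (auto simp: matrix_vector_mult_def)
qed

text \<open>The gradient of an antiperiodic function turns by \<open>\<pi> + \<alpha>\<close> under the rotation by \<open>\<alpha>\<close>, so for
  \<open>\<alpha> \<le> \<pi> / 2\<close> its rotation difference is at least as large as the gradient itself.\<close>

lemma gradient_Poincare:
  fixes v :: "2 \<Rightarrow> real^2 \<Rightarrow> real" and h :: "2 \<Rightarrow> 2 \<Rightarrow> real^2 \<Rightarrow> real"
  assumes \<Omega>: "open \<Omega>" "\<And>t p. rot t *v p \<in> \<Omega> \<longleftrightarrow> p \<in> \<Omega>" "\<Omega> \<subseteq> cball 0 1"
    and w: "\<And>i. has_weak_partial \<Omega> i \<eta> (v i)" "\<And>i j. has_weak_partial \<Omega> j (v i) (h i j)"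
    and L2: "\<eta> \<in> L2 \<Omega>" "\<And>i. v i \<in> L2 \<Omega>" "\<And>i j. h i j \<in> L2 \<Omega>"
    and sym: "AE p in lebesgue. p \<in> \<Omega> \<longrightarrow> \<eta> (rot \<alpha> *v p) = - \<eta> p"
    and \<alpha>: "0 < \<alpha>" "\<alpha> \<le> pi / 2"
  shows "2 * (\<integral>\<^sup>+p\<in>\<Omega>. ennreal (\<Sum>i\<in>UNIV. (v i p)\<^sup>2) \<partial>lebesgue)
    \<le> ennreal (\<alpha>\<^sup>2) * (\<integral>\<^sup>+p\<in>\<Omega>. ennreal (\<Sum>i\<in>UNIV. \<Sum>j\<in>UNIV. (h i j p)\<^sup>2) \<partial>lebesgue)"
proof -
  have bdd: "bounded \<Omega>" using \<Omega>(3) bounded_cball bounded_subset by blast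
  \<comment> \<open>All functions are exchanged for Borel versions that vanish off \<Omega>;
    \<open>ver\<close> collects what the rotation lemmas ask of such a version.\<close>
  define ver where "ver u u' \<longleftrightarrow> u' \<in> borel_measurable borel \<and> (\<forall>p. p \<notin> \<Omega> \<longrightarrow> u' p = 0) \<and> integrable lborel u' \<and>
    (AE p in lebesgue. p \<in> \<Omega> \<longrightarrow> u p = u' p) \<and> locally_integrable_on u' \<Omega>" for u u' :: "real^2 \<Rightarrow> real"
  have ex: "\<exists>u'. ver u u'" if "u \<in> L2 \<Omega>" for u
    unfolding ver_def by (rule L2_borel_version[OF \<Omega>(1) bdd that]) blast
  obtain \<eta>' where "ver \<eta> \<eta>'" using ex[OF L2(1)] by blast
  then have \<eta>': "\<eta>' \<in> borel_measurable borel" "\<And>p. p \<notin> \<Omega> \<Longrightarrow> \<eta>' p = 0" "integrable lborel \<eta>'"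
    "AE p in lebesgue. p \<in> \<Omega> \<longrightarrow> \<eta> p = \<eta>' p" "locally_integrable_on \<eta>' \<Omega>"
    unfolding ver_def by blast+
  have "\<forall>i. \<exists>u'. ver (v i) u'" using ex[OF L2(2)] by blast
  then obtain v' where "\<And>i. ver (v i) (v' i)" by metis
  then have v': "\<And>i. v' i \<in> borel_measurable borel" "\<And>i p. p \<notin> \<Omega> \<Longrightarrow> v' i p = 0" "\<And>i. integrable lborel (v' i)"
    "\<And>i. AE p in lebesgue. p \<in> \<Omega> \<longrightarrow> v i p = v' i p" "\<And>i. locally_integrable_on (v' i) \<Omega>"
    unfolding ver_def by blast+
  have "\<forall>i j. \<exists>u'. ver (h i j) u'" using ex[OF L2(3)] by blast
  then obtain h' where "\<And>i j. ver (h i j) (h' i j)" by metis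
  then have h': "\<And>i j. h' i j \<in> borel_measurable borel" "\<And>i j p. p \<notin> \<Omega> \<Longrightarrow> h' i j p = 0" "\<And>i j. integrable lborel (h' i j)"
    "\<And>i j. AE p in lebesgue. p \<in> \<Omega> \<longrightarrow> h i j p = h' i j p" "\<And>i j. locally_integrable_on (h' i j) \<Omega>"
    unfolding ver_def by blast+
  have w': "has_weak_partial \<Omega> i \<eta>' (v' i)" for i
    by (rule has_weak_partial_cong_AE[OF w(1)]) (fact \<eta>' v')+
  have ww': "has_weak_partial \<Omega> j (v' i) (h' i j)" for i j
    by (rule has_weak_partial_cong_AE[OF w(2)]) (fact v' h')+
  have [measurable]: "v' i \<in> borel_measurable borel" "h' i j \<in> borel_measurable borel" for i j
    using v'(1) h'(1) by blast+
  have comp [measurable]: "(\<lambda>p::real^2. p $ i) \<in> borel_measurable borel" for i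
    by (intro borel_measurable_continuous_onI continuous_intros)
  let ?R = "rot \<alpha>"
  have "AE p in lebesgue. \<eta>' (?R *v p) = - \<eta>' p"
    using sym \<eta>'(4)
      AE_rot[OF \<eta>'(4), of \<alpha>]
  proof eventually_elim
    case (elim p)
    then show ?case using \<eta>'(2) \<Omega>(2)[of \<alpha> p] by (cases "p \<in> \<Omega>") auto
  qed
  then have sym': "AE p in lborel. \<eta>' (?R *v p) = - \<eta>' p"
    by (simp add: AE_completion_iff)
  have grad: "AE p in lebesgue. p \<in> \<Omega> \<longrightarrow> v' i (?R *v p) = - (?R *v (\<chi> j. v' j p)) $ i" for i
    by (rule gradient_rot_borel[OF \<Omega>(1,2) w']) (fact \<eta>' v' sym')+
  define T where "T = (\<lambda>i p. p $ 1 * h' i 2 p - p $ 2 * h' i 1 p)"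
  have T_meas [measurable]: "T i \<in> borel_measurable borel" for i
    unfolding T_def by measurable
  have c1: "\<bar>p $ i\<bar> \<le> 1" if "p \<in> \<Omega>" for p i
    using component_le_norm_cart[of p i] that \<Omega>(3) by (auto simp: subset_iff)
  have T_int: "integrable lborel (T i)" for i
  proof -
    have "integrable lborel (\<lambda>p. h' i j p * p $ k)" for j k
    proof (rule integrable_bounded_mult[OF h'(3) comp])
      show "\<bar>p $ k\<bar> \<le> 1" if "h' i j p \<noteq> 0" for p
        using that h'(2)[of p i j] c1[of p k] by blast
    qed
    then have "integrable lborel (\<lambda>p. p $ k * h' i j p)" for j k
      by (simp only: mult.commute)
    then show ?thesis unfolding T_def by (intro Bochner_Integration.integrable_diff)
  qed
  have energy: "(\<integral>\<^sup>+p. ennreal ((v' i (?R *v p) - v' i p)\<^sup>2) \<partial>lborel) \<le> ennreal (\<alpha>\<^sup>2) * (\<integral>\<^sup>+p. ennreal ((T i p)\<^sup>2) \<partial>lborel)" for i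
    unfolding T_def
    by (rule rotation_difference_energy_borel[OF \<Omega>(1,2) ww' ww'])
      (use v'(1-3) h'(2) T_meas[of i] T_int[of i] \<alpha> in \<open>auto simp: T_def\<close>)
  have "2 * (\<integral>\<^sup>+p\<in>\<Omega>. ennreal (\<Sum>i\<in>UNIV. (v i p)\<^sup>2) \<partial>lebesgue) = (\<integral>\<^sup>+p. ennreal (2 * (\<Sum>i\<in>UNIV. (v' i p)\<^sup>2)) \<partial>lborel)"
  proof -
    have ae: "AE p in lebesgue. \<forall>i. p \<in> \<Omega> \<longrightarrow> v i p = v' i p"
      unfolding AE_all_countable using v'(4) by blast
    have "(\<integral>\<^sup>+p\<in>\<Omega>. ennreal (\<Sum>i\<in>UNIV. (v i p)\<^sup>2) \<partial>lebesgue) = (\<integral>\<^sup>+p. ennreal (\<Sum>i\<in>UNIV. (v' i p)\<^sup>2) \<partial>lebesgue)"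
    proof (rule nn_integral_cong_AE)
      show "AE p in lebesgue. ennreal (\<Sum>i\<in>UNIV. (v i p)\<^sup>2) * indicator \<Omega> p = ennreal (\<Sum>i\<in>UNIV. (v' i p)\<^sup>2)"
        using ae
      proof eventually_elim
        case (elim p)
        then show ?case using v'(2) by (cases "p \<in> \<Omega>") auto
      qed
    qed
    also have "\<dots> = (\<integral>\<^sup>+p. ennreal (\<Sum>i\<in>UNIV. (v' i p)\<^sup>2) \<partial>lborel)"
      by (rule nn_integral_completion)
    finally show ?thesis
      by (simp add: nn_integral_cmult[symmetric] ennreal_mult' sum_nonneg)
  qed
  also have "\<dots> \<le> (\<integral>\<^sup>+p. ennreal (\<Sum>i\<in>UNIV. (v' i (?R *v p) - v' i p)\<^sup>2) \<partial>lborel)"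
  proof (rule nn_integral_mono_AE)
    have "AE p in lborel. \<forall>i. p \<in> \<Omega> \<longrightarrow> v' i (?R *v p) = - (?R *v (\<chi> j. v' j p)) $ i"
      unfolding AE_all_countable using grad by (simp add: AE_completion_iff)
    then show "AE p in lborel. ennreal (2 * (\<Sum>i\<in>UNIV. (v' i p)\<^sup>2)) \<le> ennreal (\<Sum>i\<in>UNIV. (v' i (?R *v p) - v' i p)\<^sup>2)"
    proof eventually_elim
      case (elim p)
      show ?case
      proof (cases "p \<in> \<Omega>")
        case True
        define c s a b where "c = cos \<alpha>" and "s = sin \<alpha>" and "a = v' 1 p" and "b = v' 2 p"
        have c: "c \<ge> 0" unfolding c_def using \<alpha> by (intro cos_ge_zero) auto
        have cs: "c\<^sup>2 + s\<^sup>2 = 1" by (simp add: c_def s_def)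
        have "v' 1 (?R *v p) = - (c * a - s * b)" "v' 2 (?R *v p) = - (s * a + c * b)"
          using elim True by (simp_all add: c_def s_def a_def b_def)
        then have "(\<Sum>i\<in>UNIV. (v' i (?R *v p) - v' i p)\<^sup>2) = (- (c * a - s * b) - a)\<^sup>2 + (- (s * a + c * b) - b)\<^sup>2"
          by (simp add: sum_2 a_def b_def)
        \<comment> \<open>With R the rotation by \<alpha> this is |- R v - v|^2 = (2 + 2 cos
          \<alpha>) |v|^2, and the cosine is nonnegative because \<alpha> \<le> \<pi>/2.\<close>
        also have "\<dots> = (c\<^sup>2 + s\<^sup>2 + 1 + 2 * c) * (a\<^sup>2 + b\<^sup>2)"
          by (simp add: power2_eq_square algebra_simps)
        also have "\<dots> \<ge> 2 * (a\<^sup>2 + b\<^sup>2)"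
          unfolding cs using c by (intro mult_right_mono) auto
        finally show ?thesis by (intro ennreal_leI) (simp add: sum_2 a_def b_def)
      next
        case False
        then show ?thesis using v'(2) by (simp add: sum_nonneg)
      qed
    qed
  qed
  also have "\<dots> = (\<Sum>i\<in>UNIV. \<integral>\<^sup>+p. ennreal ((v' i (?R *v p) - v' i p)\<^sup>2) \<partial>lborel)"
    by (subst nn_integral_sum[symmetric]) (auto simp: sum_ennreal)
  also have "\<dots> \<le> (\<Sum>i\<in>UNIV. ennreal (\<alpha>\<^sup>2) * (\<integral>\<^sup>+p. ennreal ((T i p)\<^sup>2) \<partial>lborel))"
    by (intro sum_mono energy)
  also have "\<dots> = ennreal (\<alpha>\<^sup>2) * (\<integral>\<^sup>+p. ennreal (\<Sum>i\<in>UNIV. (T i p)\<^sup>2) \<partial>lborel)"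
    unfolding sum_distrib_left[symmetric] by (subst nn_integral_sum[symmetric]) (auto simp: sum_ennreal)
  also have "\<dots> \<le> ennreal (\<alpha>\<^sup>2) * (\<integral>\<^sup>+p\<in>\<Omega>. ennreal (\<Sum>i\<in>UNIV. \<Sum>j\<in>UNIV. (h i j p)\<^sup>2) \<partial>lebesgue)"
  proof (rule mult_left_mono)
    have "(\<integral>\<^sup>+p. ennreal (\<Sum>i\<in>UNIV. (T i p)\<^sup>2) \<partial>lborel) = (\<integral>\<^sup>+p. ennreal (\<Sum>i\<in>UNIV. (T i p)\<^sup>2) \<partial>lebesgue)"
      by (rule nn_integral_completion[symmetric])
    also have "\<dots> \<le> (\<integral>\<^sup>+p\<in>\<Omega>. ennreal (\<Sum>i\<in>UNIV. \<Sum>j\<in>UNIV. (h i j p)\<^sup>2) \<partial>lebesgue)"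
    proof (rule nn_integral_mono_AE)
      have "AE p in lebesgue. \<forall>i j. p \<in> \<Omega> \<longrightarrow> h i j p = h' i j p"
        unfolding AE_all_countable using h'(4) by blast
      then show "AE p in lebesgue. ennreal (\<Sum>i\<in>UNIV. (T i p)\<^sup>2) \<le> ennreal (\<Sum>i\<in>UNIV. \<Sum>j\<in>UNIV. (h i j p)\<^sup>2) * indicator \<Omega> p"
      proof eventually_elim
        case (elim p)
        show ?case
        proof (cases "p \<in> \<Omega>")
          case True
          have "norm p \<le> 1" using True \<Omega>(3) by auto
          then have n1: "(p $ 1)\<^sup>2 + (p $ 2)\<^sup>2 \<le> 1" by (simp add: norm_vec2 real_sqrt_le_1_iff)
          have "(x * b - y * a)\<^sup>2 \<le> a\<^sup>2 + b\<^sup>2" if "x\<^sup>2 + y\<^sup>2 \<le> 1" for x y a b :: real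
          proof -
            \<comment> \<open>Lagrange's identity: adding the square of x a + y b completes the
              product of the two norms. It expresses that the angular derivative is at most |p|
              times the gradient.\<close>
            have "(x * b - y * a)\<^sup>2 \<le> (x * b - y * a)\<^sup>2 + (x * a + y * b)\<^sup>2" by simp
            also have "\<dots> = (x\<^sup>2 + y\<^sup>2) * (a\<^sup>2 + b\<^sup>2)"
              by (simp add: power2_eq_square algebra_simps)
            also have "\<dots> \<le> 1 * (a\<^sup>2 + b\<^sup>2)" using that by (intro mult_right_mono) auto
            finally show ?thesis by simp
          qed
          from this[OF n1] have "(T i p)\<^sup>2 \<le> (\<Sum>j\<in>UNIV. (h i j p)\<^sup>2)" for i
            using elim True by (simp add: T_def sum_2)
          then show ?thesis using True by (auto intro!: ennreal_leI sum_mono)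
        next
          case False
          then show ?thesis using h'(2) by (simp add: T_def)
        qed
      qed
    qed
    finally show "(\<integral>\<^sup>+p. ennreal (\<Sum>i\<in>UNIV. (T i p)\<^sup>2) \<partial>lborel) \<le> (\<integral>\<^sup>+p\<in>\<Omega>. ennreal (\<Sum>i\<in>UNIV. \<Sum>j\<in>UNIV. (h i j p)\<^sup>2) \<partial>lebesgue)" .
  qed simp
  finally show ?thesis .
qed

section \<open>The stress of the optimal flat deformation\<close>

abbreviation sq :: "real^2 \<Rightarrow> real" where "sq p \<equiv> (p $ 1)\<^sup>2 + (p $ 2)\<^sup>2"

lemma sq_eq_norm: "sq p = (norm p)\<^sup>2"
  by (simp add: norm_vec2)

lemma annulus_sq:
  assumes "0 < r0"
  shows "p \<in> annulus r0 \<longleftrightarrow> r0\<^sup>2 < sq p \<and> sq p < 1"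
proof -
  have "r0 < norm p \<longleftrightarrow> r0\<^sup>2 < (norm p)\<^sup>2"
    using assms power_strict_mono[of r0 "norm p" 2] power2_less_imp_less[of r0 "norm p"] by auto
  moreover have "norm p < 1 \<longleftrightarrow> (norm p)\<^sup>2 < 1"
    by (simp add: abs_square_less_1)
  ultimately show ?thesis by (simp add: annulus_def sq_eq_norm)
qed

lemma open_annulus: "open (annulus r0)"
  unfolding annulus_def by (intro open_Collect_conj open_Collect_less continuous_intros)

lemma bounded_annulus: "bounded (annulus r0)"
  unfolding annulus_def bounded_iff by (auto intro!: exI[of _ 1])

lemma annulus_subset_cball: "annulus r0 \<subseteq> cball 0 1"
  by (auto simp: annulus_def)

lemma annulus_rot: "rot t *v p \<in> annulus r0 \<longleftrightarrow> p \<in> annulus r0"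
  by (simp add: annulus_def)

lemma lmeasurable_annulus: "annulus r0 \<in> lmeasurable"
  by (simp add: lmeasurable_open open_annulus bounded_annulus)

lemma sets_annulus [simp]: "annulus r0 \<in> sets lebesgue"
  using lmeasurable_annulus by (rule fmeasurableD)

lemma component_measurable [measurable]: "(\<lambda>p::real^'n. p $ i) \<in> borel_measurable borel"
  by (intro borel_measurable_continuous_onI continuous_intros)

lemma has_derivative_component [derivative_intros]:
  "((\<lambda>p::real^'n. p $ i) has_derivative (\<lambda>h. h $ i)) (at p within S)"
  by (rule bounded_linear_imp_has_derivative, rule bounded_linear_vec_nth)

text \<open>Up to a constant factor this is the stress of the optimal flat deformation: it is divergence
  free and its normal component \<open>-(|p|\<^sup>2 - 1)(|p|\<^sup>2 - r\<^sub>0\<^sup>2)/|p|\<^sup>2\<close> vanishes on both boundary circles.\<close>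

definition stress :: "real \<Rightarrow> 2 \<Rightarrow> 2 \<Rightarrow> real^2 \<Rightarrow> real" where
  "stress r0 i j p = (if i = j then - 3 * sq p + (1 + r0\<^sup>2) + r0\<^sup>2 / sq p else 0)
     + (2 - 2 * r0\<^sup>2 / (sq p)\<^sup>2) * (p $ i * p $ j)"

text \<open>The shift by -1 makes the function vanish where \<open>sq p\<close> is within 1 / (m +
  1) of either end, so its support is a compact subset of the open annulus.\<close>

definition cutoff :: "real \<Rightarrow> nat \<Rightarrow> real^2 \<Rightarrow> real" where
  "cutoff r0 m p = bump (real (Suc m) * (sq p - r0\<^sup>2) - 1) * bump (real (Suc m) * (1 - sq p) - 1)"

definition bump' :: "real \<Rightarrow> real" where
  "bump' t = (if t > 0 then exp (- (1/t)) / t\<^sup>2 else 0)"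

lemma DERIV_bump: "(bump has_real_derivative bump' t) (at t)"
proof -
  have "bump' = expfun ([:0, 0, 1:] * (1 - pderiv 1))"
    by (auto simp: bump'_def expfun_def fun_eq_iff power2_eq_square)
  then show ?thesis using DERIV_expfun[of 1 t] by simp
qed

lemma stress_measurable [measurable]: "stress r0 i j \<in> borel_measurable borel"
  unfolding stress_def[abs_def] by measurable

lemma stress_bounded:
  assumes "0 < r0" "r0 < 1" "p \<in> annulus r0"
  shows "\<bar>stress r0 i j p\<bar> \<le> 8 + 2 / r0\<^sup>2"
proof -
  have s: "r0\<^sup>2 < sq p" "sq p < 1" using assms annulus_sq by auto
  have r: "0 < r0\<^sup>2" "r0\<^sup>2 < 1" using assms by (auto simp: power_less_one_iff abs_square_less_1)
  have sp: "0 < sq p" using s r by linarith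
  have "0 \<le> r0\<^sup>2 / sq p" using sp r by (intro divide_nonneg_pos) auto
  moreover have "r0\<^sup>2 / sq p \<le> 1" using s(1) sp by (subst pos_divide_le_eq) auto
  moreover have "\<bar>- 3 * x + (1 + a) + b\<bar> \<le> 6" if "0 \<le> b" "b \<le> 1" "0 < a" "a < x" "x < 1" for x a b :: real
    using that by linarith
  ultimately have 1: "\<bar>- 3 * sq p + (1 + r0\<^sup>2) + r0\<^sup>2 / sq p\<bar> \<le> 6" using s r by blast
  have "r0\<^sup>2 * r0\<^sup>2 \<le> (sq p)\<^sup>2" unfolding power2_eq_square[of "sq p"] using s r by (intro mult_mono) auto
  then have "2 * r0\<^sup>2 / (sq p)\<^sup>2 \<le> 2 * r0\<^sup>2 / (r0\<^sup>2 * r0\<^sup>2)"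
    by (rule divide_left_mono) (use r mult_pos_pos[OF zero_less_power[OF sp, of 2] mult_pos_pos[OF r(1) r(1)]] in auto)
  also have "2 * x / (x * x) = 2 / x" if "x > 0" for x :: real
    using that by (simp add: field_simps)
  from this[OF r(1)] have "2 * r0\<^sup>2 / (r0\<^sup>2 * r0\<^sup>2) = 2 / r0\<^sup>2" .
  finally have "2 * r0\<^sup>2 / (sq p)\<^sup>2 \<le> 2 / r0\<^sup>2" .
  moreover have "0 \<le> 2 * r0\<^sup>2 / (sq p)\<^sup>2" by simp
  ultimately have 2: "\<bar>2 - 2 * r0\<^sup>2 / (sq p)\<^sup>2\<bar> \<le> 2 + 2 / r0\<^sup>2" by linarith
  have "\<bar>p $ k\<bar> \<le> 1" for k
    using component_le_norm_cart[of p k] assms(3) by (auto simp: annulus_def)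
  then have 3: "\<bar>p $ i * p $ j\<bar> \<le> 1" by (simp add: abs_mult mult_le_one)
  \<comment> \<open>The isotropic part of the stress contributes 6 and this part 2 + 2 / r0^2;
    together they give the bound.\<close>
  have "\<bar>(2 - 2 * r0\<^sup>2 / (sq p)\<^sup>2) * (p $ i * p $ j)\<bar> \<le> (2 + 2 / r0\<^sup>2) * 1"
    unfolding abs_mult[of "2 - 2 * r0\<^sup>2 / (sq p)\<^sup>2"] by (intro mult_mono 2 3) (use r in auto)
  with 1 show ?thesis unfolding stress_def by (auto simp del: mult_minus_left)
qed

lemma Ck_power2: "Ck k f \<Longrightarrow> Ck k (\<lambda>x. (f x)\<^sup>2)"
  unfolding power2_eq_square by (rule Ck_mult)

lemma Ck_sq: "Ck k sq"
  by (intro Ck_add Ck_power2 Ck_component)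

text \<open>A smooth function on the whole plane that agrees with \<open>1 / |p|\<^sup>2\<close> on the annulus.\<close>

lemma Ck_inverse_sq:
  assumes "r0 \<noteq> 0"
  shows "Ck k (\<lambda>p. inverse (sq p + bump (r0\<^sup>2 - sq p)))"
proof (rule Ck_inverse)
  show "sq p + bump (r0\<^sup>2 - sq p) \<noteq> 0" for p
  proof (cases "sq p = 0")
    case True
    then show ?thesis unfolding True using assms by (simp add: bump_eq)
  next
    case False
    then have "sq p > 0" by (metis add_nonneg_nonneg less_eq_real_def zero_le_power2)
    then show ?thesis using bump_nonneg[of "r0\<^sup>2 - sq p"] by linarith
  qed
  show "Ck k (\<lambda>p. sq p + bump (r0\<^sup>2 - sq p))"
    by (intro Ck_add Ck_sq Ck_expfun Ck_diff Ck_const Ck_power2 Ck_component)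
qed

lemma inverse_sq_eq: "sq p \<ge> r0\<^sup>2 \<Longrightarrow> inverse (sq p + bump (r0\<^sup>2 - sq p)) = 1 / sq p"
  by (simp add: bump_eq inverse_eq_divide)

lemma cutoff_nonzero:
  assumes "cutoff r0 m p \<noteq> 0"
  shows "1 / real (Suc m) \<le> sq p - r0\<^sup>2" "1 / real (Suc m) \<le> 1 - sq p"
  using assms by (auto simp: cutoff_def bump_eq field_simps split: if_splits)

text \<open>The stress is singular at the origin, while test functions are smooth on the whole
  plane. Replacing 1 / \<open>sq p\<close> by the globally smooth function of
  \<open>Ck_inverse_sq\<close> changes nothing where the cutoff is nonzero.\<close>

lemma cutoff_stress_test:
  assumes "0 < r0"
  shows "(\<lambda>p. stress r0 i j p * cutoff r0 m p) \<in> test_functions (annulus r0)"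
proof -
  let ?r = "\<lambda>p. inverse (sq p + bump (r0\<^sup>2 - sq p))"
  let ?S = "\<lambda>p. (if i = j then - 3 * sq p + (1 + r0\<^sup>2) + r0\<^sup>2 * ?r p else 0)
     + (2 - 2 * r0\<^sup>2 * (?r p)\<^sup>2) * (p $ i * p $ j)"
  let ?K = "{p. r0\<^sup>2 + 1 / real (Suc m) \<le> sq p} \<inter> {p. sq p \<le> 1 - 1 / real (Suc m)}"
  have "(\<lambda>p. ?S p * cutoff r0 m p) = (\<lambda>p. stress r0 i j p * cutoff r0 m p)"
  proof
    fix p show "?S p * cutoff r0 m p = stress r0 i j p * cutoff r0 m p"
    proof (cases "cutoff r0 m p = 0")
      case False
      have "0 \<le> 1 / real (Suc m)" by simp
      with cutoff_nonzero(1)[OF False] have "sq p \<ge> r0\<^sup>2" by linarith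
      then show ?thesis by (simp only: inverse_sq_eq stress_def) (simp add: power_divide)
    qed simp
  qed
  moreover have "(\<lambda>p. ?S p * cutoff r0 m p) \<in> test_functions (annulus r0)"
  proof (rule test_functionsI)
    have "Ck k ?S" for k
      by (cases "i = j") (use assms in \<open>auto intro!: Ck_add Ck_mult Ck_diff Ck_uminus Ck_power2 Ck_component Ck_const Ck_inverse_sq\<close>)
    moreover have "Ck k (cutoff r0 m)" for k
      unfolding cutoff_def[abs_def]
      by (intro Ck_mult Ck_expfun Ck_diff Ck_const Ck_sq Ck_add Ck_power2 Ck_component)
    ultimately show "Ck k (\<lambda>p. ?S p * cutoff r0 m p)" for k by (rule Ck_mult)
    have "closed ?K" by (intro closed_Int closed_Collect_le continuous_intros)
    moreover have "?K \<subseteq> cball 0 1"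
    proof
      fix p assume "p \<in> ?K"
      then have "sq p \<le> 1 - 1 / real (Suc m)" by blast
      moreover have "0 \<le> 1 / real (Suc m)" by simp
      ultimately have "sq p \<le> 1" by linarith
      then show "p \<in> cball 0 1" by (simp add: norm_vec2 real_sqrt_le_1_iff)
    qed
    ultimately show "compact ?K"
      by (meson bounded_cball bounded_subset compact_eq_bounded_closed)
    show "?K \<subseteq> annulus r0"
    proof
      fix p assume "p \<in> ?K"
      then have "r0\<^sup>2 + 1 / real (Suc m) \<le> sq p" "sq p \<le> 1 - 1 / real (Suc m)" by blast+
      moreover have "0 < 1 / real (Suc m)" by simp
      ultimately have "r0\<^sup>2 < sq p \<and> sq p < 1" by linarith
      then show "p \<in> annulus r0" using assms annulus_sq by blast
    qed
    show "?S p * cutoff r0 m p = 0" if "p \<notin> ?K" for p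
    proof -
      have "cutoff r0 m p = 0" using cutoff_nonzero[of r0 m p] that by (simp del: of_nat_Suc add: algebra_simps) argo
      then show ?thesis by simp
    qed
  qed
  ultimately show ?thesis by (simp only:)
qed

lemma has_derivative_radial:
  assumes "(f has_real_derivative D) (at (sq p))"
  shows "((\<lambda>p. f (sq p)) has_derivative (\<lambda>h. D * (2 * p $ 1 * h $ 1 + 2 * p $ 2 * h $ 2))) (at p)"
proof -
  have "(sq has_derivative (\<lambda>h. 2 * p $ 1 * h $ 1 + 2 * p $ 2 * h $ 2)) (at p)"
    by (auto intro!: derivative_eq_intros simp: fun_eq_iff)
  from has_derivative_compose[OF this assms[unfolded has_field_derivative_def]] show ?thesis .
qed

text \<open>The stress being divergence free, only the gradient of the cutoff contributes; this
  gradient is radial and picks out the normal component of the stress. The form of the right side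
  shows that the result stays bounded as \<open>m\<close> grows.\<close>

lemma divergence_cutoff_stress:
  fixes m :: nat
  assumes "0 < r0" "p \<in> annulus r0"
  defines "M \<equiv> real (Suc m)"
  defines "x \<equiv> M * (sq p - r0\<^sup>2) - 1" and "y \<equiv> M * (1 - sq p) - 1"
  shows "partial 1 (\<lambda>p. stress r0 i 1 p * cutoff r0 m p) p + partial 2 (\<lambda>p. stress r0 i 2 p * cutoff r0 m p) p
    = - 2 * p $ i / sq p * ((sq p - 1) * ((x + 1) * bump' x) * bump y + (sq p - r0\<^sup>2) * bump x * ((y + 1) * bump' y))"
proof -
  have s: "sq p \<noteq> 0" "sq p > 0" using assms annulus_sq[of r0 p] zero_le_power2[of r0] by linarith+
  define a where "a = r0\<^sup>2"
  have cutoff: "(cutoff r0 m has_derivative (\<lambda>h. (M * bump' x * bump y - M * bump x * bump' y) * (2 * p $ 1 * h $ 1 + 2 * p $ 2 * h $ 2))) (at p)"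
  proof -
    have "((\<lambda>s. bump (M * (s - r0\<^sup>2) - 1) * bump (M * (1 - s) - 1)) has_real_derivative
        M * bump' x * bump y - M * bump x * bump' y) (at (sq p))"
      by (auto intro!: derivative_eq_intros DERIV_chain2[OF DERIV_bump] simp: x_def y_def)
    from has_derivative_radial[OF this] show ?thesis
      unfolding cutoff_def[abs_def] M_def[symmetric] .
  qed
  have stress: "(stress r0 i j has_derivative
     (\<lambda>h. (if i = j then - 3 - a / (sq p)\<^sup>2 else 0) * (2 * p $ 1 * h $ 1 + 2 * p $ 2 * h $ 2)
       + (4 * a / (sq p)^3 * (2 * p $ 1 * h $ 1 + 2 * p $ 2 * h $ 2)) * (p $ i * p $ j)
       + (2 - 2 * a / (sq p)\<^sup>2) * (h $ i * p $ j + p $ i * h $ j))) (at p)" for i j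
  proof -
    have "((\<lambda>s. if i = j then - 3 * s + (1 + a) + a / s else 0) has_real_derivative
        (if i = j then - 3 - a / (sq p)\<^sup>2 else 0)) (at (sq p))"
      using s by (auto intro!: derivative_eq_intros simp: power2_eq_square)
    note 1 = has_derivative_radial[OF this]
    have "((\<lambda>s. 2 - 2 * a / s\<^sup>2) has_real_derivative 4 * a / x^3) (at x)" if "x \<noteq> 0" for x
      using that by (auto intro!: derivative_eq_intros simp: field_simps power2_eq_square power3_eq_cube)
    note 2 = has_derivative_radial[OF this[OF s(1)]]
    have 3: "((\<lambda>p. p $ i * p $ j) has_derivative (\<lambda>h. p $ i * h $ j + h $ i * p $ j)) (at p)"
      by (rule has_derivative_mult[OF has_derivative_component has_derivative_component])
    show ?thesis
      unfolding stress_def[abs_def] a_def[symmetric]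
      by (rule has_derivative_eq_rhs[OF has_derivative_add[OF 1 has_derivative_mult[OF 2 3]]])
        (simp add: fun_eq_iff algebra_simps)
  qed
  have partial: "partial j (\<lambda>p. stress r0 i j p * cutoff r0 m p) p = 
     partial j (stress r0 i j) p * cutoff r0 m p + stress r0 i j p * partial j (cutoff r0 m) p" for j
    using stress cutoff by (intro partial_mult) (auto simp: differentiable_def)
  have ps: "partial j (stress r0 i j) p = (if i = j then - 3 - a / (sq p)\<^sup>2 else 0) * (2 * p $ j)
       + (4 * a / (sq p)^3 * (2 * p $ j)) * (p $ i * p $ j)
       + (2 - 2 * a / (sq p)\<^sup>2) * ((if i = j then 1 else 0) * p $ j + p $ i)" for j
    using exhaust_2[of j] exhaust_2[of i] by (auto simp: has_derivative_imp_partial[OF stress] axis_def)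
  have pc: "partial j (cutoff r0 m) p = (M * bump' x * bump y - M * bump x * bump' y) * (2 * p $ j)" for j
    using exhaust_2[of j] by (auto simp: has_derivative_imp_partial[OF cutoff] axis_def)
  have div0: "partial 1 (stress r0 i 1) p + partial 2 (stress r0 i 2) p = 0"
  proof -
    define S where "S = sq p"
    have S: "S \<noteq> 0" "(p $ 1)\<^sup>2 = S - (p $ 2)\<^sup>2" using s by (auto simp: S_def)
    note psS = ps[unfolded S_def[symmetric]]
    have "partial 1 (stress r0 i 1) p + partial 2 (stress r0 i 2) p =
      p $ i * (2 * (- 3 - a / S\<^sup>2) + 8 * a / S^3 * ((p $ 1)\<^sup>2 + (p $ 2)\<^sup>2) + 3 * (2 - 2 * a / S\<^sup>2))"
      unfolding psS using exhaust_2[of i]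
      by (auto simp: algebra_simps power2_eq_square)
    also have "\<dots> = 0"
      unfolding S_def[symmetric] using S(1) by (simp add: field_simps power2_eq_square power3_eq_cube)
    finally show ?thesis .
  qed
  have normal: "stress r0 i 1 p * p $ 1 + stress r0 i 2 p * p $ 2 = - (sq p - 1) * (sq p - a) / sq p * p $ i"
  proof -
    define S where "S = sq p"
    have S: "S \<noteq> 0" using s by (auto simp: S_def)
    note stS = stress_def[of r0 _ _ p, unfolded S_def[symmetric] a_def[symmetric]]
    have "stress r0 i 1 p * p $ 1 + stress r0 i 2 p * p $ 2 =
      p $ i * (- 3 * S + (1 + a) + a / S + (2 - 2 * a / S\<^sup>2) * ((p $ 1)\<^sup>2 + (p $ 2)\<^sup>2))"
      unfolding stS using exhaust_2[of i]
      by (auto simp: algebra_simps power2_eq_square)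
    also have "\<dots> = - (S - 1) * (S - a) / S * p $ i"
      unfolding S_def[symmetric] using S by (simp add: field_simps power2_eq_square)
    finally show ?thesis by (simp add: S_def)
  qed
  have "partial 1 (\<lambda>p. stress r0 i 1 p * cutoff r0 m p) p + partial 2 (\<lambda>p. stress r0 i 2 p * cutoff r0 m p) p
    = (partial 1 (stress r0 i 1) p + partial 2 (stress r0 i 2) p) * cutoff r0 m p
      + 2 * (M * bump' x * bump y - M * bump x * bump' y) * (stress r0 i 1 p * p $ 1 + stress r0 i 2 p * p $ 2)"
    unfolding partial pc by (simp add: algebra_simps)
  also have "\<dots> = 2 * (M * bump' x * bump y - M * bump x * bump' y) * (- (sq p - 1) * (sq p - a) / sq p * p $ i)"
    unfolding div0 normal by simp
  \<comment> \<open>Every derivative of a bump carries the factor \<open>M\<close>. It is paired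
    with the zero of the normal component on the same circle, since M (sq p - r0^2) = x + 1 and M (1
    - sq p) = y + 1.\<close>
  also have "\<dots> = - 2 * p $ i / sq p * ((sq p - 1) * ((M * (sq p - a)) * bump' x) * bump y + (sq p - a) * bump x * ((M * (1 - sq p)) * bump' y))"
      proof -
    have "2 * (M * X * b - M * B * Y) * (- (S - 1) * (S - a) / S * q) = - 2 * q / S * ((S - 1) * ((M * (S - a)) * X) * b + (S - a) * B * ((M * (1 - S)) * Y))"
      for X Y B b S q :: real by (simp add: divide_inverse algebra_simps)
    then show ?thesis .
  qed
  also have "M * (sq p - a) = x + 1" by (simp add: x_def a_def)
  also have "M * (1 - sq p) = y + 1" by (simp add: y_def)
  finally show ?thesis by (simp only: a_def)
qed

text \<open>(x + 1) \<open>bump'\<close> x is the boundary-layer profile left by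
  \<open>divergence_cutoff_stress\<close>. The bound 3 provides the dominating function, and the
  decay for large x makes the layer disappear in the limit.\<close>

lemma bump'_bounds: "0 \<le> (x + 1) * bump' x" "(x + 1) * bump' x \<le> 3"
  and bump'_decay: "x > 0 \<Longrightarrow> (x + 1) * bump' x \<le> 1 / x + 1 / x\<^sup>2"
proof -
  show "0 \<le> (x + 1) * bump' x" by (simp add: bump'_def)
  have *: "(x + 1) * bump' x = (1 / x) * exp (- (1 / x)) + (1 / x)\<^sup>2 * exp (- (1 / x))" if "x > 0" for x
    using that by (simp add: bump'_def field_simps power2_eq_square)
  have e: "t * exp (- t) \<le> 1" "t\<^sup>2 * exp (- t) \<le> 2" "exp (- t) \<le> 1" if "t > 0" for t :: real
  proof -
    have "t \<le> exp t" using exp_ge_add_one_self[of t] by linarith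
    moreover have "t\<^sup>2 \<le> 2 * exp t" using exp_lower_Taylor_quadratic[of t] that by (simp add: field_simps)
    ultimately show "t * exp (- t) \<le> 1" "t\<^sup>2 * exp (- t) \<le> 2" "exp (- t) \<le> 1"
      using that by (simp_all add: exp_minus field_simps)
  qed
  show "(x + 1) * bump' x \<le> 3"
  proof (cases "x > 0")
    case True
    then have "0 < 1 / x" by simp
    then show ?thesis using *[OF True] e(1)[of "1/x"] e(2)[of "1/x"] by linarith
  qed (simp add: bump'_def)
  show "(x + 1) * bump' x \<le> 1 / x + 1 / x\<^sup>2" if "x > 0"
  proof -
    have "(1 / x) * exp (- (1 / x)) \<le> (1 / x) * 1" "(1 / x)\<^sup>2 * exp (- (1 / x)) \<le> (1 / x)\<^sup>2 * 1"
      by (intro mult_left_mono e; use that in simp)+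
    then show ?thesis unfolding *[OF that] by (simp add: power_divide)
  qed
qed

lemma scaled_at_top: "c > 0 \<Longrightarrow> filterlim (\<lambda>m. real (Suc m) * c - 1) at_top sequentially"
proof -
  assume c: "c > 0"
  have "filterlim (\<lambda>m. real (Suc m)) at_top sequentially"
    by (rule filterlim_compose[OF filterlim_real_sequentially filterlim_Suc])
  from filterlim_tendsto_pos_mult_at_top[OF tendsto_const c this]
  have "filterlim (\<lambda>m. - 1 + c * real (Suc m)) at_top sequentially"
    by (rule filterlim_tendsto_add_at_top[OF tendsto_const])
  then show ?thesis by (simp add: algebra_simps)
qed

lemma bump_at_top: "(bump \<longlongrightarrow> 1) at_top"
proof -
  have "((\<lambda>x::real. exp (- inverse x)) \<longlongrightarrow> exp (- 0)) at_top"
    by (intro tendsto_intros tendsto_inverse_0_at_top filterlim_ident)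
  then have "((\<lambda>x::real. exp (- inverse x)) \<longlongrightarrow> 1) at_top" by simp
  then show ?thesis
    by (rule Lim_transform_eventually)
      (use eventually_gt_at_top[of 0] in \<open>auto elim!: eventually_mono simp: bump_eq inverse_eq_divide\<close>)
qed

lemma bump'_at_top: "((\<lambda>x. (x + 1) * bump' x) \<longlongrightarrow> 0) at_top"
proof (rule tendsto_sandwich[OF _ _ tendsto_const])
  show "eventually (\<lambda>x. 0 \<le> (x + 1) * bump' x) at_top" using bump'_bounds by simp
  show "eventually (\<lambda>x. (x + 1) * bump' x \<le> inverse x + (inverse x)\<^sup>2) at_top"
    using eventually_gt_at_top[of 0] by eventually_elim (use bump'_decay in \<open>auto simp: inverse_eq_divide power_divide\<close>)
  have "((\<lambda>x::real. inverse x + (inverse x)\<^sup>2) \<longlongrightarrow> 0 + 0\<^sup>2) at_top"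
    by (intro tendsto_intros tendsto_inverse_0_at_top filterlim_ident)
  then show "((\<lambda>x::real. inverse x + (inverse x)\<^sup>2) \<longlongrightarrow> 0) at_top" by simp
qed

text \<open>The weak form of div \<sigma> = 0 with vanishing normal stress on the boundary.
  Integration by parts is done against the stress times the cutoff. As m tends to infinity the
  cutoff tends to 1 on one side, while on the other the divergence of the product tends boundedly to
  0.\<close>

lemma stress_equilibrium:
  assumes r0: "0 < r0" "r0 < 1" and u: "u \<in> L2 (annulus r0)"
    and w: "\<And>j. has_weak_partial (annulus r0) j u (d j)" and d: "\<And>j. d j \<in> L2 (annulus r0)"
  shows "(LINT p|lebesgue_on (annulus r0). (\<Sum>j\<in>UNIV. stress r0 i j p * d j p)) = 0"
proof -
  let ?\<Omega> = "annulus r0" let ?L = "lebesgue_on ?\<Omega>"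
  let ?\<zeta> = "cutoff r0"
  have restr: "f \<in> borel_measurable ?L" if "f \<in> borel_measurable borel" for f :: "real^2 \<Rightarrow> real"
    using that by (intro measurable_restrict_space1 measurable_completion) simp
  have um: "u \<in> borel_measurable ?L" and dm: "d j \<in> borel_measurable ?L" for j
    using u d by (auto simp: L2_def)
  have ui: "integrable ?L u" and di: "integrable ?L (d j)" for j
    using u d L2_integrable[OF lmeasurable_annulus] by auto
  note Sm = restr[OF stress_measurable]
  let ?B = "8 + 2 / r0\<^sup>2"
  have B: "?B \<ge> 0" using r0 by simp
  have \<zeta>m: "?\<zeta> m \<in> borel_measurable borel" for m
  proof -
    have "bump \<in> borel_measurable borel"
      using DERIV_bump DERIV_isCont by (intro borel_measurable_continuous_onI continuous_at_imp_continuous_on) blast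
    note [measurable] = this
    show ?thesis unfolding cutoff_def[abs_def] by measurable
  qed
  have \<zeta>01: "0 \<le> ?\<zeta> m p" "?\<zeta> m p \<le> 1" for m p
    by (auto simp: cutoff_def bump_nonneg bump_le_1 intro!: mult_le_one)
  let ?F = "\<lambda>p. \<Sum>j\<in>UNIV. stress r0 i j p * d j p"
  have Fm: "?F \<in> borel_measurable ?L" using Sm dm by measurable
  have AE_in: "AE p in ?L. p \<in> ?\<Omega>" using AE_space[of ?L] by simp
  have Fi: "integrable ?L ?F"
  proof (rule Bochner_Integration.integrable_bound[OF _ Fm])
    show "integrable ?L (\<lambda>p. \<Sum>j\<in>UNIV. ?B * norm (d j p))" using di by (intro Bochner_Integration.integrable_sum integrable_mult_right integrable_norm)
    show "AE p in ?L. norm (?F p) \<le> norm (\<Sum>j\<in>UNIV. ?B * norm (d j p))"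
      using AE_in
    proof eventually_elim
      case (elim p)
      have "norm (?F p) \<le> (\<Sum>j\<in>UNIV. norm (stress r0 i j p * d j p))" by (rule norm_sum)
      also have "\<dots> \<le> (\<Sum>j\<in>UNIV. ?B * norm (d j p))"
        unfolding norm_mult using stress_bounded[OF r0 elim] by (intro sum_mono mult_right_mono) auto
      finally show ?case using B by (simp add: sum_nonneg)
    qed
  qed
  let ?G = "\<lambda>m p. \<Sum>j\<in>UNIV. partial j (\<lambda>p. stress r0 i j p * ?\<zeta> m p) p"
  have by_parts: "(LINT p|?L. ?F p * ?\<zeta> m p) = - (LINT p|?L. u p * ?G m p)" for m
  proof -
    note t = cutoff_stress_test[OF r0(1), of i _ m]
    have ii: "integrable ?L (\<lambda>p. d j p * (stress r0 i j p * ?\<zeta> m p))"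
      "integrable ?L (\<lambda>p. u p * partial j (\<lambda>p. stress r0 i j p * ?\<zeta> m p) p)" for j
      using locally_integrable_test_integrable[OF has_weak_partialD(2)[OF w] t, of j]
        locally_integrable_test_integrable[OF has_weak_partialD(1)[OF w] test_functions_partial[OF t], of j]
      by (simp_all add: set_integrable_iff_lebesgue_on)
    have "(LINT p|?L. d j p * (stress r0 i j p * ?\<zeta> m p)) = - (LINT p|?L. u p * partial j (\<lambda>p. stress r0 i j p * ?\<zeta> m p) p)" for j
      using has_weak_partialD(3)[OF w t, of j] by (simp add: set_integral_eq_lebesgue_on)
    then have "(\<Sum>j\<in>UNIV. (LINT p|?L. d j p * (stress r0 i j p * ?\<zeta> m p))) = - (\<Sum>j\<in>UNIV. (LINT p|?L. u p * partial j (\<lambda>p. stress r0 i j p * ?\<zeta> m p) p))"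
      by (simp add: sum_negf)
    moreover have "(LINT p|?L. ?F p * ?\<zeta> m p) = (LINT p|?L. (\<Sum>j\<in>UNIV. d j p * (stress r0 i j p * ?\<zeta> m p)))"
      by (rule Bochner_Integration.integral_cong) (auto simp: sum_2 algebra_simps)
    moreover have "\<dots> = (\<Sum>j\<in>UNIV. (LINT p|?L. d j p * (stress r0 i j p * ?\<zeta> m p)))"
      by (rule Bochner_Integration.integral_sum) (rule ii)
    moreover have "(LINT p|?L. u p * ?G m p) = (\<Sum>j\<in>UNIV. (LINT p|?L. u p * partial j (\<lambda>p. stress r0 i j p * ?\<zeta> m p) p))"
      unfolding sum_distrib_left by (rule Bochner_Integration.integral_sum) (rule ii)
    ultimately show ?thesis by simp
  qed
  have lim1: "(\<lambda>m. LINT p|?L. ?F p * ?\<zeta> m p) \<longlonglongrightarrow> (LINT p|?L. ?F p)"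
  proof (rule integral_dominated_convergence[where w = "\<lambda>p. norm (?F p)"])
    show "(\<lambda>p. ?F p * ?\<zeta> m p) \<in> borel_measurable ?L" for m
      using Fm restr[OF \<zeta>m] by (rule borel_measurable_times)
    show "AE p in ?L. norm (?F p * ?\<zeta> m p) \<le> norm (?F p)" for m
      using \<zeta>01 by (intro AE_I2) (simp add: abs_mult mult_right_le_one_le)
    show "AE p in ?L. (\<lambda>m. ?F p * ?\<zeta> m p) \<longlonglongrightarrow> ?F p"
      using AE_in
    proof eventually_elim
      case (elim p)
      then have s: "sq p - r0\<^sup>2 > 0" "1 - sq p > 0" using annulus_sq r0 by auto
      have "(\<lambda>m. ?F p * ?\<zeta> m p) \<longlonglongrightarrow> ?F p * (1 * 1)"
        unfolding cutoff_def
        by (intro tendsto_mult tendsto_const filterlim_compose[OF bump_at_top scaled_at_top] s)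
      then show ?case by simp
    qed
  qed (use Fi Fm in auto)
  \<comment> \<open>The dominating constant is the bound 2 / r0^2 of the prefactor times 3 + 3 for
    the two boundary layers.\<close>
  have lim2: "(\<lambda>m. LINT p|?L. u p * ?G m p) \<longlonglongrightarrow> (LINT p|?L. 0)"
  proof (rule integral_dominated_convergence[where w = "\<lambda>p. 2 / r0\<^sup>2 * 6 * norm (u p)"])
    have "partial j (\<lambda>p. stress r0 i j p * ?\<zeta> m p) \<in> borel_measurable ?L" for j m
      using test_functions_measurable[OF test_functions_partial[OF cutoff_stress_test[OF r0(1)]]] by (rule restr)
    then show "(\<lambda>p. u p * ?G m p) \<in> borel_measurable ?L" for m
      using um by measurable
    have G: "?G m p = - 2 * p $ i / sq p * ((sq p - 1) * ((x + 1) * bump' x) * bump y + (sq p - r0\<^sup>2) * bump x * ((y + 1) * bump' y))"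
      if "p \<in> ?\<Omega>" "x = real (Suc m) * (sq p - r0\<^sup>2) - 1" "y = real (Suc m) * (1 - sq p) - 1" for p m x y
      using divergence_cutoff_stress[OF r0(1) that(1)] that(2,3) by (simp only: sum_2)
    show "AE p in ?L. norm (u p * ?G m p) \<le> 2 / r0\<^sup>2 * 6 * norm (u p)" for m
      using AE_in
    proof eventually_elim
      case (elim p)
      define x y where "x = real (Suc m) * (sq p - r0\<^sup>2) - 1" and "y = real (Suc m) * (1 - sq p) - 1"
      have s: "sq p > r0\<^sup>2" "sq p < 1" "r0\<^sup>2 > 0" using elim annulus_sq r0 by auto
      then have s': "sq p - r0\<^sup>2 \<le> 1" by linarith
      have "\<bar>(sq p - 1) * ((x + 1) * bump' x) * bump y\<bar> \<le> 1 * 3 * 1"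
        unfolding abs_mult by (intro mult_mono) (use s bump'_bounds[of x] bump_nonneg[of y] bump_le_1[of y] in \<open>auto simp: abs_mult[symmetric]\<close>)
      moreover have "\<bar>(sq p - r0\<^sup>2) * bump x * ((y + 1) * bump' y)\<bar> \<le> 1 * 1 * 3"
        unfolding abs_mult by (intro mult_mono) (use s s' bump'_bounds[of y] bump_nonneg[of x] bump_le_1[of x] in \<open>auto simp: abs_mult[symmetric]\<close>)
      ultimately have b1: "\<bar>(sq p - 1) * ((x + 1) * bump' x) * bump y + (sq p - r0\<^sup>2) * bump x * ((y + 1) * bump' y)\<bar> \<le> 6"
        by linarith
      have "\<bar>p $ i\<bar> \<le> 1" using component_le_norm_cart[of p i] elim by (auto simp: annulus_def)
      then have b2: "\<bar>- 2 * p $ i / sq p\<bar> \<le> 2 / r0\<^sup>2"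
        using s by (simp add: abs_mult abs_divide) (intro frac_le; simp)
      have "\<bar>?G m p\<bar> \<le> 2 / r0\<^sup>2 * 6"
        unfolding G[OF elim x_def y_def] abs_mult[of "- 2 * p $ i / sq p"]
        by (intro mult_mono b1 b2) (use s in auto)
      then have "\<bar>?G m p\<bar> * \<bar>u p\<bar> \<le> 2 / r0\<^sup>2 * 6 * \<bar>u p\<bar>"
        by (rule mult_right_mono) simp
      then show ?case
        by (simp only: real_norm_def abs_mult mult.commute)
    qed
    show "AE p in ?L. (\<lambda>m. u p * ?G m p) \<longlonglongrightarrow> 0"
      using AE_in
    proof eventually_elim
      case (elim p)
      then have s: "sq p - r0\<^sup>2 > 0" "1 - sq p > 0" using annulus_sq r0 by auto
      have "(\<lambda>m. u p * ?G m p) \<longlonglongrightarrow> u p * (- 2 * p $ i / sq p * ((sq p - 1) * 0 * 1 + (sq p - r0\<^sup>2) * 1 * 0))"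
        unfolding G[OF elim refl refl]
        by (intro tendsto_mult tendsto_add tendsto_const filterlim_compose[OF bump_at_top scaled_at_top]
          filterlim_compose[OF bump'_at_top scaled_at_top] s)
      then show ?case by simp
    qed
  qed (use ui in auto)
  have "(\<lambda>m. LINT p|?L. ?F p * ?\<zeta> m p) \<longlonglongrightarrow> 0"
    unfolding by_parts using tendsto_minus[OF lim2] by simp
  with lim1 show ?thesis by (rule LIMSEQ_unique)
qed

section \<open>The stretching energy from below\<close>

lemma L2_cong_AE:
  assumes "open \<Omega>" "u \<in> L2 \<Omega>" and AE: "AE p in lebesgue. p \<in> \<Omega> \<longrightarrow> v p = u p"
  shows "v \<in> L2 (\<Omega> :: (real^'n) set)"
proof -
  have \<Omega>: "\<Omega> \<in> sets lebesgue" using assms(1) by simp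
  have "(\<lambda>p. indicator \<Omega> p * u p) \<in> borel_measurable lebesgue"
    using assms(2) \<Omega> by (simp add: L2_def borel_measurable_restrict_space_iff)
  then have "(\<lambda>p. indicator \<Omega> p * v p) \<in> borel_measurable lebesgue"
    by (rule borel_measurable_AE_limit[where f = "\<lambda>_. \<lambda>p. indicator \<Omega> p * u p"])
      (use AE in \<open>auto elim!: eventually_mono simp: indicator_def\<close>)
  then have m: "v \<in> borel_measurable (lebesgue_on \<Omega>)"
    using \<Omega> by (simp add: borel_measurable_restrict_space_iff)
  have "integrable (lebesgue_on \<Omega>) (\<lambda>p. (v p)\<^sup>2)"
  proof (rule integrable_cong_AE_imp)
    show "integrable (lebesgue_on \<Omega>) (\<lambda>p. (u p)\<^sup>2)" using assms(2) by (simp add: L2_def)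
    show "(\<lambda>p. (v p)\<^sup>2) \<in> borel_measurable (lebesgue_on \<Omega>)" using m by measurable
    show "AE p in lebesgue_on \<Omega>. (u p)\<^sup>2 = (v p)\<^sup>2"
      unfolding AE_lebesgue_on_iff[OF \<Omega>] using AE by (auto elim!: eventually_mono)
  qed
  with m show ?thesis by (simp add: L2_def)
qed

lemma weak_partial_L2:
  assumes "open \<Omega>" "has_weak_partial \<Omega> i u v" "v \<in> L2 \<Omega>"
  shows "weak_partial \<Omega> i u \<in> L2 \<Omega>"
  by (rule L2_cong_AE[OF assms(1,3) weak_partial_AE_eq[OF assms(1,2)]])

lemma Sobolev_1_weak_partial:
  assumes "open \<Omega>" "u \<in> Sobolev 1 \<Omega>"
  shows "u \<in> L2 \<Omega>" "has_weak_partial \<Omega> i u (weak_partial \<Omega> i u)" "weak_partial \<Omega> i u \<in> L2 \<Omega>"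
proof -
  have S: "u \<in> Sobolev (Suc 0) \<Omega>" using assms(2) by simp
  then show "u \<in> L2 \<Omega>" by simp
  obtain v where v: "v \<in> Sobolev 0 \<Omega>" "has_weak_partial \<Omega> i u v" using S by (rule SobolevE)
  then show "has_weak_partial \<Omega> i u (weak_partial \<Omega> i u)" using weak_partial_works by blast
  show "weak_partial \<Omega> i u \<in> L2 \<Omega>" using weak_partial_L2[OF assms(1) v(2)] v(1) by simp
qed

text \<open>The definition provides some derivative \<open>v\<close> that has a weak derivative
  itself, whereas the Hessian is built from the chosen \<open>weak_partial\<close>. The second
  derivative must be carried over from one representative to the other.\<close>

lemma Sobolev_2_weak_partial:
  assumes "open \<Omega>" "u \<in> Sobolev 2 \<Omega>"
  shows "u \<in> L2 \<Omega>" "has_weak_partial \<Omega> i u (weak_partial \<Omega> i u)" "weak_partial \<Omega> i u \<in> L2 \<Omega>"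
    "has_weak_partial \<Omega> j (weak_partial \<Omega> i u) (weak_partial \<Omega> j (weak_partial \<Omega> i u))"
    "weak_partial \<Omega> j (weak_partial \<Omega> i u) \<in> L2 \<Omega>"
proof -
  have S: "u \<in> Sobolev (Suc 1) \<Omega>" using assms(2) by (simp add: numeral_2_eq_2)
  then show "u \<in> L2 \<Omega>" by simp
  obtain v where v: "v \<in> Sobolev 1 \<Omega>" "has_weak_partial \<Omega> i u v" using S by (rule SobolevE)
  show w: "has_weak_partial \<Omega> i u (weak_partial \<Omega> i u)" using v weak_partial_works by blast
  have vL2: "v \<in> L2 \<Omega>" using v(1) Sobolev_subset_L2 by blast
  show "weak_partial \<Omega> i u \<in> L2 \<Omega>" by (rule weak_partial_L2[OF assms(1) v(2) vL2])
  note vw = Sobolev_1_weak_partial[OF assms(1) v(1)]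
  have eq: "AE x in lebesgue. x \<in> \<Omega> \<longrightarrow> v x = weak_partial \<Omega> i u x"
    by (rule weak_partial_unique[OF assms(1) v(2) w])
  have hw: "has_weak_partial \<Omega> j (weak_partial \<Omega> i u) (weak_partial \<Omega> j v)"
    by (rule has_weak_partial_cong_AE[OF vw(2) has_weak_partialD(2)[OF w] has_weak_partialD(2)[OF vw(2)] eq]) simp
  then show "has_weak_partial \<Omega> j (weak_partial \<Omega> i u) (weak_partial \<Omega> j (weak_partial \<Omega> i u))"
    by (rule weak_partial_works)
  show "weak_partial \<Omega> j (weak_partial \<Omega> i u) \<in> L2 \<Omega>"
    by (rule weak_partial_L2[OF assms(1) hw vw(3)])
qed

section \<open>The quadratic energy density and the explicit flat solution\<close>

lemma energy_density_expand:
  fixes M N :: "real^2^2"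
  assumes "transpose M = M" "transpose N = N" "\<nu> \<noteq> 1"
  shows "energy_density \<nu> M = energy_density \<nu> (M - N)
    + 2 * (\<Sum>i\<in>UNIV. \<Sum>j\<in>UNIV. (N $ i $ j + (if i = j then \<nu> / (1 - \<nu>) * trace N else 0)) * M $ i $ j)
    - (\<Sum>i\<in>UNIV. \<Sum>j\<in>UNIV. (N $ i $ j + (if i = j then \<nu> / (1 - \<nu>) * trace N else 0)) * N $ i $ j)"
proof -
  have s: "M $ 2 $ 1 = M $ 1 $ 2" "N $ 2 $ 1 = N $ 1 $ 2"
    using arg_cong[OF assms(1), of "\<lambda>A. A $ 2 $ 1"] arg_cong[OF assms(2), of "\<lambda>A. A $ 2 $ 1"]
    by (simp_all add: transpose_def)
  \<comment> \<open>On symmetric matrices the density is |M|^2 + \<nu> / (1 - \<nu>) (trace M)^2. It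
    is quadratic, so its expansion about \<open>N\<close> is exact, and the matrix N + \<nu> / (1 -
    \<nu>) (trace N) I of the statement is half its gradient, that is, the stress belonging to
    \<open>N\<close>.\<close>
  define k where "k = \<nu> / (1 - \<nu>)"
  have k: "1 / (1 - \<nu>) = 1 + k" using assms(3) by (simp add: k_def field_simps)
  show ?thesis
    unfolding energy_density_def k k_def[symmetric]
    by (simp add: trace_def det_2 sum_2 s power2_eq_square algebra_simps)
qed

text \<open>The flat displacement is this coefficient at s = |p|^2 times p. The constant term and
  the term in 1/s are the radial solutions r and 1/r of plane elasticity, and the term linear in s
  is the particular solution forced by \<open>g1\<close>; the constants are fixed by zero normal
  stress on both circles.\<close>

definition flat_coef :: "real \<Rightarrow> real \<Rightarrow> real \<Rightarrow> real" where
  "flat_coef r0 \<nu> s = (3 * \<nu> - 1) / 48 * s + (1 - \<nu>) * (1 + r0\<^sup>2) / 16 + (1 + \<nu>) * r0\<^sup>2 / 16 / s"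

definition flat_coef' :: "real \<Rightarrow> real \<Rightarrow> real \<Rightarrow> real" where
  "flat_coef' r0 \<nu> s = (3 * \<nu> - 1) / 48 - (1 + \<nu>) * r0\<^sup>2 / 16 / s\<^sup>2"

definition flat_strain :: "real \<Rightarrow> real \<Rightarrow> real^2 \<Rightarrow> real^2^2" where
  "flat_strain r0 \<nu> p = (\<chi> i j. (if i = j then 2 * flat_coef r0 \<nu> (sq p) - sq p / 3 else 0)
     + (4 * flat_coef' r0 \<nu> (sq p) + 1 / 3) * (p $ i * p $ j))"

lemma DERIV_flat_coef: "s \<noteq> 0 \<Longrightarrow> (flat_coef r0 \<nu> has_real_derivative flat_coef' r0 \<nu> s) (at s)"
  unfolding flat_coef_def[abs_def] flat_coef'_def
  by (auto intro!: derivative_eq_intros simp: field_simps power2_eq_square)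

lemma transpose_flat_strain: "transpose (flat_strain r0 \<nu> p) = flat_strain r0 \<nu> p"
  by (auto simp: flat_strain_def transpose_def vec_eq_iff mult.commute)

text \<open>The origin of \<open>stress\<close>. Strain and stress are both combinations of the
  identity and p p^T, so the identity splits into one scalar equation for each: \<open>l\<close> for
  p p^T and \<open>m\<close> for the identity.\<close>

lemma flat_strain_stress:
  assumes "sq p \<noteq> 0" "\<nu> \<noteq> 1"
  shows "flat_strain r0 \<nu> p $ i $ j + (if i = j then \<nu> / (1 - \<nu>) * trace (flat_strain r0 \<nu> p) else 0)
    = (1 + \<nu>) / 8 * stress r0 i j p"
proof -
  define s where "s = sq p"
  define v w a where "v = flat_coef r0 \<nu> s" and "w = flat_coef' r0 \<nu> s" and "a = r0\<^sup>2"
  have s: "s \<noteq> 0" using assms by (simp add: s_def)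
  have tr: "trace (flat_strain r0 \<nu> p) = 2 * (2 * v - s / 3) + (4 * w + 1 / 3) * s"
    unfolding trace_def flat_strain_def s_def[symmetric] v_def[symmetric] w_def[symmetric]
    by (simp add: sum_2 s_def power2_eq_square algebra_simps)
  have l: "4 * w + 1 / 3 = (1 + \<nu>) / 8 * (2 - 2 * a / s\<^sup>2)"
    using s by (simp add: w_def flat_coef'_def a_def field_simps)
  have m: "2 * v - s / 3 + \<nu> / (1 - \<nu>) * (2 * (2 * v - s / 3) + (4 * w + 1 / 3) * s)
    = (1 + \<nu>) / 8 * (- 3 * s + (1 + a) + a / s)"
  proof -
    have v: "v = (3 * \<nu> - 1) / 48 * s + (1 - \<nu>) * (1 + a) / 16 + (1 + \<nu>) * a / 16 / s"
      by (simp add: v_def flat_coef_def a_def)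
    show ?thesis
      unfolding l v using s assms(2) by (simp add: divide_simps power2_eq_square) (simp add: algebra_simps)
  qed
  have e: "flat_strain r0 \<nu> p $ i $ j = (if i = j then 2 * v - s / 3 else 0) + (4 * w + 1 / 3) * (p $ i * p $ j)"
    by (simp add: flat_strain_def s_def v_def w_def)
  have st: "stress r0 i j p = (if i = j then - 3 * s + (1 + a) + a / s else 0) + (2 - 2 * a / s\<^sup>2) * (p $ i * p $ j)"
    by (simp add: stress_def s_def a_def)
  show ?thesis
  proof (cases "i = j")
    case True
    have "X + L * q + T = c * (Q + R * q)" if "X + T = c * Q" "L = c * R" for X L q T c Q R :: real
      unfolding that(2) using that(1) by (simp add: algebra_simps)
    from this[OF m l] show ?thesis unfolding e tr st using True by (simp only: if_True simp_thms)
  next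
    case False
    then show ?thesis unfolding e st using l by simp
  qed
qed

definition flat_disp :: "real \<Rightarrow> real \<Rightarrow> real^2 \<Rightarrow> real^2" where
  "flat_disp r0 \<nu> p = flat_coef r0 \<nu> (sq p) *\<^sub>R p"

lemma flat_coef_bounds:
  assumes "0 < r0" "r0 < 1" "-1 < \<nu>" "\<nu> \<le> 1/2" "p \<in> annulus r0"
  shows "\<bar>flat_coef r0 \<nu> (sq p)\<bar> \<le> 1" "\<bar>flat_coef' r0 \<nu> (sq p)\<bar> \<le> 1 + 1 / r0\<^sup>2"
proof -
  have s: "r0\<^sup>2 < sq p" "sq p < 1" using assms annulus_sq by auto
  have r: "0 < r0\<^sup>2" "r0\<^sup>2 < 1" using assms by (auto simp: power_less_one_iff abs_square_less_1)
  have sp: "0 < sq p" using s r by linarith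
  define t where "t = r0\<^sup>2 / sq p"
  define a where "a = r0\<^sup>2"
  define S where "S = sq p"
  have t: "0 \<le> t" "t \<le> 1" using s r sp by (auto simp: t_def pos_divide_le_eq intro!: divide_nonneg_pos)
  have "\<bar>(3 * \<nu> - 1) / 48 * S\<bar> \<le> 1 / 12 * 1"
    unfolding abs_mult using assms s sp by (intro mult_mono) (auto simp: S_def)
  moreover have "0 \<le> (1 - \<nu>) * (1 + a)" "(1 - \<nu>) * (1 + a) \<le> 2 * 2"
    using assms r mult_mono[of "1 - \<nu>" 2 "1 + a" 2] by (auto simp: a_def)
  then have "\<bar>(1 - \<nu>) * (1 + a) / 16\<bar> \<le> 2 * 2 / 16"
    by linarith
  moreover have "\<bar>(1 + \<nu>) / 16 * t\<bar> \<le> 2 / 16 * 1"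
    unfolding abs_mult using assms t by (intro mult_mono) auto
  moreover have "flat_coef r0 \<nu> (sq p) = (3 * \<nu> - 1) / 48 * S + (1 - \<nu>) * (1 + a) / 16 + (1 + \<nu>) / 16 * t"
    by (simp add: flat_coef_def S_def a_def t_def)
  ultimately show "\<bar>flat_coef r0 \<nu> (sq p)\<bar> \<le> 1" by linarith
  have "1 / sq p \<le> 1 / r0\<^sup>2" by (rule divide_left_mono) (use s r mult_pos_pos[OF sp r(1)] in auto)
  then have u: "0 \<le> t / sq p" "t / sq p \<le> 1 / r0\<^sup>2"
    using t sp mult_mono[of t 1 "1 / sq p" "1 / r0\<^sup>2"] by auto
  have "\<bar>(1 + \<nu>) / 16 * (t / sq p)\<bar> \<le> 1 * (1 / r0\<^sup>2)"
    unfolding abs_mult using assms u by (intro mult_mono) auto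
  moreover have "\<bar>(3 * \<nu> - 1) / 48\<bar> \<le> 1" using assms by simp
  moreover have "flat_coef' r0 \<nu> (sq p) = (3 * \<nu> - 1) / 48 - (1 + \<nu>) / 16 * (t / sq p)"
    by (simp add: flat_coef'_def t_def power2_eq_square)
  ultimately show "\<bar>flat_coef' r0 \<nu> (sq p)\<bar> \<le> 1 + 1 / r0\<^sup>2" by linarith
qed

lemma flat_disp_weak:
  fixes r0 \<nu> :: real
  assumes r: "0 < r0" "r0 < 1" "-1 < \<nu>" "\<nu> \<le> 1/2"
  defines "u \<equiv> \<lambda>i p. flat_disp r0 \<nu> p $ i"
  shows "has_weak_partial (annulus r0) j (u i) (partial j (u i))" "u i \<in> L2 (annulus r0)" "partial j (u i) \<in> L2 (annulus r0)"
    "p \<in> annulus r0 \<Longrightarrow> partial j (u i) p = (if i = j then flat_coef r0 \<nu> (sq p) else 0) + 2 * flat_coef' r0 \<nu> (sq p) * (p $ i * p $ j)"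
proof -
  have u: "u i = (\<lambda>p. flat_coef r0 \<nu> (sq p) * p $ i)" for i by (simp add: u_def flat_disp_def)
  have D: "(u i has_derivative (\<lambda>h. flat_coef r0 \<nu> (sq p) * h $ i
      + flat_coef' r0 \<nu> (sq p) * (2 * p $ 1 * h $ 1 + 2 * p $ 2 * h $ 2) * p $ i)) (at p)"
    if "p \<in> annulus r0" for p i
  proof -
    have "sq p \<noteq> 0" using that annulus_sq[OF r(1)] r(1) by (metis less_asym zero_less_power)
    from has_derivative_mult[OF has_derivative_radial[OF DERIV_flat_coef[OF this]] has_derivative_component]
    show ?thesis unfolding u .
  qed
  show pd: "partial j (u i) p = (if i = j then flat_coef r0 \<nu> (sq p) else 0) + 2 * flat_coef' r0 \<nu> (sq p) * (p $ i * p $ j)"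
    if "p \<in> annulus r0" for p i j
    using has_derivative_imp_partial[OF D[OF that], of j i] exhaust_2[of j] by (auto simp: axis_def)
  have c1: "\<bar>p $ k\<bar> \<le> 1" if "p \<in> annulus r0" for p :: "real^2" and k
    using component_le_norm_cart[of p k] that by (auto simp: annulus_def)
  let ?B = "1 + 2 * (1 + 1 / r0\<^sup>2)"
  have B: "1 \<le> ?B" by simp
  have *: "has_weak_partial (annulus r0) j (u i) (partial j (u i)) \<and> u i \<in> L2 (annulus r0) \<and> partial j (u i) \<in> L2 (annulus r0)" for i j
  proof -
    have "loc_lip (u i) p" if "p \<in> annulus r0" for p
    proof -
      \<comment> \<open>A function smooth on the whole plane with the same values on the annulus;
        the Lipschitz property is read off from it.\<close>
      let ?f = "\<lambda>p. ((3 * \<nu> - 1) / 48 * sq p + (1 - \<nu>) * (1 + r0\<^sup>2) / 16 + (1 + \<nu>) * r0\<^sup>2 / 16 * inverse (sq p + bump (r0\<^sup>2 - sq p))) * p $ i"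
      have "Ck 1 ?f"
        using r(1) by (intro Ck_mult Ck_add Ck_const Ck_power2 Ck_component Ck_inverse_sq) auto
      then have "loc_lip ?f p" by (rule Ck_imp_loc_lip)
      moreover have "eventually (\<lambda>y. y \<in> annulus r0) (nhds p)"
        using open_annulus that by (rule eventually_nhds_in_open)
      then have "eventually (\<lambda>y. u i y = ?f y) (nhds p)"
      proof eventually_elim
        case (elim y)
        then have "r0\<^sup>2 \<le> sq y" using annulus_sq[OF r(1)] by (auto intro: less_imp_le)
        from inverse_sq_eq[OF this] show ?case by (simp only: u flat_coef_def) simp
      qed
      ultimately show ?thesis by (rule loc_lip_cong)
    qed
    moreover have "AE p in lebesgue. p \<in> annulus r0 \<longrightarrow> u i differentiable (at p)"
      using D by (auto simp: differentiable_def)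
    moreover have "\<bar>u i p\<bar> \<le> ?B" if "p \<in> annulus r0" for p
    proof -
      have "\<bar>u i p\<bar> \<le> 1 * 1"
        unfolding u abs_mult by (intro mult_mono flat_coef_bounds[OF r that] c1[OF that]) auto
      with B show ?thesis by linarith
    qed
    moreover have "\<bar>partial j (u i) p\<bar> \<le> ?B" if "p \<in> annulus r0" for p
    proof -
      have "\<bar>flat_coef' r0 \<nu> (sq p) * (p $ i * p $ j)\<bar> \<le> (1 + 1 / r0\<^sup>2) * (1 * 1)"
        unfolding abs_mult by (intro mult_mono flat_coef_bounds(2)[OF r that] c1[OF that]) auto
      moreover have "\<bar>if i = j then flat_coef r0 \<nu> (sq p) else 0\<bar> \<le> 1" using flat_coef_bounds(1)[OF r that] by auto
      ultimately show ?thesis unfolding pd[OF that] by linarith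
    qed
    then have "AE p in lebesgue. p \<in> annulus r0 \<longrightarrow> \<bar>partial j (u i) p\<bar> \<le> ?B" by auto
    ultimately show ?thesis
      using loc_lip_weak_partial[OF open_annulus bounded_annulus, of r0 "u i" ?B j] by blast
  qed
  show "has_weak_partial (annulus r0) j (u i) (partial j (u i))" "u i \<in> L2 (annulus r0)" "partial j (u i) \<in> L2 (annulus r0)"
    using * by auto
qed

lemma zero_weak_partial: "has_weak_partial \<Omega> i (\<lambda>p. 0) (\<lambda>p. 0)"
  by (simp add: has_weak_partial_def locally_integrable_on_def set_integrable_def set_lebesgue_integral_def)

lemma zero_Sobolev: "(\<lambda>p. 0) \<in> Sobolev k \<Omega>"
proof (induction k)
  case (Suc k)
  then show ?case using zero_weak_partial subsetD[OF Sobolev_subset_L2 Suc.IH] by auto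
qed (simp add: L2_def)

lemma weak_hessian_AE_zero:
  assumes "open \<Omega>" "\<eta> \<in> Sobolev 2 \<Omega>" "AE p in lebesgue. p \<in> \<Omega> \<longrightarrow> \<eta> p = 0"
  shows "AE p in lebesgue. p \<in> \<Omega> \<longrightarrow> weak_partial \<Omega> i \<eta> p = 0"
    "AE p in lebesgue. p \<in> \<Omega> \<longrightarrow> weak_partial \<Omega> j (weak_partial \<Omega> i \<eta>) p = 0"
proof -
  note w = Sobolev_2_weak_partial[OF assms(1,2)]
  have z: "locally_integrable_on (\<lambda>p. 0) \<Omega>" by (rule has_weak_partialD(1)[OF zero_weak_partial])
  have eq: "AE p in lebesgue. p \<in> \<Omega> \<longrightarrow> 0 = \<eta> p" using assms(3) by (auto elim!: eventually_mono)
  have "has_weak_partial \<Omega> i \<eta> (\<lambda>p. 0)"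
    by (rule has_weak_partial_cong_AE[OF zero_weak_partial has_weak_partialD(1)[OF w(2)] z eq]) simp
  then show 1: "AE p in lebesgue. p \<in> \<Omega> \<longrightarrow> weak_partial \<Omega> i \<eta> p = 0"
    by (rule weak_partial_AE_eq[OF assms(1)])
  then have eq: "AE p in lebesgue. p \<in> \<Omega> \<longrightarrow> 0 = weak_partial \<Omega> i \<eta> p" by (auto elim!: eventually_mono)
  have "has_weak_partial \<Omega> j (weak_partial \<Omega> i \<eta>) (\<lambda>p. 0)"
    by (rule has_weak_partial_cong_AE[OF zero_weak_partial has_weak_partialD(2)[OF w(2)] z eq]) simp
  then show "AE p in lebesgue. p \<in> \<Omega> \<longrightarrow> weak_partial \<Omega> j (weak_partial \<Omega> i \<eta>) p = 0"
    by (rule weak_partial_AE_eq[OF assms(1)])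
qed

lemma bounded_mult_integrable:
  fixes f g :: "real^2 \<Rightarrow> real"
  assumes "integrable (lebesgue_on \<Omega>) f" "g \<in> borel_measurable borel" "\<And>p. p \<in> \<Omega> \<Longrightarrow> \<bar>g p\<bar> \<le> B"
  shows "integrable (lebesgue_on \<Omega>) (\<lambda>p. g p * f p)"
proof (rule Bochner_Integration.integrable_bound)
  show "integrable (lebesgue_on \<Omega>) (\<lambda>p. B * f p)" using assms(1) by simp
  have "g \<in> borel_measurable (lebesgue_on \<Omega>)"
    using assms(2) by (intro measurable_restrict_space1 measurable_completion) simp
  then show "(\<lambda>p. g p * f p) \<in> borel_measurable (lebesgue_on \<Omega>)"
    using borel_measurable_integrable[OF assms(1)] by measurable
  show "AE p in lebesgue_on \<Omega>. norm (g p * f p) \<le> norm (B * f p)"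
  proof (rule AE_I2)
    fix p assume "p \<in> space (lebesgue_on \<Omega>)"
    then have "\<bar>g p\<bar> \<le> \<bar>B\<bar>" using assms(3)[of p] by simp
    then show "norm (g p * f p) \<le> norm (B * f p)"
      unfolding real_norm_def abs_mult by (rule mult_right_mono) simp
  qed
qed

lemma strain_nth:
  "strain r0 (u, \<eta>) p $ i $ j = weak_partial (annulus r0) i (\<lambda>y. u y $ j) p + weak_partial (annulus r0) j (\<lambda>y. u y $ i) p
    + weak_partial (annulus r0) i \<eta> p * weak_partial (annulus r0) j \<eta> p - g1 p $ i $ j"
  by (simp add: strain_def Let_def weak_jacobian_def weak_gradient_def transpose_def rowvector_def matrix_matrix_mult_def)

lemma g1_nth: "g1 p $ i $ j = (if i = j then sq p else 0) / 3 - p $ i * p $ j / 3"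
  using exhaust_2[of i] exhaust_2[of j] by (auto simp: g1_def power2_eq_square)

lemma transpose_strain: "transpose (strain r0 X p) = strain r0 X p"
  by (cases X) (auto simp: vec_eq_iff transpose_def strain_nth g1_nth mult.commute)

text \<open>The energy of the explicit flat competitor. It is compared with the infimum by
  \<open>flat_energy_le\<close>, an inequality in the direction that the lower bound uses.\<close>

definition flat_value :: "real \<Rightarrow> real \<Rightarrow> real" where
  "flat_value r0 \<nu> = (LINT p|lebesgue_on (annulus r0). energy_density \<nu> (flat_strain r0 \<nu> p))"

lemma lebesgue_on_measurable:
  assumes "f \<in> borel_measurable borel"
  shows "f \<in> borel_measurable (lebesgue_on \<Omega>)"
  using assms by (intro measurable_restrict_space1 measurable_completion) simp

lemma const_integrable_annulus: "integrable (lebesgue_on (annulus r0)) (\<lambda>p. c :: real)"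
  using L2_integrable[OF lmeasurable_annulus const_L2[OF lmeasurable_annulus]] .

lemma stress_symmetric: "stress r0 i j p = stress r0 j i p"
  by (auto simp: stress_def mult.commute)

lemma g1_bounded: "p \<in> annulus r0 \<Longrightarrow> \<bar>g1 p $ i $ j\<bar> \<le> 1"
proof -
  assume p: "p \<in> annulus r0"
  have c: "\<bar>p $ k\<bar> \<le> 1" for k
    using component_le_norm_cart[of p k] p by (auto simp: annulus_def)
  have q: "\<bar>p $ k * p $ l\<bar> \<le> 1" for k l
    using c by (simp add: abs_mult mult_le_one)
  show ?thesis
    using exhaust_2[of i] exhaust_2[of j] q[of 1 1] q[of 1 2] q[of 2 2]
    by (auto simp: g1_def power2_eq_square)
qed

lemma g1_measurable [measurable]: "(\<lambda>p. g1 p $ i $ j) \<in> borel_measurable borel"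
  unfolding g1_nth by measurable

lemma admissibleD:
  assumes "(u, \<eta>) \<in> admissible r0"
  shows "(\<lambda>p. u p $ i) \<in> Sobolev 1 (annulus r0)" "\<eta> \<in> Sobolev 2 (annulus r0)"
  using assms by (auto simp: admissible_def)

text \<open>The stress is symmetric, so on the symmetrized gradient it acts as twice the stress on
  the full gradient, and each row of that integrates to zero by \<open>stress_equilibrium\<close>.
  What remains depends on \<eta> and \<open>g1\<close> alone.\<close>

lemma stress_strain_integral:
  fixes r0 :: real
  assumes r0: "0 < r0" "r0 < 1" and X: "(u, \<eta>) \<in> admissible r0"
  defines "v \<equiv> \<lambda>i. weak_partial (annulus r0) i \<eta>"
  shows "integrable (lebesgue_on (annulus r0)) (\<lambda>p. \<Sum>i\<in>UNIV. \<Sum>j\<in>UNIV. stress r0 i j p * strain r0 (u, \<eta>) p $ i $ j)"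
      (is "integrable ?L ?F")
    and "integrable (lebesgue_on (annulus r0)) (\<lambda>p. \<Sum>i\<in>UNIV. \<Sum>j\<in>UNIV. stress r0 i j p * (v i p * v j p))"
    and "(LINT p|lebesgue_on (annulus r0). (\<Sum>i\<in>UNIV. \<Sum>j\<in>UNIV. stress r0 i j p * strain r0 (u, \<eta>) p $ i $ j))
      = (LINT p|lebesgue_on (annulus r0). (\<Sum>i\<in>UNIV. \<Sum>j\<in>UNIV. stress r0 i j p * (v i p * v j p)))
        - (LINT p|lebesgue_on (annulus r0). (\<Sum>i\<in>UNIV. \<Sum>j\<in>UNIV. stress r0 i j p * g1 p $ i $ j))"
proof -
  let ?\<Omega> = "annulus r0"
  define d where "d = (\<lambda>i j. weak_partial ?\<Omega> j (\<lambda>p. u p $ i))"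
  note du = Sobolev_1_weak_partial[OF open_annulus admissibleD(1)[OF X]]
  note dv = Sobolev_2_weak_partial[OF open_annulus admissibleD(2)[OF X]]
  have d_int: "integrable ?L (d i j)" for i j
    unfolding d_def by (rule L2_integrable[OF lmeasurable_annulus du(3)])
  have v_int: "integrable ?L (\<lambda>p. v i p * v j p)" for i j
    unfolding v_def by (rule L2_mult_integrable[OF dv(3) dv(3)])
  note bi = bounded_mult_integrable[OF _ stress_measurable stress_bounded[OF r0]]
  have di: "integrable ?L (\<lambda>p. \<Sum>i\<in>UNIV. \<Sum>j\<in>UNIV. stress r0 i j p * d i j p)"
    by (intro Bochner_Integration.integrable_sum bi d_int)
  show vi: "integrable ?L (\<lambda>p. \<Sum>i\<in>UNIV. \<Sum>j\<in>UNIV. stress r0 i j p * (v i p * v j p))"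
    by (intro Bochner_Integration.integrable_sum bi v_int)
  have "integrable ?L (\<lambda>p. g1 p $ i $ j)" for i j
    using bounded_mult_integrable[OF const_integrable_annulus[of r0 1] g1_measurable g1_bounded] by simp
  then have gi: "integrable ?L (\<lambda>p. \<Sum>i\<in>UNIV. \<Sum>j\<in>UNIV. stress r0 i j p * g1 p $ i $ j)"
    by (intro Bochner_Integration.integrable_sum bi)
  have eq: "?F = (\<lambda>p. 2 * (\<Sum>i\<in>UNIV. \<Sum>j\<in>UNIV. stress r0 i j p * d i j p)
      + (\<Sum>i\<in>UNIV. \<Sum>j\<in>UNIV. stress r0 i j p * (v i p * v j p)) - (\<Sum>i\<in>UNIV. \<Sum>j\<in>UNIV. stress r0 i j p * g1 p $ i $ j))"
  proof
    fix p
    have "stress r0 2 1 p = stress r0 1 2 p" by (rule stress_symmetric)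
    then show "?F p = 2 * (\<Sum>i\<in>UNIV. \<Sum>j\<in>UNIV. stress r0 i j p * d i j p)
      + (\<Sum>i\<in>UNIV. \<Sum>j\<in>UNIV. stress r0 i j p * (v i p * v j p)) - (\<Sum>i\<in>UNIV. \<Sum>j\<in>UNIV. stress r0 i j p * g1 p $ i $ j)"
      by (simp add: strain_nth sum_2 d_def v_def algebra_simps)
  qed
  show "integrable ?L ?F"
    unfolding eq using di vi gi by auto
  have "(LINT p|?L. (\<Sum>i\<in>UNIV. \<Sum>j\<in>UNIV. stress r0 i j p * d i j p)) = (\<Sum>i\<in>UNIV. (LINT p|?L. (\<Sum>j\<in>UNIV. stress r0 i j p * d i j p)))"
    by (intro Bochner_Integration.integral_sum Bochner_Integration.integrable_sum bi d_int)
  also have "\<dots> = 0"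
    using stress_equilibrium[OF r0 du(1) du(2) du(3)] by (simp add: d_def)
  finally show "(LINT p|?L. ?F p) = (LINT p|?L. (\<Sum>i\<in>UNIV. \<Sum>j\<in>UNIV. stress r0 i j p * (v i p * v j p)))
        - (LINT p|?L. (\<Sum>i\<in>UNIV. \<Sum>j\<in>UNIV. stress r0 i j p * g1 p $ i $ j))"
    unfolding eq using di vi gi by simp
qed

text \<open>On symmetric matrices the density has the eigenvalue 1 on trace-free matrices and (1 +
  \<nu>) / (1 - \<nu>) on multiples of the identity, and both are at least (1 + \<nu>) / 2. The
  proof clears denominators and exhibits the difference as a sum of squares.\<close>

lemma energy_density_coercive:
  assumes \<nu>: "-1 < \<nu>" "\<nu> \<le> 1/2" and M: "transpose M = M"
  shows "(\<Sum>i\<in>UNIV. \<Sum>j\<in>UNIV. (M $ i $ j)\<^sup>2) \<le> 2 / (1 + \<nu>) * energy_density \<nu> M"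
proof -
  define a b c where "a = M $ 1 $ 1" and "b = M $ 2 $ 2" and "c = M $ 1 $ 2"
  have "M $ 2 $ 1 = c"
    using arg_cong[OF M, of "\<lambda>A. A $ 2 $ 1"] by (simp add: c_def transpose_def)
  then have N: "(\<Sum>i\<in>UNIV. \<Sum>j\<in>UNIV. (M $ i $ j)\<^sup>2) = a\<^sup>2 + b\<^sup>2 + 2 * c\<^sup>2"
    and E: "energy_density \<nu> M = ((a + b)\<^sup>2 - (1 - \<nu>) * (2 * (a * b - c\<^sup>2))) / (1 - \<nu>)"
    using \<nu> by (auto simp: energy_density_def trace_def det_2 sum_2 a_def b_def c_def power2_eq_square field_simps)
  have "2 * ((a + b)\<^sup>2 - (1 - \<nu>) * (2 * (a * b - c\<^sup>2))) - (1 + \<nu>) * (1 - \<nu>) * (a\<^sup>2 + b\<^sup>2 + 2 * c\<^sup>2)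
    = (1 + \<nu>)\<^sup>2 / 2 * (a + b)\<^sup>2 + (1 - \<nu>)\<^sup>2 / 2 * ((a - b)\<^sup>2 + 4 * c\<^sup>2)"
    by (simp add: power2_eq_square field_simps)
  moreover have "0 \<le> (1 + \<nu>)\<^sup>2 / 2 * (a + b)\<^sup>2 + (1 - \<nu>)\<^sup>2 / 2 * ((a - b)\<^sup>2 + 4 * c\<^sup>2)"
    by (intro add_nonneg_nonneg mult_nonneg_nonneg) auto
  ultimately have "(1 + \<nu>) * (1 - \<nu>) * (a\<^sup>2 + b\<^sup>2 + 2 * c\<^sup>2) \<le> 2 * ((a + b)\<^sup>2 - (1 - \<nu>) * (2 * (a * b - c\<^sup>2)))"
    by linarith
  then have "a\<^sup>2 + b\<^sup>2 + 2 * c\<^sup>2 \<le> 2 * ((a + b)\<^sup>2 - (1 - \<nu>) * (2 * (a * b - c\<^sup>2))) / ((1 + \<nu>) * (1 - \<nu>))"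
    using \<nu> by (subst pos_le_divide_eq) (auto simp: mult.commute)
  then show ?thesis unfolding N E by simp
qed

section \<open>Comparison of arbitrary deformations with the flat one\<close>

context
  fixes r0 \<nu> :: real
  assumes r0: "0 < r0" "r0 < 1" and \<nu>: "-1 < \<nu>" "\<nu> \<le> 1/2"
begin

lemma flat_disp_admissible: "(flat_disp r0 \<nu>, \<lambda>p. 0) \<in> admissible r0"
proof -
  have "(\<lambda>p. flat_disp r0 \<nu> p $ i) \<in> Sobolev 1 (annulus r0)" for i
  proof -
    have "\<forall>j. \<exists>v\<in>L2 (annulus r0). has_weak_partial (annulus r0) j (\<lambda>p. flat_disp r0 \<nu> p $ i) v"
      using flat_disp_weak(1,3)[OF r0 \<nu>] by blast
    then show ?thesis using flat_disp_weak(2)[OF r0 \<nu>] by simp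
  qed
  then show ?thesis by (simp add: admissible_def zero_Sobolev)
qed

lemma flat_disp_strain:
  "AE p in lebesgue_on (annulus r0). strain r0 (flat_disp r0 \<nu>, \<lambda>p. 0) p = flat_strain r0 \<nu> p"
proof -
  have 1: "AE p in lebesgue. \<forall>i j. p \<in> annulus r0 \<longrightarrow> weak_partial (annulus r0) j (\<lambda>p. flat_disp r0 \<nu> p $ i) p
      = partial j (\<lambda>p. flat_disp r0 \<nu> p $ i) p"
    unfolding AE_all_countable using weak_partial_AE_eq[OF open_annulus flat_disp_weak(1)[OF r0 \<nu>]] by blast
  have 2: "AE p in lebesgue. \<forall>i. p \<in> annulus r0 \<longrightarrow> weak_partial (annulus r0) i (\<lambda>p. 0) p = 0"
    unfolding AE_all_countable using weak_partial_AE_eq[OF open_annulus zero_weak_partial] by blast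
  show ?thesis
    unfolding AE_lebesgue_on_iff[OF sets_annulus]
    using 1 2
  proof eventually_elim
    case (elim p)
    show ?case
    proof
      assume p: "p \<in> annulus r0"
      have "strain r0 (flat_disp r0 \<nu>, \<lambda>p. 0) p $ i $ j = flat_strain r0 \<nu> p $ i $ j" for i j
        using elim p flat_disp_weak(4)[OF r0 \<nu> p]
        by (simp add: strain_nth g1_nth flat_strain_def algebra_simps)
      then show "strain r0 (flat_disp r0 \<nu>, \<lambda>p. 0) p = flat_strain r0 \<nu> p" by (simp add: vec_eq_iff)
    qed
  qed
qed

text \<open>The energy of the flat strain is its stress paired with itself. For other strains the
  nonnegative first term of \<open>energy_density_expand\<close> is dropped, which leaves the
  tangent plane of the convex density at the flat strain.\<close>

lemma flat_strain_density:
  assumes "p \<in> annulus r0"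
  shows "energy_density \<nu> (flat_strain r0 \<nu> p) = (1 + \<nu>) / 8 * (\<Sum>i\<in>UNIV. \<Sum>j\<in>UNIV. stress r0 i j p * flat_strain r0 \<nu> p $ i $ j)"
    and "transpose M = M \<Longrightarrow> energy_density \<nu> M \<ge> 2 * ((1 + \<nu>) / 8 * (\<Sum>i\<in>UNIV. \<Sum>j\<in>UNIV. stress r0 i j p * M $ i $ j))
      - energy_density \<nu> (flat_strain r0 \<nu> p)"
proof -
  have s: "sq p \<noteq> 0" using assms annulus_sq[OF r0(1)] r0(1) by (metis less_asym zero_less_power)
  have n1: "\<nu> \<noteq> 1" using \<nu> by simp
  have ss: "(\<Sum>i\<in>UNIV. \<Sum>j\<in>UNIV. (flat_strain r0 \<nu> p $ i $ j + (if i = j then \<nu> / (1 - \<nu>) * trace (flat_strain r0 \<nu> p) else 0)) * M $ i $ j)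
    = (1 + \<nu>) / 8 * (\<Sum>i\<in>UNIV. \<Sum>j\<in>UNIV. stress r0 i j p * M $ i $ j)" for M :: "real^2^2"
    unfolding flat_strain_stress[OF s n1] by (simp add: sum_distrib_left mult.assoc)
  have "energy_density \<nu> (flat_strain r0 \<nu> p - flat_strain r0 \<nu> p) = 0"
    by (simp add: energy_density_def trace_def det_2)
  with energy_density_expand[OF transpose_flat_strain transpose_flat_strain n1, of r0 \<nu> p r0 \<nu> p]
  show 1: "energy_density \<nu> (flat_strain r0 \<nu> p) = (1 + \<nu>) / 8 * (\<Sum>i\<in>UNIV. \<Sum>j\<in>UNIV. stress r0 i j p * flat_strain r0 \<nu> p $ i $ j)"
    unfolding ss by linarith
  assume M: "transpose M = M"
  have "transpose (M - flat_strain r0 \<nu> p) = M - flat_strain r0 \<nu> p"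
    using M transpose_flat_strain[of r0 \<nu> p] by (simp add: transpose_def vec_eq_iff)
  from energy_density_nonneg[OF \<nu> this] energy_density_expand[OF M transpose_flat_strain n1, of r0 \<nu> p]
  show "energy_density \<nu> M \<ge> 2 * ((1 + \<nu>) / 8 * (\<Sum>i\<in>UNIV. \<Sum>j\<in>UNIV. stress r0 i j p * M $ i $ j))
      - energy_density \<nu> (flat_strain r0 \<nu> p)"
    unfolding ss 1 by linarith
qed

text \<open>The flat energy is the stress paired with its own strain, and for zero \<eta>
  \<open>stress_strain_integral\<close> leaves only the term with \<open>g1\<close>. The same term
  occurs for every admissible deformation, which makes the comparison sharp.\<close>

lemma flat_value_eq:
  "integrable (lebesgue_on (annulus r0)) (\<lambda>p. energy_density \<nu> (flat_strain r0 \<nu> p))"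
  "flat_value r0 \<nu> = - ((1 + \<nu>) / 8 * (LINT p|lebesgue_on (annulus r0). (\<Sum>i\<in>UNIV. \<Sum>j\<in>UNIV. stress r0 i j p * g1 p $ i $ j)))"
proof -
  let ?L = "lebesgue_on (annulus r0)"
  let ?S = "\<lambda>p. strain r0 (flat_disp r0 \<nu>, \<lambda>p. 0) p"
  let ?F = "\<lambda>p. \<Sum>i\<in>UNIV. \<Sum>j\<in>UNIV. stress r0 i j p * ?S p $ i $ j"
  note si = stress_strain_integral[OF r0 flat_disp_admissible]
  have fm: "(\<lambda>p. energy_density \<nu> (flat_strain r0 \<nu> p)) \<in> borel_measurable borel"
    unfolding energy_density_def trace_def det_2 sum_2 flat_strain_def flat_coef_def flat_coef'_def
    by simp
  have ae: "AE p in ?L. (1 + \<nu>) / 8 * ?F p = energy_density \<nu> (flat_strain r0 \<nu> p)"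
    using flat_disp_strain AE_space[of ?L] by eventually_elim (simp add: flat_strain_density)
  have Fi: "integrable ?L (\<lambda>p. (1 + \<nu>) / 8 * ?F p)" using si(1) by simp
  show i: "integrable ?L (\<lambda>p. energy_density \<nu> (flat_strain r0 \<nu> p))"
    by (rule integrable_cong_AE_imp[OF Fi lebesgue_on_measurable[OF fm]])
      (use ae in \<open>auto elim!: eventually_mono\<close>)
  have "flat_value r0 \<nu> = (LINT p|?L. (1 + \<nu>) / 8 * ?F p)"
    unfolding flat_value_def using i Fi
    by (intro integral_cong_AE borel_measurable_integrable) (use ae in \<open>auto elim!: eventually_mono\<close>)
  also have "\<dots> = (1 + \<nu>) / 8 * (LINT p|?L. ?F p)" by simp
  also have "(LINT p|?L. ?F p) = 0 - (LINT p|?L. (\<Sum>i\<in>UNIV. \<Sum>j\<in>UNIV. stress r0 i j p * g1 p $ i $ j))"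
  proof -
    let ?w = "\<lambda>i. weak_partial (annulus r0) i (\<lambda>p. 0 :: real)"
    have "AE p in lebesgue. \<forall>i. p \<in> annulus r0 \<longrightarrow> ?w i p = 0"
      unfolding AE_all_countable using weak_partial_AE_eq[OF open_annulus zero_weak_partial] by blast
    then have "AE p in ?L. (\<Sum>i\<in>UNIV. \<Sum>j\<in>UNIV. stress r0 i j p * (?w i p * ?w j p)) = 0"
      unfolding AE_lebesgue_on_iff[OF sets_annulus] by eventually_elim auto
    then have "(LINT p|?L. (\<Sum>i\<in>UNIV. \<Sum>j\<in>UNIV. stress r0 i j p * (?w i p * ?w j p))) = 0"
      by (rule integral_eq_zero_AE)
    then show ?thesis unfolding si(3) by simp
  qed
  finally show "flat_value r0 \<nu> = - ((1 + \<nu>) / 8 * (LINT p|?L. (\<Sum>i\<in>UNIV. \<Sum>j\<in>UNIV. stress r0 i j p * g1 p $ i $ j)))"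
    by simp
qed

lemma bending_energy_flat:
  assumes "\<eta> \<in> Sobolev 2 (annulus r0)" "AE p in lebesgue_on (annulus r0). \<eta> p = 0"
  shows "bending_energy r0 \<nu> (u, \<eta>) = 0"
proof -
  let ?\<Omega> = "annulus r0"
  have z: "AE p in lebesgue. p \<in> ?\<Omega> \<longrightarrow> \<eta> p = 0" using assms(2) by (simp add: AE_lebesgue_on_iff)
  have "AE p in lebesgue. \<forall>i j. p \<in> ?\<Omega> \<longrightarrow> weak_partial ?\<Omega> j (weak_partial ?\<Omega> i \<eta>) p = 0"
    unfolding AE_all_countable using weak_hessian_AE_zero(2)[OF open_annulus assms(1) z] by blast
  then have "AE p in lebesgue. ennreal (energy_density \<nu> (weak_hessian ?\<Omega> \<eta> p)) * indicator ?\<Omega> p = 0"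
  proof eventually_elim
    case (elim p)
    then show ?case
      by (cases "p \<in> ?\<Omega>") (simp_all add: energy_density_def weak_hessian_def trace_def det_2 sum_2)
  qed
  then have "(\<integral>\<^sup>+p\<in>?\<Omega>. ennreal (energy_density \<nu> (weak_hessian ?\<Omega> \<eta> p)) \<partial>lebesgue) = (\<integral>\<^sup>+(p::real^2). 0 \<partial>lebesgue)"
    by (rule nn_integral_cong_AE)
  then show ?thesis by (simp add: bending_energy_def)
qed

lemma flat_energy_le: "flat_energy r0 \<nu> \<tau> \<le> ennreal (flat_value r0 \<nu>)"
proof -
  let ?X = "(flat_disp r0 \<nu>, \<lambda>p. 0 :: real)" let ?L = "lebesgue_on (annulus r0)"
  have "?X \<in> admissible_flat r0" using flat_disp_admissible by (simp add: admissible_flat_def)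
  then have "flat_energy r0 \<nu> \<tau> \<le> energy r0 \<nu> \<tau> ?X"
    unfolding flat_energy_def by (rule INF_lower)
  also have "\<dots> = stretching_energy r0 \<nu> ?X"
    by (simp add: energy_def bending_energy_flat zero_Sobolev)
  also have "\<dots> = (\<integral>\<^sup>+p. ennreal (energy_density \<nu> (strain r0 ?X p)) \<partial>?L)"
    unfolding stretching_energy_def by (simp add: nn_integral_restrict_space)
  also have "\<dots> = (\<integral>\<^sup>+p. ennreal (energy_density \<nu> (flat_strain r0 \<nu> p)) \<partial>?L)"
    by (rule nn_integral_cong_AE) (use flat_disp_strain in \<open>auto elim!: eventually_mono\<close>)
  also have "\<dots> = ennreal (flat_value r0 \<nu>)"
    unfolding flat_value_def
    by (rule nn_integral_eq_integral[OF flat_value_eq(1)])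
      (auto intro!: AE_I2 energy_density_nonneg[OF \<nu> transpose_flat_strain])
  finally show ?thesis .
qed

text \<open>Integrate the tangent inequality at the flat strain. Its linear term is twice
  \<open>flat_value\<close> plus a term quadratic in D\<eta>, and the subtracted energy of the flat
  strain leaves one copy of \<open>flat_value\<close>.\<close>

lemma stretching_lower_bound:
  assumes X: "(u, \<eta>) \<in> admissible r0"
  shows "ennreal (flat_value r0 \<nu>) \<le> stretching_energy r0 \<nu> (u, \<eta>)
    + ennreal (8 + 2 / r0\<^sup>2) * (\<integral>\<^sup>+p\<in>annulus r0. ennreal (\<Sum>i\<in>UNIV. (weak_partial (annulus r0) i \<eta> p)\<^sup>2) \<partial>lebesgue)"
proof -
  let ?L = "lebesgue_on (annulus r0)" let ?K = "8 + 2 / r0\<^sup>2"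
  define v where "v = (\<lambda>i. weak_partial (annulus r0) i \<eta>)"
  let ?V = "\<lambda>p. \<Sum>i\<in>UNIV. (v i p)\<^sup>2"
  have v: "weak_partial (annulus r0) i \<eta> = v i" for i by (simp add: v_def)
  note si = stress_strain_integral[OF r0 X, unfolded v]
  have V_int: "integrable ?L ?V"
    unfolding v_def using Sobolev_2_weak_partial(3)[OF open_annulus admissibleD(2)[OF X]]
    by (intro Bochner_Integration.integrable_sum) (auto simp: L2_def)
  let ?F = "\<lambda>p. \<Sum>i\<in>UNIV. \<Sum>j\<in>UNIV. stress r0 i j p * strain r0 (u, \<eta>) p $ i $ j"
  let ?Q = "\<lambda>p. \<Sum>i\<in>UNIV. \<Sum>j\<in>UNIV. stress r0 i j p * (v i p * v j p)"
  let ?f = "\<lambda>p. 2 * ((1 + \<nu>) / 8 * ?F p) - energy_density \<nu> (flat_strain r0 \<nu> p)"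
  have Ff: "integrable ?L ?f" using si(1) flat_value_eq(1) by auto
  have f_val: "(LINT p|?L. ?f p) = flat_value r0 \<nu> + (1 + \<nu>) / 4 * (LINT p|?L. ?Q p)"
  proof -
    have "(LINT p|?L. ?f p) = 2 * ((1 + \<nu>) / 8 * (LINT p|?L. ?F p)) - flat_value r0 \<nu>"
      unfolding flat_value_def using si(1) flat_value_eq(1) by simp
    also have "\<dots> = flat_value r0 \<nu> + (1 + \<nu>) / 4 * (LINT p|?L. ?Q p)"
    proof -
      have "2 * ((1 + \<nu>) / 8 * (Q - G)) - F = F + (1 + \<nu>) / 4 * Q" if "F = - ((1 + \<nu>) / 8 * G)" for F G Q
        unfolding that by (simp add: field_simps)
      from this[OF flat_value_eq(2)] show ?thesis unfolding si(3) .
    qed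
    finally show ?thesis .
  qed
  have Q_ge: "- (2 * ?K * (LINT p|?L. ?V p)) \<le> (LINT p|?L. ?Q p)"
  proof -
    have "(LINT p|?L. - (2 * ?K) * ?V p) \<le> (LINT p|?L. ?Q p)"
    proof (rule Bochner_Integration.integral_mono)
      show "integrable ?L (\<lambda>p. - (2 * ?K) * ?V p)" using V_int by simp
      fix p assume "p \<in> space ?L"
      then have b: "\<bar>stress r0 i j p\<bar> \<le> ?K" for i j using stress_bounded[OF r0] by simp
      have "\<bar>?Q p\<bar> \<le> (\<Sum>i\<in>UNIV. \<Sum>j\<in>UNIV. \<bar>stress r0 i j p * (v i p * v j p)\<bar>)"
        by (intro order_trans[OF sum_abs] sum_mono order_refl)
      also have "\<dots> \<le> (\<Sum>i\<in>UNIV. \<Sum>j\<in>UNIV. ?K * \<bar>v i p * v j p\<bar>)"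
        unfolding abs_mult[of "stress r0 _ _ p"] by (intro sum_mono mult_right_mono b) auto
      also have "\<dots> = ?K * (\<bar>v 1 p\<bar> + \<bar>v 2 p\<bar>)\<^sup>2"
        by (simp add: sum_2 abs_mult power2_eq_square algebra_simps)
      also have "\<dots> \<le> ?K * (2 * ?V p)"
      proof (rule mult_left_mono)
        show "(\<bar>v 1 p\<bar> + \<bar>v 2 p\<bar>)\<^sup>2 \<le> 2 * ?V p"
          using sum_squares_bound[of "\<bar>v 1 p\<bar>" "\<bar>v 2 p\<bar>"] by (simp add: sum_2 power2_sum)
      qed simp
      finally show "- (2 * ?K) * ?V p \<le> ?Q p" by (simp add: algebra_simps abs_le_iff)
    qed (rule si(2))
    then show ?thesis unfolding integral_mult_right_zero by (simp only: mult_minus_left)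
  qed
  have V0: "0 \<le> (LINT p|?L. ?V p)" by (intro Bochner_Integration.integral_nonneg sum_nonneg) auto
  \<comment> \<open>Collecting the loss: the bound K of the stress entries and (|v1| + |v2|)^2 \<le>
    2 |v|^2 give 2 K, which (1 + \<nu>) / 4 \<le> 1/2 reduces to K.\<close>
  have "flat_value r0 \<nu> - ?K * (LINT p|?L. ?V p) \<le> (LINT p|?L. ?f p)"
  proof -
    have "(1 + \<nu>) / 4 * (2 * ?K * (LINT p|?L. ?V p)) \<le> 1 / 2 * (2 * ?K * (LINT p|?L. ?V p))"
      using \<nu> V0 by (intro mult_right_mono mult_nonneg_nonneg) auto
    moreover have "(1 + \<nu>) / 4 * - (2 * ?K * (LINT p|?L. ?V p)) \<le> (1 + \<nu>) / 4 * (LINT p|?L. ?Q p)"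
      using \<nu> by (intro mult_left_mono Q_ge) auto
    moreover have "F - k * V \<le> F + c * Q" if "c * (2 * k * V) \<le> 1 / 2 * (2 * k * V)" "c * - (2 * k * V) \<le> c * Q" for F k V c Q :: real
      using that by simp
    ultimately show ?thesis unfolding f_val by blast
  qed
  then have "ennreal (flat_value r0 \<nu>) \<le> ennreal (LINT p|?L. ?f p) + ennreal (?K * (LINT p|?L. ?V p))"
  proof -
    \<comment> \<open>Here \<open>a\<close> may be negative, in which case \<open>ennreal a\<close>
      is 0.\<close>
    have sub: "ennreal (a + b) \<le> ennreal a + ennreal b" if "b \<ge> 0" for a b
      using that by (cases "a \<ge> 0") (auto simp: ennreal_neg intro!: ennreal_leI)
    have "ennreal (flat_value r0 \<nu>) \<le> ennreal ((LINT p|?L. ?f p) + ?K * (LINT p|?L. ?V p))"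
      by (rule ennreal_leI) (use \<open>flat_value r0 \<nu> - ?K * (LINT p|?L. ?V p) \<le> (LINT p|?L. ?f p)\<close> in linarith)
    also have "\<dots> \<le> ennreal (LINT p|?L. ?f p) + ennreal (?K * (LINT p|?L. ?V p))"
      by (rule sub) (use V0 in \<open>intro mult_nonneg_nonneg; simp\<close>)
    finally show ?thesis .
  qed
  also have "ennreal (?K * (LINT p|?L. ?V p)) = ennreal ?K * (\<integral>\<^sup>+p\<in>annulus r0. ennreal (?V p) \<partial>lebesgue)"
  proof -
    have "(\<integral>\<^sup>+p\<in>annulus r0. ennreal (?V p) \<partial>lebesgue) = (\<integral>\<^sup>+p. ennreal (?V p) \<partial>?L)"
      by (simp add: nn_integral_restrict_space)
    also have "\<dots> = ennreal (LINT p|?L. ?V p)"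
      by (rule nn_integral_eq_integral[OF V_int]) (auto intro!: AE_I2 sum_nonneg)
    finally show ?thesis using V0 by (simp add: ennreal_mult)
  qed
  also have "ennreal (LINT p|?L. ?f p) \<le> stretching_energy r0 \<nu> (u, \<eta>)"
  proof -
    \<comment> \<open>The tangent plane may be negative at some points, but the energy is an
      integral in [0, \<infinity>]. The positive part still lies below the density, which is
      nonnegative.\<close>
    have "(LINT p|?L. ?f p) \<le> (LINT p|?L. max 0 (?f p))"
      using Ff by (intro Bochner_Integration.integral_mono) auto
    then have "ennreal (LINT p|?L. ?f p) \<le> ennreal (LINT p|?L. max 0 (?f p))" by (rule ennreal_leI)
    also have "\<dots> = (\<integral>\<^sup>+p. ennreal (max 0 (?f p)) \<partial>?L)"
      using Ff by (intro nn_integral_eq_integral[symmetric]) auto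
    also have "\<dots> \<le> (\<integral>\<^sup>+p. ennreal (energy_density \<nu> (strain r0 (u, \<eta>) p)) \<partial>?L)"
    proof (rule nn_integral_mono)
      fix p assume "p \<in> space ?L"
      then have "p \<in> annulus r0" by simp
      from flat_strain_density(2)[OF this transpose_strain[of r0 "(u, \<eta>)" p]]
      show "ennreal (max 0 (?f p)) \<le> ennreal (energy_density \<nu> (strain r0 (u, \<eta>) p))"
        using energy_density_nonneg[OF \<nu> transpose_strain] by (intro ennreal_leI) simp
    qed
    also have "\<dots> = stretching_energy r0 \<nu> (u, \<eta>)"
      unfolding stretching_energy_def by (simp add: nn_integral_restrict_space)
    finally show ?thesis .
  qed
  finally show ?thesis by (simp add: v_def add_right_mono)
qed

end

section \<open>Symmetry, coercivity of bending and the lower bound\<close>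

lemma polar_add: "polar r (\<theta> + t) = rot t *v polar r \<theta>"
  by (simp add: vec_eq_iff forall_2 polar_def cos_add sin_add algebra_simps)

lemma polar_nth [simp]: "polar r \<theta> $ 1 = r * cos \<theta>" "polar r \<theta> $ 2 = r * sin \<theta>"
  by (simp_all add: polar_def)

lemma polar_Arg: "p = polar (norm p) (Arg (Complex (p $ 1) (p $ 2)))"
proof -
  let ?z = "Complex (p $ 1) (p $ 2)"
  have "cmod ?z = norm p" by (simp add: cmod_def norm_vec2)
  then have "?z = rcis (norm p) (Arg ?z)" using rcis_cmod_Arg[of ?z] by simp
  then have "Re ?z = norm p * cos (Arg ?z)" "Im ?z = norm p * sin (Arg ?z)"
    by (metis Re_rcis Im_rcis)+
  then show ?thesis by (simp add: vec_eq_iff forall_2)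
qed

text \<open>The pointwise bound asks for a symmetric matrix, and the weak Hessian is symmetric only
  almost everywhere, by \<open>weak_partial_commute\<close>.\<close>

lemma bending_coercive:
  assumes \<nu>: "-1 < \<nu>" "\<nu> \<le> 1/2" and \<eta>: "\<eta> \<in> Sobolev 2 (annulus r0)"
  shows "(\<integral>\<^sup>+p\<in>annulus r0. ennreal (\<Sum>i\<in>UNIV. \<Sum>j\<in>UNIV. (weak_partial (annulus r0) j (weak_partial (annulus r0) i \<eta>) p)\<^sup>2) \<partial>lebesgue)
    \<le> ennreal (2 / (1 + \<nu>)) * bending_energy r0 \<nu> (u, \<eta>)"
proof -
  let ?\<Omega> = "annulus r0" let ?L = "lebesgue_on ?\<Omega>"
  let ?H = "weak_hessian ?\<Omega> \<eta>"
  note w = Sobolev_2_weak_partial[OF open_annulus \<eta>]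
  have H: "?H p $ i $ j = weak_partial ?\<Omega> j (weak_partial ?\<Omega> i \<eta>) p" for i j p
    by (simp add: weak_hessian_def)
  have Hm: "(\<lambda>p. ?H p $ i $ j) \<in> borel_measurable ?L" for i j
    unfolding H using w(5) by (simp add: L2_def)
  have sym: "AE p in ?L. transpose (?H p) = ?H p"
  proof -
    have "AE p in lebesgue. \<forall>i j. p \<in> ?\<Omega> \<longrightarrow> ?H p $ i $ j = ?H p $ j $ i"
      unfolding AE_all_countable H using weak_partial_commute[OF open_annulus w(2) w(4) w(2) w(4)] by blast
    then show ?thesis
      unfolding AE_lebesgue_on_iff[OF sets_annulus] by eventually_elim (simp add: transpose_def vec_eq_iff)
  qed
  have Wm: "(\<lambda>p. ennreal (energy_density \<nu> (?H p))) \<in> borel_measurable ?L"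
    unfolding energy_density_def trace_def det_2 sum_2 using Hm by measurable
  have "(\<integral>\<^sup>+p\<in>?\<Omega>. ennreal (\<Sum>i\<in>UNIV. \<Sum>j\<in>UNIV. (?H p $ i $ j)\<^sup>2) \<partial>lebesgue)
    = (\<integral>\<^sup>+p. ennreal (\<Sum>i\<in>UNIV. \<Sum>j\<in>UNIV. (?H p $ i $ j)\<^sup>2) \<partial>?L)"
    by (simp add: nn_integral_restrict_space)
  also have "\<dots> \<le> (\<integral>\<^sup>+p. ennreal (2 / (1 + \<nu>)) * ennreal (energy_density \<nu> (?H p)) \<partial>?L)"
  proof (rule nn_integral_mono_AE)
    show "AE p in ?L. ennreal (\<Sum>i\<in>UNIV. \<Sum>j\<in>UNIV. (?H p $ i $ j)\<^sup>2) \<le> ennreal (2 / (1 + \<nu>)) * ennreal (energy_density \<nu> (?H p))"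
      using sym
    proof eventually_elim
      case (elim p)
      from energy_density_coercive[OF \<nu> elim] show ?case
        using \<nu> by (simp add: ennreal_mult'[symmetric] ennreal_leI)
    qed
  qed
  also have "\<dots> = ennreal (2 / (1 + \<nu>)) * (\<integral>\<^sup>+p. ennreal (energy_density \<nu> (?H p)) \<partial>?L)"
    by (rule nn_integral_cmult[OF Wm])
  also have "(\<integral>\<^sup>+p. ennreal (energy_density \<nu> (?H p)) \<partial>?L) = bending_energy r0 \<nu> (u, \<eta>)"
    by (simp add: bending_energy_def nn_integral_restrict_space)
  finally show ?thesis by (simp add: H)
qed

text \<open>Antiperiodicity is pointwise for the continuous representative. It passes to \<eta>
  because the exceptional null set stays null under rotation, so \<eta> and \<open>h\<close> agree
  both at p and at the rotated point.\<close>

lemma admissible_sym_rot: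
  assumes "(u, \<eta>) \<in> admissible_sym r0 n"
  shows "AE p in lebesgue. p \<in> annulus r0 \<longrightarrow> \<eta> (rot (pi / real n) *v p) = - \<eta> p"
proof -
  obtain h where h: "AE p in lebesgue_on (annulus r0). \<eta> p = h p"
    and anti: "\<And>r \<theta>. r \<in> {r0<..<1} \<Longrightarrow> h (polar r (\<theta> - pi / real n)) = - h (polar r \<theta>)"
    using assms unfolding admissible_sym_def by blast
  have 1: "AE p in lebesgue. p \<in> annulus r0 \<longrightarrow> \<eta> p = h p"
    using h by (simp add: AE_lebesgue_on_iff)
  have a: "h (rot (pi / real n) *v p) = - h p" if "p \<in> annulus r0" for p
  proof -
    obtain \<theta> where p: "p = polar (norm p) \<theta>" using polar_Arg by blast
    have "rot (pi / real n) *v p = polar (norm p) (\<theta> + pi / real n)"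
      by (subst p) (simp add: polar_add)
    moreover have "norm p \<in> {r0<..<1}" using that by (auto simp: annulus_def)
    from anti[OF this, of "\<theta> + pi / real n"] have "h p = - h (polar (norm p) (\<theta> + pi / real n))"
      using p by simp
    ultimately show ?thesis by simp
  qed
  show ?thesis
    using 1 AE_rot[OF 1, of "pi / real n"]
    by eventually_elim (simp add: annulus_rot a)
qed

text \<open>The constant multiplies the factors of three estimates: 8 + 2 / r0^2 from the stress,
  \<alpha>^2 / 2 with \<alpha> = \<pi>/n from \<open>gradient_Poincare\<close>, and 2 / (1 + \<nu>)
  from coercivity.\<close>

lemma bending_lower_bound:
  fixes r0 \<nu> :: real
  assumes r0: "0 < r0" "r0 < 1" and \<nu>: "-1 < \<nu>" "\<nu> \<le> 1/2" and n: "n \<ge> 2"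
    and X: "(u, \<eta>) \<in> admissible_sym r0 n"
  shows "ennreal (flat_value r0 \<nu>) \<le> stretching_energy r0 \<nu> (u, \<eta>)
    + ennreal ((8 + 2 / r0\<^sup>2) * (pi\<^sup>2 / (1 + \<nu>)) / (real n)\<^sup>2) * bending_energy r0 \<nu> (u, \<eta>)"
proof -
  let ?\<Omega> = "annulus r0" let ?K = "8 + 2 / r0\<^sup>2" let ?\<alpha> = "pi / real n"
  let ?B = "bending_energy r0 \<nu> (u, \<eta>)"
  have adm: "(u, \<eta>) \<in> admissible r0" using X by (auto simp: admissible_sym_def)
  have \<eta>: "\<eta> \<in> Sobolev 2 ?\<Omega>" by (rule admissibleD(2)[OF adm])
  note w = Sobolev_2_weak_partial[OF open_annulus \<eta>]
  let ?G = "\<integral>\<^sup>+p\<in>?\<Omega>. ennreal (\<Sum>i\<in>UNIV. (weak_partial ?\<Omega> i \<eta> p)\<^sup>2) \<partial>lebesgue"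
  let ?H = "\<integral>\<^sup>+p\<in>?\<Omega>. ennreal (\<Sum>i\<in>UNIV. \<Sum>j\<in>UNIV. (weak_partial ?\<Omega> j (weak_partial ?\<Omega> i \<eta>) p)\<^sup>2) \<partial>lebesgue"
  have \<alpha>: "0 < ?\<alpha>" "?\<alpha> \<le> pi / 2" using n divide_left_mono[of 2 "real n" pi] by auto
  have P: "2 * ?G \<le> ennreal (?\<alpha>\<^sup>2) * ?H"
    by (rule gradient_Poincare[OF open_annulus annulus_rot annulus_subset_cball w(2) w(4) w(1) w(3) w(5) admissible_sym_rot[OF X] \<alpha>])
  have "?G = ennreal (1 / 2) * (2 * ?G)"
  proof -
    have "ennreal (1 / 2) * 2 = ennreal (1 / 2) * ennreal 2" by simp
    also have "\<dots> = 1" by (subst ennreal_mult[symmetric]) auto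
    finally show ?thesis by (simp add: mult.assoc[symmetric])
  qed
  also have "\<dots> \<le> ennreal (1 / 2) * (ennreal (?\<alpha>\<^sup>2) * (ennreal (2 / (1 + \<nu>)) * ?B))"
    by (intro mult_left_mono order_trans[OF P] bending_coercive[OF \<nu> \<eta>]) auto
  also have "\<dots> = ennreal (1 / 2 * (?\<alpha>\<^sup>2 * (2 / (1 + \<nu>)))) * ?B"
  proof -
    have "ennreal x * (ennreal y * (ennreal z * b)) = ennreal (x * (y * z)) * b" if "0 \<le> x" "0 \<le> y" "0 \<le> z" for x y z b
      using that by (simp add: ennreal_mult mult.assoc)
    moreover have "0 \<le> 2 / (1 + \<nu>)" "(0::real) \<le> 1 / 2" using \<nu> by auto
    ultimately show ?thesis by (meson zero_le_power2)
  qed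
  also have "1 / 2 * (?\<alpha>\<^sup>2 * (2 / (1 + \<nu>))) = pi\<^sup>2 / (1 + \<nu>) / (real n)\<^sup>2"
    by (simp add: power_divide)
  finally have G: "?G \<le> ennreal (pi\<^sup>2 / (1 + \<nu>) / (real n)\<^sup>2) * ?B" .
  have "ennreal (flat_value r0 \<nu>) \<le> stretching_energy r0 \<nu> (u, \<eta>) + ennreal ?K * ?G"
    by (rule stretching_lower_bound[OF r0 \<nu> adm])
  also have "\<dots> \<le> stretching_energy r0 \<nu> (u, \<eta>) + ennreal ?K * (ennreal (pi\<^sup>2 / (1 + \<nu>) / (real n)\<^sup>2) * ?B)"
    by (intro add_left_mono mult_left_mono G) auto
  also have "ennreal ?K * (ennreal (pi\<^sup>2 / (1 + \<nu>) / (real n)\<^sup>2) * ?B) = ennreal (?K * (pi\<^sup>2 / (1 + \<nu>)) / (real n)\<^sup>2) * ?B"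
  proof -
    have "ennreal x * (ennreal (y / z) * b) = ennreal (x * y / z) * b" if "0 \<le> x" "0 \<le> y / z" for x y z b
      using that by (simp only: times_divide_eq_right[symmetric] ennreal_mult mult.assoc)
    moreover have "0 \<le> ?K" "0 \<le> pi\<^sup>2 / (1 + \<nu>) / (real n)\<^sup>2" using \<nu> by auto
    ultimately show ?thesis by blast
  qed
  finally show ?thesis .
qed

lemma energy_lower_bound:
  fixes r0 \<nu> \<tau> :: real
  assumes r0: "0 < r0" "r0 < 1" and \<nu>: "-1 < \<nu>" "\<nu> \<le> 1/2" and n: "n \<ge> 2" and \<tau>: "\<tau> > 0"
    and X: "X \<in> admissible_sym r0 n" and pos: "flat_value r0 \<nu> > 0"
  shows "min (ennreal (flat_value r0 \<nu> / (2 * ((8 + 2 / r0\<^sup>2) * (pi\<^sup>2 / (1 + \<nu>)))) * real n * \<tau>\<^sup>2)) (flat_energy r0 \<nu> \<tau> / 2)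
    \<le> energy r0 \<nu> \<tau> X"
proof -
  obtain u \<eta> where Xe: "X = (u, \<eta>)" by (cases X)
  let ?F = "flat_value r0 \<nu>" let ?S = "stretching_energy r0 \<nu> X" let ?B = "bending_energy r0 \<nu> X"
  define K where "K = (8 + 2 / r0\<^sup>2) * (pi\<^sup>2 / (1 + \<nu>))"
  have K: "K > 0" unfolding K_def using \<nu> by (intro mult_pos_pos divide_pos_pos) (auto intro: add_pos_nonneg)
  have lb: "ennreal ?F \<le> ?S + ennreal (K / (real n)\<^sup>2) * ?B"
    unfolding K_def using bending_lower_bound[OF r0 \<nu> n] X by (simp add: Xe)
  show ?thesis
  proof (cases "flat_energy r0 \<nu> \<tau> / 2 \<le> ?S")
    case True
    then have "flat_energy r0 \<nu> \<tau> / 2 \<le> energy r0 \<nu> \<tau> X"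
      unfolding energy_def by (rule order_trans) simp
    then show ?thesis by (rule min.coboundedI2)
  next
    case False
    then have "?S < flat_energy r0 \<nu> \<tau> / 2" by simp
    \<comment> \<open>The infimum is traded for the explicit value, which is the quantity that
      \<open>lb\<close> controls.\<close>
    also have "\<dots> \<le> ennreal ?F / 2" by (intro divide_right_mono_ennreal flat_energy_le[OF r0 \<nu>])
    also have "\<dots> = ennreal (?F / 2)" using pos by (simp add: ennreal_divide_numeral)
    finally have S: "?S < ennreal (?F / 2)" .
    have "ennreal (?F / (2 * K) * real n * \<tau>\<^sup>2) \<le> ennreal (\<tau>\<^sup>2) * ?B"
    proof (cases "?B = \<infinity>")
      case True
      then show ?thesis using \<tau> by (simp add: ennreal_mult_top)
    next
      case False
      then obtain b where b: "b \<ge> 0" "?B = ennreal b" by (cases ?B) auto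
      obtain s where s: "s \<ge> 0" "?S = ennreal s" using S by (cases ?S) auto
      have sF: "s < ?F / 2" using S s pos by (simp add: ennreal_less_iff)
      have "ennreal ?F \<le> ennreal (s + K / (real n)\<^sup>2 * b)"
        using lb s b K by (simp add: ennreal_mult[symmetric])
      then have "?F \<le> s + K / (real n)\<^sup>2 * b"
        using s b K by (subst (asm) ennreal_le_iff) auto
      with sF have "?F / 2 \<le> K / (real n)\<^sup>2 * b" by linarith
      then have "?F / (2 * K) * (real n)\<^sup>2 \<le> b"
        using K n by (simp add: field_simps)
      moreover have "?F / (2 * K) * real n \<le> ?F / (2 * K) * (real n)\<^sup>2"
        using pos K n by (intro mult_left_mono) (auto simp: power2_eq_square)
      ultimately have "?F / (2 * K) * real n * \<tau>\<^sup>2 \<le> b * \<tau>\<^sup>2"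
        by (intro mult_right_mono) auto
      then show ?thesis using b by (simp add: ennreal_mult[symmetric] mult.commute ennreal_leI)
    qed
    also have "\<dots> \<le> energy r0 \<nu> \<tau> X" by (simp add: energy_def)
    finally show ?thesis unfolding K_def by (rule min.coboundedI1)
  qed
qed

lemma admissible_flat_subset_sym: "admissible_flat r0 \<subseteq> admissible_sym r0 n"
  unfolding admissible_flat_def admissible_sym_def by (auto intro!: exI[of _ "\<lambda>p. 0"])

section \<open>The ruffled deformation\<close>

text \<open>With y |y| in place of y^2 the function is odd in y: the reflection at the edge \<theta>
  = 0 is built in, and one formula serves the two sectors on either side of that edge.\<close>

definition saddle :: "real \<Rightarrow> real^2 \<Rightarrow> real" where
  "saddle k p = p $ 1 * p $ 2 - k * (p $ 2 * \<bar>p $ 2\<bar>)"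

definition parity_sign :: "int \<Rightarrow> real" where
  "parity_sign j = (if even j then 1 else - 1)"

text \<open>On the base sector the value is sin \<theta> sin (\<alpha> - \<theta>) / sin \<alpha>,
  which is symmetric about \<alpha> / 2. Continuing it by rotations with alternating sign, as done
  here, is therefore the same as odd reflection in the rays.\<close>

definition profile :: "real \<Rightarrow> real \<Rightarrow> real" where
  "profile \<alpha> \<theta> = parity_sign \<lfloor>\<theta> / \<alpha>\<rfloor> * saddle (cot \<alpha>) (polar 1 (\<theta> - of_int \<lfloor>\<theta> / \<alpha>\<rfloor> * \<alpha>))"

definition ruffle :: "real \<Rightarrow> real^2 \<Rightarrow> real" where
  "ruffle \<alpha> p = (norm p)\<^sup>2 * profile \<alpha> (Arg (Complex (p $ 1) (p $ 2)))"

lemma parity_sign_add: "parity_sign (i + j) = parity_sign i * parity_sign j"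
  by (simp add: parity_sign_def)

lemma parity_sign_abs [simp]: "\<bar>parity_sign j\<bar> = 1"
  by (simp add: parity_sign_def)

lemma profile_shift:
  assumes "\<alpha> > 0"
  shows "profile \<alpha> (\<theta> + of_int m * \<alpha>) = parity_sign m * profile \<alpha> \<theta>"
proof -
  have "(\<theta> + of_int m * \<alpha>) / \<alpha> = \<theta> / \<alpha> + of_int m"
    using assms by (simp add: field_simps)
  then have "\<lfloor>(\<theta> + of_int m * \<alpha>) / \<alpha>\<rfloor> = \<lfloor>\<theta> / \<alpha>\<rfloor> + m" by simp
  then show ?thesis
    unfolding profile_def by (simp add: parity_sign_add algebra_simps)
qed

text \<open>The two expressions on neighbouring sectors agree: this is the point where \<open>k = cot \<alpha>\<close> is used.\<close>

lemma profile_near_0: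
  assumes \<alpha>: "0 < \<alpha>" "\<alpha> \<le> pi / 2" and t: "\<bar>t\<bar> < \<alpha>"
  shows "profile \<alpha> t = saddle (cot \<alpha>) (polar 1 t)"
proof (cases "t \<ge> 0")
  case True
  then have "\<lfloor>t / \<alpha>\<rfloor> = 0" using assms by (intro floor_unique) auto
  then show ?thesis by (simp add: profile_def parity_sign_def)
next
  case False
  then have "\<lfloor>t / \<alpha>\<rfloor> = -1" using assms by (intro floor_unique) (auto simp: field_simps)
  then have "profile \<alpha> t = - saddle (cot \<alpha>) (polar 1 (t + \<alpha>))"
    by (simp add: profile_def parity_sign_def)
  also have "\<dots> = saddle (cot \<alpha>) (polar 1 t)"
  proof -
    have s: "sin \<alpha> > 0" using \<alpha> by (intro sin_gt_zero) auto
    have s1: "sin (t + \<alpha>) \<ge> 0" using \<alpha> t False by (intro sin_ge_zero) auto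
    have "0 \<le> sin (- t)" using \<alpha> t False by (intro sin_ge_zero) auto
    then have s2: "sin t \<le> 0" by simp
    define x y c d where "x = cos t" and "y = sin t" and "c = cos \<alpha>" and "d = sin \<alpha>"
    have cd: "d \<noteq> 0" "d * d = 1 - c * c" using s sin_cos_squared_add[of \<alpha>] by (auto simp: c_def d_def power2_eq_square)
    have "- ((c * x - d * y) * (y * c + x * d) - c / d * ((y * c + x * d) * (y * c + x * d))) = x * y + c / d * (y * y)"
    proof -
      \<comment> \<open>With X, Y the coordinates rotated by \<alpha>, the left side is Y (c Y - d
        X), and c Y - d X is the old coordinate y. The slope c / d = cot \<alpha> is what produces
        this factor.\<close>
      have "d * (- ((c * x - d * y) * (y * c + x * d) - c / d * ((y * c + x * d) * (y * c + x * d)))) = d * (x * y + c / d * (y * y))"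
      proof -
        have "d * (- ((c * x - d * y) * (y * c + x * d) - c / d * ((y * c + x * d) * (y * c + x * d))))
          = (y * c + x * d) * (c * (y * c + x * d) - d * (c * x - d * y))"
          using cd(1) by (simp add: field_simps)
        also have "c * (y * c + x * d) - d * (c * x - d * y) = y * (c * c + d * d)" by (simp add: algebra_simps)
        also have "\<dots> = y" by (simp add: cd(2))
        also have "(y * c + x * d) * y = d * (x * y + c / d * (y * y))" using cd(1) by (simp add: field_simps)
        finally show ?thesis .
      qed
      then show ?thesis using cd(1) by simp
    qed
    then show ?thesis
      using s1 s2 unfolding saddle_def polar_nth
      by (simp add: cot_def cos_add sin_add x_def y_def c_def d_def mult_ac)
  qed
  finally show ?thesis .
qed

lemma polar_saddle: "r \<ge> 0 \<Longrightarrow> saddle k (polar r t) = r\<^sup>2 * saddle k (polar 1 t)"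
  by (simp add: saddle_def abs_mult power2_eq_square algebra_simps)

lemma norm_polar [simp]: "norm (polar r t) = \<bar>r\<bar>"
proof -
  have "(r * cos t)\<^sup>2 + (r * sin t)\<^sup>2 = r\<^sup>2 * ((cos t)\<^sup>2 + (sin t)\<^sup>2)"
    unfolding power_mult_distrib distrib_left ..
  then show ?thesis by (simp add: norm_vec2)
qed

text \<open>\<open>Arg\<close> differs from \<theta> by a multiple of 2 \<pi> = 2 n \<alpha>. This
  is an even number of sectors, so the sign is unaffected and the choice of branch is
  immaterial.\<close>

lemma ruffle_polar:
  assumes \<alpha>: "\<alpha> = pi / real n" "n > 0" and r: "r > 0"
  shows "ruffle \<alpha> (polar r \<theta>) = r\<^sup>2 * profile \<alpha> \<theta>"
proof -
  define \<phi> where "\<phi> = Arg (Complex (polar r \<theta> $ 1) (polar r \<theta> $ 2))"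
  have "polar r \<theta> = polar (norm (polar r \<theta>)) \<phi>" unfolding \<phi>_def by (rule polar_Arg)
  also have "norm (polar r \<theta>) = r" using r by simp
  finally have "polar r \<theta> = polar r \<phi>" .
  then have "polar r \<theta> $ 1 = polar r \<phi> $ 1" "polar r \<theta> $ 2 = polar r \<phi> $ 2" by (simp_all only:)
  then have "sin \<phi> = sin \<theta> \<and> cos \<phi> = cos \<theta>" using r unfolding polar_nth by auto
  then obtain m :: int where "\<phi> = \<theta> + 2 * pi * m" using sin_cos_eq_iff by blast
  also have "2 * pi * m = of_int (2 * int n * m) * \<alpha>" using \<alpha> by simp
  finally have "profile \<alpha> \<phi> = parity_sign (2 * int n * m) * profile \<alpha> \<theta>"
    using profile_shift[of \<alpha> \<theta> "2 * int n * m"] \<alpha> by simp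
  then show ?thesis using r by (simp add: ruffle_def parity_sign_def \<phi>_def)
qed

text \<open>The hypothesis says that r sin (\<alpha> - |\<theta>|) is positive. As an open condition
  in Cartesian coordinates it holds in neighbourhoods, although \<open>Arg\<close> jumps.\<close>

lemma cone_polar:
  assumes \<alpha>: "0 < \<alpha>" "\<alpha> \<le> pi / 2" and p: "p $ 1 * sin \<alpha> - \<bar>p $ 2\<bar> * cos \<alpha> > 0"
  obtains r t where "r > 0" "\<bar>t\<bar> < \<alpha>" "p = polar r t"
proof -
  let ?t = "Arg (Complex (p $ 1) (p $ 2))" let ?r = "norm p"
  have e: "p = polar ?r ?t" by (rule polar_Arg)
  have r: "?r > 0" using p by (cases "p = 0") auto
  have t: "- pi < ?t" "?t \<le> pi" by (simp_all add: mpi_less_Arg Arg_le_pi)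
  have abs_sin: "\<bar>sin ?t\<bar> = sin \<bar>?t\<bar>"
  proof (cases "?t \<ge> 0")
    case True
    then show ?thesis using t sin_ge_zero[of ?t] by simp
  next
    case False
    then show ?thesis using t sin_ge_zero[of "- ?t"] by simp
  qed
  have "p $ 1 * sin \<alpha> - \<bar>p $ 2\<bar> * cos \<alpha> = ?r * sin (\<alpha> - \<bar>?t\<bar>)"
    by (subst (1 2) e) (simp add: abs_mult abs_sin sin_diff algebra_simps)
  with p r have "sin (\<alpha> - \<bar>?t\<bar>) > 0" by (simp add: zero_less_mult_iff)
  then have "\<bar>?t\<bar> < \<alpha>"
    using sin_ge_zero[of "- (\<alpha> - \<bar>?t\<bar>)"] sin_minus[of "\<alpha> - \<bar>?t\<bar>"] \<alpha> t by linarith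
  with r e that show ?thesis by blast
qed

text \<open>\<open>saddle\<close> describes the function on a double sector |t| < \<alpha> around an
  edge. Double sectors around neighbouring edges overlap, so every nonzero point, also one on an
  edge, is interior to some double sector.\<close>

lemma ruffle_local:
  assumes \<alpha>: "\<alpha> = pi / real n" "n \<ge> 2" and p0: "p0 \<noteq> 0"
  obtains j :: int where "eventually (\<lambda>p. ruffle \<alpha> p = parity_sign j * saddle (cot \<alpha>) (rot (- (of_int j * \<alpha>)) *v p)) (nhds p0)"
proof -
  have a: "0 < \<alpha>" "\<alpha> \<le> pi / 2" using \<alpha> divide_left_mono[of 2 "real n" pi] by auto
  let ?\<theta> = "Arg (Complex (p0 $ 1) (p0 $ 2))"
  \<comment> \<open>Rounding to the nearest multiple of \<alpha> leaves |t0| \<le> \<alpha> / 2,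
    well inside the double sector.\<close>
  define j where "j = \<lfloor>?\<theta> / \<alpha> + 1 / 2\<rfloor>"
  define t0 where "t0 = ?\<theta> - of_int j * \<alpha>"
  let ?R = "rot (- (of_int j * \<alpha>))"
  have "of_int j \<le> ?\<theta> / \<alpha> + 1 / 2" "?\<theta> / \<alpha> + 1 / 2 < of_int j + 1"
    unfolding j_def by linarith+
  then have t0: "\<bar>t0\<bar> < \<alpha>" using a unfolding t0_def by (auto simp: field_simps abs_less_iff)
  have R0: "?R *v p0 = polar (norm p0) t0"
    using polar_Arg[of p0] polar_add[of "norm p0" ?\<theta> "- (of_int j * \<alpha>)"] by (simp add: t0_def)
  let ?c = "\<lambda>p. (?R *v p) $ 1 * sin \<alpha> - \<bar>(?R *v p) $ 2\<bar> * cos \<alpha>"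
  have c0: "?c p0 > 0"
  proof -
    have abs_sin: "\<bar>sin t0\<bar> = sin \<bar>t0\<bar>"
      using t0 a sin_ge_zero[of t0] sin_ge_zero[of "- t0"] by (cases "t0 \<ge> 0") auto
    have "?c p0 = norm p0 * sin (\<alpha> - \<bar>t0\<bar>)"
      unfolding R0 polar_nth by (simp add: abs_mult abs_sin sin_diff algebra_simps)
    moreover have "sin (\<alpha> - \<bar>t0\<bar>) > 0" using t0 a by (intro sin_gt_zero) auto
    ultimately show ?thesis using p0 by simp
  qed
  have "isCont ?c p0"
    by (simp only: rot_component) (intro continuous_intros)
  then have "(?c \<longlongrightarrow> ?c p0) (nhds p0)"
    using tendsto_at_iff_tendsto_nhds[of ?c p0] unfolding isCont_def by blast
  from order_tendstoD(1)[OF this c0] have "eventually (\<lambda>p. ?c p > 0) (nhds p0)" .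
  then have "eventually (\<lambda>p. ruffle \<alpha> p = parity_sign j * saddle (cot \<alpha>) (?R *v p)) (nhds p0)"
  proof eventually_elim
    case (elim p)
    obtain r t where rt: "r > 0" "\<bar>t\<bar> < \<alpha>" "?R *v p = polar r t"
      using cone_polar[OF a elim] by blast
    have "p = rot (of_int j * \<alpha>) *v polar r t" unfolding rt(3)[symmetric] by (simp add: rot_add)
    then have "p = polar r (t + of_int j * \<alpha>)" by (simp only: polar_add)
    then have "ruffle \<alpha> p = r\<^sup>2 * profile \<alpha> (t + of_int j * \<alpha>)"
      using ruffle_polar[OF \<alpha>(1) _ rt(1)] \<alpha>(2) by simp
    also have "\<dots> = r\<^sup>2 * (parity_sign j * saddle (cot \<alpha>) (polar 1 t))"
      using profile_near_0[OF a rt(2)] profile_shift[OF a(1)] by simp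
    also have "\<dots> = parity_sign j * saddle (cot \<alpha>) (polar r t)"
      using rt(1) by (subst polar_saddle) auto
    finally show ?case by (simp add: rt(3))
  qed
  then show ?thesis by (rule that)
qed

lemma DERIV_mult_abs: "((\<lambda>t::real. t * \<bar>t\<bar>) has_real_derivative 2 * \<bar>t\<bar>) (at t)"
proof -
  consider "t > 0" | "t < 0" | "t = 0" by linarith
  then show ?thesis
  proof cases
    case 1
    have "((\<lambda>t. t * t) has_real_derivative 2 * \<bar>t\<bar>) (at t)"
      using 1 by (auto intro!: derivative_eq_intros)
    then show ?thesis
      by (rule DERIV_cong_ev[OF refl _ refl, THEN iffD1, rotated])
        (use 1 in \<open>auto simp: eventually_nhds_metric dist_real_def intro!: exI[of _ t]\<close>)
  next
    case 2
    have "((\<lambda>t. - (t * t)) has_real_derivative 2 * \<bar>t\<bar>) (at t)"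
      using 2 by (auto intro!: derivative_eq_intros)
    then show ?thesis
      by (rule DERIV_cong_ev[OF refl _ refl, THEN iffD1, rotated])
        (use 2 in \<open>auto simp: eventually_nhds_metric dist_real_def intro!: exI[of _ "-t"]\<close>)
  next
    case 3
    have "((\<lambda>h::real. \<bar>h\<bar>) \<longlongrightarrow> 0) (at 0)" by (rule tendsto_eq_intros refl | simp)+
    then have "((\<lambda>h::real. h * \<bar>h\<bar> / h) \<longlongrightarrow> 0) (at 0)"
      by (rule Lim_transform_eventually) (auto simp: eventually_at_filter)
    with 3 show ?thesis by (simp add: DERIV_def)
  qed
qed

lemma has_derivative_saddle:
  "(saddle k has_derivative (\<lambda>h. p $ 2 * h $ 1 + (p $ 1 - 2 * k * \<bar>p $ 2\<bar>) * h $ 2)) (at p)"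
proof -
  have 1: "((\<lambda>p. p $ 1 * p $ 2) has_derivative (\<lambda>h. p $ 1 * h $ 2 + h $ 1 * p $ 2)) (at p)"
    by (rule has_derivative_mult[OF has_derivative_component has_derivative_component])
  have 2: "((\<lambda>p::real^2. p $ 2 * \<bar>p $ 2\<bar>) has_derivative (\<lambda>h. 2 * \<bar>p $ 2\<bar> * h $ 2)) (at p)"
    using has_derivative_compose[OF has_derivative_component DERIV_mult_abs[unfolded has_field_derivative_def]] .
  show ?thesis
    unfolding saddle_def[abs_def]
    by (rule has_derivative_eq_rhs[OF has_derivative_diff[OF 1 has_derivative_mult_right[OF 2]]])
      (simp add: fun_eq_iff algebra_simps)
qed

text \<open>The derivative of y |y| is 2 |y|, so near every nonzero point, including those on the
  rays, the gradient is continuous and piecewise linear. Its Lipschitz property can be read off from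
  the formula.\<close>

lemma ruffle_local_gradient:
  fixes n :: nat and p0 :: "real^2"
  assumes \<alpha>: "\<alpha> = pi / real n" "n \<ge> 2" and p0: "p0 \<noteq> 0"
  obtains j :: int where
    "eventually (\<lambda>p. ruffle \<alpha> p = parity_sign j * saddle (cot \<alpha>) (rot (- (of_int j * \<alpha>)) *v p)) (nhds p0)"
    "eventually (\<lambda>p. ruffle \<alpha> differentiable (at p)) (nhds p0)"
    "\<And>i. eventually (\<lambda>p. partial i (ruffle \<alpha>) p = parity_sign j * (rot (- (of_int j * \<alpha>)) $ 1 $ i * (rot (- (of_int j * \<alpha>)) *v p) $ 2
       + rot (- (of_int j * \<alpha>)) $ 2 $ i * ((rot (- (of_int j * \<alpha>)) *v p) $ 1 - 2 * cot \<alpha> * \<bar>(rot (- (of_int j * \<alpha>)) *v p) $ 2\<bar>))) (nhds p0)"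
proof -
  obtain j :: int where j: "eventually (\<lambda>p. ruffle \<alpha> p = parity_sign j * saddle (cot \<alpha>) (rot (- (of_int j * \<alpha>)) *v p)) (nhds p0)"
    using ruffle_local[OF assms] by blast
  let ?R = "rot (- (of_int j * \<alpha>))"
  let ?g = "\<lambda>p. parity_sign j * saddle (cot \<alpha>) (?R *v p)"
  have sd: "saddle k differentiable (at q)" for k q
    using has_derivative_saddle by (auto simp: differentiable_def)
  have ps: "partial 1 (saddle k) q = q $ 2" "partial 2 (saddle k) q = q $ 1 - 2 * k * \<bar>q $ 2\<bar>" for k q
    by (simp_all add: has_derivative_imp_partial[OF has_derivative_saddle] axis_def)
  have gd: "?g differentiable (at p)" for p
    using partial_compose_linear(2)[OF sd] by (intro differentiable_mult) auto
  have gp: "partial i ?g p = parity_sign j * (?R $ 1 $ i * (?R *v p) $ 2 + ?R $ 2 $ i * ((?R *v p) $ 1 - 2 * cot \<alpha> * \<bar>(?R *v p) $ 2\<bar>))" for i p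
    using partial_mult[of "\<lambda>p. parity_sign j" p "\<lambda>p. saddle (cot \<alpha>) (?R *v p)" i] partial_compose_linear[where f = "saddle (cot \<alpha>)" and A = ?R and x = p, OF sd]
    by (simp add: sum_2 ps)
  show ?thesis
  proof (rule that[OF j])
    have "eventually (\<lambda>p. eventually (\<lambda>q. ruffle \<alpha> q = ?g q) (nhds p)) (nhds p0)"
      using j by (simp add: eventually_eventually)
    then show "eventually (\<lambda>p. ruffle \<alpha> differentiable (at p)) (nhds p0)"
      by eventually_elim (rule differentiable_eventually[OF _ gd])
    show "eventually (\<lambda>p. partial i (ruffle \<alpha>) p = parity_sign j * (?R $ 1 $ i * (?R *v p) $ 2
       + ?R $ 2 $ i * ((?R *v p) $ 1 - 2 * cot \<alpha> * \<bar>(?R *v p) $ 2\<bar>))) (nhds p0)" for i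
      using j gp by (rule partial_eventually)
  qed
qed

lemma saddle_rot:
  "saddle k (rot t *v p) = (cos t * p $ 1 - sin t * p $ 2) * (sin t * p $ 1 + cos t * p $ 2)
    - k * ((sin t * p $ 1 + cos t * p $ 2) * \<bar>sin t * p $ 1 + cos t * p $ 2\<bar>)"
  by (simp add: saddle_def)

lemma negligible_rot_line: "negligible {p. (rot t *v p) $ 2 = 0}"
proof -
  let ?a = "sin t *\<^sub>R axis 1 1 + cos t *\<^sub>R axis 2 1 :: real^2"
  have "?a \<noteq> 0"
  proof
    assume "?a = 0"
    then have "?a $ 1 = 0" "?a $ 2 = 0" by simp_all
    then have "sin t = 0" "cos t = 0" by (simp_all add: axis_def)
    then show False using sin_cos_squared_add[of t] by simp
  qed
  moreover have "{p. (rot t *v p) $ 2 = 0} = {p. ?a \<bullet> p = 0}"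
    by (auto simp: inner_vec_def sum_2 axis_def)
  ultimately show ?thesis using negligible_hyperplane[of ?a 0] by simp
qed

definition quad_coef :: "real \<Rightarrow> real \<Rightarrow> real \<Rightarrow> 2 \<Rightarrow> 2 \<Rightarrow> real" where
  "quad_coef a b d i j = (if i = j then (if i = 1 then a else d) else b)"

lemma has_derivative_quad:
  "((\<lambda>p::real^2. (a * (p $ 1)\<^sup>2 + 2 * b * (p $ 1 * p $ 2) + d * (p $ 2)\<^sup>2) / 2) has_derivative
    (\<lambda>h. (a * p $ 1 + b * p $ 2) * h $ 1 + (b * p $ 1 + d * p $ 2) * h $ 2)) (at p)"
  by (auto intro!: derivative_eq_intros simp: fun_eq_iff algebra_simps)

section \<open>Regularity and energy of the ruffled deformation\<close>

context
  fixes n :: nat and \<alpha> k :: real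
  assumes n: "n \<ge> 2" and \<alpha>: "\<alpha> = pi / real n" and k: "k = cot \<alpha>"
begin

lemma angle_bounds: "0 < \<alpha>" "\<alpha> \<le> pi / 2"
  using \<alpha> n divide_left_mono[of 2 "real n" pi] by auto

text \<open>From tan \<alpha> \<ge> \<alpha> follows cot \<alpha> \<le> 1 / \<alpha>. The right
  angle, which is n = 2, is treated apart: there the tangent is singular and the cotangent is
  0.\<close>

lemma slope_bounds: "0 \<le> k" "k \<le> real n / pi"
proof -
  have s: "sin \<alpha> > 0" using angle_bounds by (intro sin_gt_zero) auto
  have c: "cos \<alpha> \<ge> 0" using angle_bounds by (intro cos_ge_zero) auto
  show "0 \<le> k" using s c by (simp add: k cot_def)
  show "k \<le> real n / pi"
  proof (cases "\<alpha> < pi / 2")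
    case True
    then have "\<alpha> \<le> tan \<alpha>" using abs_tan_ge[of \<alpha>] angle_bounds tan_gt_zero[of \<alpha>] by simp
    moreover have "cos \<alpha> > 0" using True angle_bounds by (intro cos_gt_zero) auto
    ultimately have "k \<le> 1 / \<alpha>" using s angle_bounds by (simp add: k cot_def tan_def field_simps)
    then show ?thesis by (simp add: \<alpha>)
  next
    case False
    then have "\<alpha> = pi / 2" using angle_bounds by simp
    then have "cos \<alpha> = cos (pi / 2)" by (rule arg_cong)
    then have "cos \<alpha> = 0" by (simp only: cos_pi_half)
    then show ?thesis by (simp add: k cot_def)
  qed
qed

private abbreviation (input) "f \<equiv> ruffle \<alpha>"
private abbreviation (input) "g \<equiv> \<lambda>i. partial i f"
private abbreviation (input) "u \<equiv> \<lambda>i p. - (f p * g i p) / 3"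

lemmas local_gradient = ruffle_local_gradient[OF \<alpha> n, folded k]

lemma ruffle_loc_lip:
  assumes "p \<noteq> 0"
  shows "loc_lip f p" "loc_lip (g i) p" "loc_lip (u i) p" "f differentiable (at p)"
proof -
  obtain j :: int where j:
    "eventually (\<lambda>p. f p = parity_sign j * saddle k (rot (- (of_int j * \<alpha>)) *v p)) (nhds p)"
    "eventually (\<lambda>p. f differentiable (at p)) (nhds p)"
    "\<And>i. eventually (\<lambda>p. g i p = parity_sign j * (rot (- (of_int j * \<alpha>)) $ 1 $ i * (rot (- (of_int j * \<alpha>)) *v p) $ 2
       + rot (- (of_int j * \<alpha>)) $ 2 $ i * ((rot (- (of_int j * \<alpha>)) *v p) $ 1 - 2 * k * \<bar>(rot (- (of_int j * \<alpha>)) *v p) $ 2\<bar>))) (nhds p)"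
    using local_gradient[OF assms] by blast
  note ll = loc_lip_mult loc_lip_diff loc_lip_add loc_lip_const loc_lip_component loc_lip_abs
  have "loc_lip (\<lambda>p. parity_sign j * saddle k (rot (- (of_int j * \<alpha>)) *v p)) p"
    unfolding saddle_rot by (intro ll)
  then show f: "loc_lip f p" by (rule loc_lip_cong[OF _ j(1)])
  have "loc_lip (\<lambda>p. parity_sign j * (rot (- (of_int j * \<alpha>)) $ 1 $ i * (rot (- (of_int j * \<alpha>)) *v p) $ 2
       + rot (- (of_int j * \<alpha>)) $ 2 $ i * ((rot (- (of_int j * \<alpha>)) *v p) $ 1 - 2 * k * \<bar>(rot (- (of_int j * \<alpha>)) *v p) $ 2\<bar>))) p"
    unfolding rot_component by (intro ll)
  then show g: "loc_lip (g i) p" by (rule loc_lip_cong[OF _ j(3)])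
  have "loc_lip (\<lambda>p. (- 1 / 3) * (f p * g i p)) p" by (intro ll f g)
  then show "loc_lip (u i) p" by simp
  show "f differentiable (at p)" using j(2) by (rule eventually_nhds_x_imp_x)
qed

lemma ruffle_bounds:
  assumes "p \<noteq> 0" "norm p \<le> 1"
  shows "\<bar>f p\<bar> \<le> 1 + k" "\<bar>g i p\<bar> \<le> 2 + 2 * k"
proof -
  obtain j :: int where j:
    "eventually (\<lambda>p. f p = parity_sign j * saddle k (rot (- (of_int j * \<alpha>)) *v p)) (nhds p)"
    "\<And>i. eventually (\<lambda>p. g i p = parity_sign j * (rot (- (of_int j * \<alpha>)) $ 1 $ i * (rot (- (of_int j * \<alpha>)) *v p) $ 2
       + rot (- (of_int j * \<alpha>)) $ 2 $ i * ((rot (- (of_int j * \<alpha>)) *v p) $ 1 - 2 * k * \<bar>(rot (- (of_int j * \<alpha>)) *v p) $ 2\<bar>))) (nhds p)"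
    using local_gradient[OF assms(1)] by blast
  let ?R = "rot (- (of_int j * \<alpha>))"
  define q where "q = ?R *v p"
  have q: "\<bar>q $ l\<bar> \<le> 1" for l
    using component_le_norm_cart[of q l] assms(2) by (simp add: q_def)
  have R: "\<bar>?R $ l $ i\<bar> \<le> 1" for l
    using exhaust_2[of l] exhaust_2[of i] by auto
  have k0: "0 \<le> k" by (rule slope_bounds)
  have "\<bar>saddle k q\<bar> \<le> \<bar>q $ 1 * q $ 2\<bar> + \<bar>k * (q $ 2 * \<bar>q $ 2\<bar>)\<bar>"
    unfolding saddle_def by (rule abs_triangle_ineq4)
  also have "\<dots> \<le> 1 * 1 + k * (1 * 1)"
    unfolding abs_mult abs_abs using q k0 by (intro add_mono mult_mono) auto
  finally show "\<bar>f p\<bar> \<le> 1 + k"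
    using eventually_nhds_x_imp_x[OF j(1)] by (simp add: abs_mult q_def)
  have "\<bar>q $ 1 - 2 * k * \<bar>q $ 2\<bar>\<bar> \<le> \<bar>q $ 1\<bar> + \<bar>2 * k * \<bar>q $ 2\<bar>\<bar>" by (rule abs_triangle_ineq4)
  also have "\<dots> \<le> 1 + 2 * k * 1"
    using q[of 1] mult_left_mono[OF q[of 2], of "2 * k"] k0 by (simp add: abs_mult)
  finally have q2: "\<bar>q $ 1 - 2 * k * \<bar>q $ 2\<bar>\<bar> \<le> 1 + 2 * k" by simp
  have "\<bar>?R $ 1 $ i * q $ 2 + ?R $ 2 $ i * (q $ 1 - 2 * k * \<bar>q $ 2\<bar>)\<bar> \<le> \<bar>?R $ 1 $ i * q $ 2\<bar> + \<bar>?R $ 2 $ i * (q $ 1 - 2 * k * \<bar>q $ 2\<bar>)\<bar>"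
    by (rule abs_triangle_ineq)
  also have "\<dots> \<le> 1 * 1 + 1 * (1 + 2 * k)"
    unfolding abs_mult[of "?R $ _ $ _"] using q q2 R k0 by (intro add_mono mult_mono) auto
  finally show "\<bar>g i p\<bar> \<le> 2 + 2 * k"
    using eventually_nhds_x_imp_x[OF j(2)[of i]] unfolding q_def by (simp add: abs_mult)
qed

text \<open>Off the lines where the rotated second coordinate y vanishes, its sign \<sigma> is
  locally constant, and |y| = \<sigma> y turns the saddle into a quadratic form. Determinant and
  squared trace of the Hessian are unaffected by the rotation and by the signs. The lines are
  indexed by all integers, which still excludes only a null set.\<close>

lemma ruffle_quadratic:
  "AE p0 in lebesgue. p0 \<noteq> 0 \<longrightarrow> (\<exists>a b d. a * d - b\<^sup>2 = -1 \<and> (a + d)\<^sup>2 = 4 * k\<^sup>2 \<and>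
     eventually (\<lambda>p. f p = (a * (p $ 1)\<^sup>2 + 2 * b * (p $ 1 * p $ 2) + d * (p $ 2)\<^sup>2) / 2) (nhds p0))"
proof -
  have "AE p in lebesgue. (rot (- (of_int j * \<alpha>)) *v p) $ 2 \<noteq> 0" for j :: int
    using AE_not_in[OF negligible_rot_line[of "- (of_int j * \<alpha>)", unfolded negligible_iff_null_sets]]
    by eventually_elim auto
  then have "AE p in lebesgue. \<forall>j::int. (rot (- (of_int j * \<alpha>)) *v p) $ 2 \<noteq> 0"
    unfolding AE_all_countable by blast
  then show ?thesis
  proof eventually_elim
    case (elim p0)
    show ?case
    proof
      assume "p0 \<noteq> 0"
      then obtain j :: int where j:
        "eventually (\<lambda>p. f p = parity_sign j * saddle k (rot (- (of_int j * \<alpha>)) *v p)) (nhds p0)"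
        using local_gradient by blast
      define c s where "c = cos (of_int j * \<alpha>)" and "s = sin (of_int j * \<alpha>)"
      define y where "y = (\<lambda>p::real^2. - s * p $ 1 + c * p $ 2)"
      define \<sigma> where "\<sigma> = sgn (y p0)"
      define e where "e = parity_sign j"
      have y0: "y p0 \<noteq> 0" using elim[rule_format, of j] by (simp add: y_def c_def s_def)
      have cs: "c\<^sup>2 + s\<^sup>2 = 1" by (simp add: c_def s_def)
      have e2: "e * e = 1" by (simp add: e_def parity_sign_def)
      have \<sigma>2: "\<sigma> * \<sigma> = 1" using y0 by (simp add: \<sigma>_def sgn_if)
      have "isCont (\<lambda>p. y p * \<sigma>) p0" unfolding y_def by (intro continuous_intros)
      then have "((\<lambda>p. y p * \<sigma>) \<longlongrightarrow> y p0 * \<sigma>) (nhds p0)"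
        using tendsto_at_iff_tendsto_nhds[of "\<lambda>p. y p * \<sigma>" p0] unfolding isCont_def by blast
      moreover have "y p0 * \<sigma> > 0" using y0 by (simp add: \<sigma>_def sgn_if mult_neg_neg)
      ultimately have "eventually (\<lambda>p. y p * \<sigma> > 0) (nhds p0)" by (rule order_tendstoD(1))
      then have abs_y: "eventually (\<lambda>p. \<bar>y p\<bar> = \<sigma> * y p) (nhds p0)"
      proof eventually_elim
        case (elim p)
        have "\<sigma> = 1 \<or> \<sigma> = -1" using y0 by (simp add: \<sigma>_def sgn_if)
        then show ?case using elim by auto
      qed
      define \<kappa> where "\<kappa> = k * \<sigma>"
      have \<kappa>2: "\<kappa>\<^sup>2 = k\<^sup>2" unfolding \<kappa>_def power_mult_distrib using \<sigma>2 by (simp add: power2_eq_square)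
      \<comment> \<open>These come from expanding 2 e (X Y - \<kappa> Y^2) in p, where X = c p1 + s
        p2 and Y = - s p1 + c p2.\<close>
      define a b d where "a = 2 * e * (- (c * s) - \<kappa> * s\<^sup>2)" and "b = e * (c\<^sup>2 - s\<^sup>2 + 2 * \<kappa> * (c * s))"
        and "d = 2 * e * (c * s - \<kappa> * c\<^sup>2)"
      have "a * d - b\<^sup>2 = (e * e) * (- (c\<^sup>2 + s\<^sup>2)\<^sup>2)"
        unfolding a_def b_def d_def by (simp add: power2_eq_square algebra_simps)
      then have 1: "a * d - b\<^sup>2 = -1" by (simp add: e2 cs)
      have "a + d = - 2 * e * \<kappa> * (c\<^sup>2 + s\<^sup>2)"
        unfolding a_def d_def by (simp add: algebra_simps)
      then have "(a + d)\<^sup>2 = 4 * (e * e) * \<kappa>\<^sup>2" unfolding cs by (simp add: power2_eq_square)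
      then have 2: "(a + d)\<^sup>2 = 4 * k\<^sup>2" by (simp add: e2 \<kappa>2)
      have "eventually (\<lambda>p. f p = (a * (p $ 1)\<^sup>2 + 2 * b * (p $ 1 * p $ 2) + d * (p $ 2)\<^sup>2) / 2) (nhds p0)"
        using j abs_y
      proof eventually_elim
        case (elim p)
        have "f p = e * ((c * p $ 1 + s * p $ 2) * y p - k * (y p * \<bar>y p\<bar>))"
          unfolding elim(1) saddle_rot by (simp add: e_def c_def s_def y_def)
        also have "\<dots> = e * ((c * p $ 1 + s * p $ 2) * y p - \<kappa> * (y p * y p))"
          unfolding elim(2) by (simp add: \<kappa>_def)
        also have "\<dots> = (a * (p $ 1)\<^sup>2 + 2 * b * (p $ 1 * p $ 2) + d * (p $ 2)\<^sup>2) / 2"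
          unfolding y_def a_def b_def d_def by (simp add: power2_eq_square field_simps)
        finally show ?case .
      qed
      with 1 2 show "\<exists>a b d. a * d - b\<^sup>2 = -1 \<and> (a + d)\<^sup>2 = 4 * k\<^sup>2 \<and>
        eventually (\<lambda>p. f p = (a * (p $ 1)\<^sup>2 + 2 * b * (p $ 1 * p $ 2) + d * (p $ 2)\<^sup>2) / 2) (nhds p0)" by blast
    qed
  qed
qed

lemma quadratic_derivatives:
  assumes ev: "eventually (\<lambda>p. f p = (a * (p $ 1)\<^sup>2 + 2 * b * (p $ 1 * p $ 2) + d * (p $ 2)\<^sup>2) / 2) (nhds p0)"
  shows "g i p0 = quad_coef a b d i 1 * p0 $ 1 + quad_coef a b d i 2 * p0 $ 2"
    and "g i differentiable (at p0)" "partial j (g i) p0 = quad_coef a b d i j"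
    and "u i differentiable (at p0)" "partial j (u i) p0 = - (g j p0 * g i p0 + f p0 * quad_coef a b d i j) / 3"
proof -
  let ?m = "quad_coef a b d"
  have gi: "eventually (\<lambda>p. g i p = ?m i 1 * p $ 1 + ?m i 2 * p $ 2) (nhds p0)"
  proof (rule partial_eventually[OF ev])
    show "partial i (\<lambda>p. (a * (p $ 1)\<^sup>2 + 2 * b * (p $ 1 * p $ 2) + d * (p $ 2)\<^sup>2) / 2) p = ?m i 1 * p $ 1 + ?m i 2 * p $ 2" for p
      using exhaust_2[of i] by (auto simp: has_derivative_imp_partial[OF has_derivative_quad] axis_def quad_coef_def)
  qed
  have lin: "((\<lambda>p::real^2. ?m i 1 * p $ 1 + ?m i 2 * p $ 2) has_derivative (\<lambda>h. ?m i 1 * h $ 1 + ?m i 2 * h $ 2)) (at p)" for p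
    by (auto intro!: derivative_eq_intros)
  show "g i p0 = ?m i 1 * p0 $ 1 + ?m i 2 * p0 $ 2" using gi by (rule eventually_nhds_x_imp_x)
  show gd: "g i differentiable (at p0)"
    by (rule differentiable_eventually[OF gi]) (use lin in \<open>auto simp: differentiable_def\<close>)
  have "partial j (g i) p0 = partial j (\<lambda>p. ?m i 1 * p $ 1 + ?m i 2 * p $ 2) p0"
    by (rule partial_cong_eventually[OF gi])
  then show gp: "partial j (g i) p0 = ?m i j"
    using exhaust_2[of j] by (auto simp: has_derivative_imp_partial[OF lin] axis_def)
  have fd: "f differentiable (at p0)"
    by (rule differentiable_eventually[OF ev]) (use has_derivative_quad[of a b d p0] in \<open>unfold differentiable_def, blast\<close>)
  have u: "u i = (\<lambda>p. (- 1 / 3) * (f p * g i p))" by auto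
  show "u i differentiable (at p0)"
    unfolding u by (intro differentiable_mult differentiable_const fd gd)
  have "partial j (u i) p0 = (- 1 / 3) * partial j (\<lambda>p. f p * g i p) p0"
    unfolding u by (subst partial_mult) (auto intro!: differentiable_mult fd gd)
  also have "partial j (\<lambda>p. f p * g i p) p0 = g j p0 * g i p0 + f p0 * ?m i j"
    by (simp add: partial_mult[OF fd gd] gp)
  also have "(- 1 / 3) * z = - z / 3" for z :: real by simp
  finally show "partial j (u i) p0 = - (g j p0 * g i p0 + f p0 * ?m i j) / 3" .
qed

text \<open>Trace and determinant fix the Frobenius norm: its square is (trace)^2 - 2 det = 4 k^2 +
  2.\<close>

lemma quad_coef_bound:
  assumes "a * d - b\<^sup>2 = -1" "(a + d)\<^sup>2 = 4 * k\<^sup>2"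
  shows "\<bar>quad_coef a b d i j\<bar> \<le> 2 + 2 * k"
proof -
  have "a\<^sup>2 + d\<^sup>2 + 2 * b\<^sup>2 = (a + d)\<^sup>2 - 2 * (a * d - b\<^sup>2)"
    by (simp add: power2_sum)
  also have "\<dots> = 4 * k\<^sup>2 + 2" unfolding assms by simp
  finally have s: "a\<^sup>2 + d\<^sup>2 + 2 * b\<^sup>2 = 4 * k\<^sup>2 + 2" .
  have "a\<^sup>2 \<le> 4 * k\<^sup>2 + 2" "b\<^sup>2 \<le> 4 * k\<^sup>2 + 2" "d\<^sup>2 \<le> 4 * k\<^sup>2 + 2"
    using s zero_le_power2[of a] zero_le_power2[of b] zero_le_power2[of d] by linarith+
  then have "(quad_coef a b d i j)\<^sup>2 \<le> 4 * k\<^sup>2 + 2"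
    unfolding quad_coef_def by auto
  also have "\<dots> \<le> (2 + 2 * k)\<^sup>2" using slope_bounds(1) by (simp add: power2_eq_square algebra_simps)
  finally show ?thesis using slope_bounds(1) abs_le_square_iff[of "quad_coef a b d i j" "2 + 2 * k"] by simp
qed

text \<open>For symmetric A one has (A p)(A p)^T - (p . A p) A = - det A (J p)(J p)^T with J the
  quarter turn. For det A = -1 the right side is 3 \<open>g1\<close>, and p . A p = 2 F. The factor
  1/3 in the displacement is the one for which the strain terms combine to a third of this left
  side.\<close>

lemma quad_strain:
  assumes "a * d - b\<^sup>2 = -1" and G: "\<And>i. G i = quad_coef a b d i 1 * p $ 1 + quad_coef a b d i 2 * p $ 2"
    and F: "F = (a * (p $ 1)\<^sup>2 + 2 * b * (p $ 1 * p $ 2) + d * (p $ 2)\<^sup>2) / 2"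
  shows "- (G i * G j + F * quad_coef a b d j i) / 3 + - (G j * G i + F * quad_coef a b d i j) / 3 + G i * G j = g1 p $ i $ j"
proof -
  define x y where "x = p $ 1" and "y = p $ 2"
  have b: "b * b = a * d + 1" using assms(1) by (simp add: power2_eq_square)
  have "G 1 = a * x + b * y" "G 2 = b * x + d * y" by (simp_all add: G quad_coef_def x_def y_def)
  note G' = this
  have F': "F = (a * (x * x) + 2 * b * (x * y) + d * (y * y)) / 2" by (simp add: F x_def y_def power2_eq_square)
  have 1: "(a * x + b * y) * (a * x + b * y) - 2 * F * a = y * y"
  proof -
    have "(a * x + b * y) * (a * x + b * y) - 2 * F * a = (b * b - a * d) * (y * y)"
      unfolding F' by (simp add: algebra_simps)
    then show ?thesis by (simp add: b)
  qed
  have 2: "(b * x + d * y) * (b * x + d * y) - 2 * F * d = x * x"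
  proof -
    have "(b * x + d * y) * (b * x + d * y) - 2 * F * d = (b * b - a * d) * (x * x)"
      unfolding F' by (simp add: algebra_simps)
    then show ?thesis by (simp add: b)
  qed
  have 3: "(a * x + b * y) * (b * x + d * y) - 2 * F * b = - (x * y)"
  proof -
    have "(a * x + b * y) * (b * x + d * y) - 2 * F * b = (a * d - b * b) * (x * y)"
      unfolding F' by (simp add: algebra_simps)
    then show ?thesis by (simp add: b)
  qed
  have L: "- (G i * G j + F * quad_coef a b d j i) / 3 + - (G j * G i + F * quad_coef a b d i j) / 3 + G i * G j
    = (G i * G j - 2 * F * quad_coef a b d i j) / 3"
    by (auto simp: quad_coef_def field_simps)
  show ?thesis
    unfolding L g1_nth using exhaust_2[of i] exhaust_2[of j] 1 2 3
    by (auto simp: G' quad_coef_def x_def[symmetric] y_def[symmetric] power2_eq_square mult.commute)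
qed

lemma ruffle_weak:
  fixes r0 :: real
  assumes r0: "0 < r0"
  defines "\<Omega> \<equiv> annulus r0"
  shows "has_weak_partial \<Omega> i f (g i)" "f \<in> L2 \<Omega>" "has_weak_partial \<Omega> j (g i) (partial j (g i))" "g i \<in> L2 \<Omega>" "partial j (g i) \<in> L2 \<Omega>"
    "has_weak_partial \<Omega> j (u i) (partial j (u i))" "u i \<in> L2 \<Omega>" "partial j (u i) \<in> L2 \<Omega>"
proof -
  have ne: "p \<noteq> 0" and le1: "norm p \<le> 1" if "p \<in> \<Omega>" for p
    using that r0 by (auto simp: \<Omega>_def annulus_def)
  \<comment> \<open>One bound for everything: the function, its gradient and its Hessian entries are
    at most 2 + 2 k, and the displacement and its derivatives are thirds of sums of at most two
    products of these.\<close>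
  define B where "B = (2 + 2 * k) * (2 + 2 * k)"
  have k0: "0 \<le> k" by (rule slope_bounds)
  have B1: "2 + 2 * k \<le> B"
    unfolding B_def using k0 mult_mono[of 1 "2 + 2 * k" "2 + 2 * k" "2 + 2 * k"] by auto
  then have B2: "2 + 2 * k \<le> B" "1 + k \<le> B" using k0 by linarith+
  have fB: "\<bar>f p\<bar> \<le> B" and gB: "\<bar>g i p\<bar> \<le> B" if "p \<in> \<Omega>" for p i
    using ruffle_bounds[OF ne[OF that] le1[OF that]] B2 by (auto intro: order_trans)
  have ab: "\<bar>- (x * y + z * w) / 3\<bar> \<le> B" if "\<bar>x\<bar> \<le> 2 + 2 * k" "\<bar>y\<bar> \<le> 2 + 2 * k" "\<bar>z\<bar> \<le> 2 + 2 * k" "\<bar>w\<bar> \<le> 2 + 2 * k" for x y z w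
  proof -
    have "\<bar>x * y\<bar> \<le> B" "\<bar>z * w\<bar> \<le> B"
      unfolding B_def abs_mult using that k0 by (intro mult_mono; simp)+
    then show ?thesis by (simp add: abs_le_iff)
  qed
  have f2: "\<bar>f p\<bar> \<le> 2 + 2 * k" and g2: "\<bar>g i p\<bar> \<le> 2 + 2 * k" if "p \<in> \<Omega>" for p i
    using ruffle_bounds[OF ne[OF that] le1[OF that]] k0 by (auto intro: order_trans)
  have uB: "\<bar>u i p\<bar> \<le> B" if "p \<in> \<Omega>" for p i
    using ab[OF f2[OF that] g2[OF that, of i], of 0 0] k0 by simp
  have ae: "AE p in lebesgue. p \<in> \<Omega> \<longrightarrow> (\<forall>i j. g i differentiable (at p) \<and> u i differentiable (at p) \<and>
      \<bar>partial j (g i) p\<bar> \<le> B \<and> \<bar>partial j (u i) p\<bar> \<le> B)"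
    using ruffle_quadratic
  proof eventually_elim
    case (elim p)
    show ?case
    proof
      assume p: "p \<in> \<Omega>"
      then obtain a b d where q: "a * d - b\<^sup>2 = -1" "(a + d)\<^sup>2 = 4 * k\<^sup>2"
        "eventually (\<lambda>p. f p = (a * (p $ 1)\<^sup>2 + 2 * b * (p $ 1 * p $ 2) + d * (p $ 2)\<^sup>2) / 2) (nhds p)"
        using elim ne by blast
      note qd = quadratic_derivatives[OF q(3)]
      show "\<forall>i j. g i differentiable (at p) \<and> u i differentiable (at p) \<and>
        \<bar>partial j (g i) p\<bar> \<le> B \<and> \<bar>partial j (u i) p\<bar> \<le> B"
      proof (intro allI conjI)
        fix i j
        show "g i differentiable (at p)" "u i differentiable (at p)" by (rule qd)+
        show "\<bar>partial j (g i) p\<bar> \<le> B" unfolding qd(3) using quad_coef_bound[OF q(1,2)] B2(1) by (rule order_trans)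
        show "\<bar>partial j (u i) p\<bar> \<le> B"
          unfolding qd(5) by (rule ab[OF g2[OF p] g2[OF p] f2[OF p] quad_coef_bound[OF q(1,2)]])
      qed
    qed
  qed
  have op: "open \<Omega>" "bounded \<Omega>" unfolding \<Omega>_def by (rule open_annulus bounded_annulus)+
  have F: "has_weak_partial \<Omega> i f (g i) \<and> f \<in> L2 \<Omega> \<and> g i \<in> L2 \<Omega>" for i
    using loc_lip_weak_partial[OF op, of f B i] ruffle_loc_lip(1,4)[OF ne] fB gB by auto
  have G: "has_weak_partial \<Omega> j (g i) (partial j (g i)) \<and> g i \<in> L2 \<Omega> \<and> partial j (g i) \<in> L2 \<Omega>" for i j
  proof -
    have "AE p in lebesgue. p \<in> \<Omega> \<longrightarrow> g i differentiable (at p)" "AE p in lebesgue. p \<in> \<Omega> \<longrightarrow> \<bar>partial j (g i) p\<bar> \<le> B"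
      using ae by (auto elim!: eventually_mono)
    then show ?thesis
      using loc_lip_weak_partial[OF op ruffle_loc_lip(2)[OF ne], where B = B and i = j] gB by blast
  qed
  have U: "has_weak_partial \<Omega> j (u i) (partial j (u i)) \<and> u i \<in> L2 \<Omega> \<and> partial j (u i) \<in> L2 \<Omega>" for i j
  proof -
    have "AE p in lebesgue. p \<in> \<Omega> \<longrightarrow> u i differentiable (at p)" "AE p in lebesgue. p \<in> \<Omega> \<longrightarrow> \<bar>partial j (u i) p\<bar> \<le> B"
      using ae by (auto elim!: eventually_mono)
    then show ?thesis
      using loc_lip_weak_partial[OF op ruffle_loc_lip(3)[OF ne], where B = B and i = j] uB by blast
  qed
  show "has_weak_partial \<Omega> i f (g i)" "f \<in> L2 \<Omega>" using F by blast+
  show "has_weak_partial \<Omega> j (g i) (partial j (g i))" "g i \<in> L2 \<Omega>" "partial j (g i) \<in> L2 \<Omega>" using G by blast+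
  show "has_weak_partial \<Omega> j (u i) (partial j (u i))" "u i \<in> L2 \<Omega>" "partial j (u i) \<in> L2 \<Omega>" using U by blast+
qed

lemma ruffle_energy:
  fixes r0 \<nu> :: real
  assumes r0: "0 < r0" "r0 < 1" and \<nu>: "-1 < \<nu>" "\<nu> \<le> 1/2"
  defines "X \<equiv> ((\<lambda>p. \<chi> i. u i p), f)"
  shows "X \<in> admissible_sym r0 n"
    and "energy r0 \<nu> \<tau> X \<le> ennreal (3 * (measure lebesgue (annulus r0) + 1) * (real n)\<^sup>2 * \<tau>\<^sup>2)"
proof -
  let ?\<Omega> = "annulus r0"
  note w = ruffle_weak[OF r0(1)]
  have "u i \<in> Sobolev 1 ?\<Omega>" for i
  proof -
    have "\<forall>j. \<exists>v\<in>L2 ?\<Omega>. has_weak_partial ?\<Omega> j (u i) v" using w(6,8) by blast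
    then show ?thesis using w(7) by simp
  qed
  moreover have g1: "g i \<in> Sobolev 1 ?\<Omega>" for i
  proof -
    have "\<forall>j. \<exists>v\<in>L2 ?\<Omega>. has_weak_partial ?\<Omega> j (g i) v" using w(3,5) by blast
    then show ?thesis using w(4) by simp
  qed
  have f2: "f \<in> Sobolev 2 ?\<Omega>"
  proof -
    have "\<forall>i. \<exists>v\<in>Sobolev 1 ?\<Omega>. has_weak_partial ?\<Omega> i f v" using w(1) g1 by blast
    then show ?thesis using w(2) unfolding numeral_2_eq_2 One_nat_def[symmetric] Sobolev.simps(2) by blast
  qed
  ultimately have adm: "X \<in> admissible r0" by (simp add: X_def admissible_def)
  have ne: "p \<noteq> 0" if "p \<in> ?\<Omega>" for p using that r0 by (auto simp: annulus_def)
  have n0: "n > 0" using n by simp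
  have z: "profile \<alpha> 0 = 0"
    using profile_near_0[OF angle_bounds, of 0] angle_bounds by (simp add: saddle_def)
  have sym: "f (polar r (\<theta> + 2 * pi / real n)) = f (polar r \<theta>)" "f (polar r 0) = 0" "f (polar r (pi / real n)) = 0"
    "f (polar r (\<theta> - pi / real n)) = - f (polar r \<theta>)" if "r > 0" for r \<theta>
  proof -
    note rp = ruffle_polar[OF \<alpha> n0 that]
    have "profile \<alpha> (\<theta> + 2 * pi / real n) = profile \<alpha> \<theta>"
      using profile_shift[OF angle_bounds(1), of \<theta> 2] by (simp add: parity_sign_def \<alpha>)
    then show "f (polar r (\<theta> + 2 * pi / real n)) = f (polar r \<theta>)" by (simp only: rp)
    show "f (polar r 0) = 0" unfolding rp by (simp add: z)
    have "profile \<alpha> (pi / real n) = 0"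
      using profile_shift[OF angle_bounds(1), of 0 1] z by (simp add: \<alpha>)
    then show "f (polar r (pi / real n)) = 0" unfolding rp by (simp add: z)
    have "profile \<alpha> (\<theta> - pi / real n) = - profile \<alpha> \<theta>"
      using profile_shift[OF angle_bounds(1), of \<theta> "-1"] by (simp add: parity_sign_def \<alpha>)
    then show "f (polar r (\<theta> - pi / real n)) = - f (polar r \<theta>)" unfolding rp by (simp add: z)
  qed
  have "continuous_on ?\<Omega> f"
    using loc_lip_imp_isCont[OF ruffle_loc_lip(1)[OF ne]] by (intro continuous_at_imp_continuous_on) auto
  moreover have "\<forall>r\<in>{r0<..<1}. (\<forall>\<theta>. f (polar r (\<theta> + 2 * pi / real n)) = f (polar r \<theta>)) \<and>
          f (polar r 0) = 0 \<and> f (polar r (pi / real n)) = 0 \<and>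
          (\<forall>\<theta>. f (polar r (\<theta> - pi / real n)) = - f (polar r \<theta>))"
    using sym r0(1) by auto
  ultimately show "X \<in> admissible_sym r0 n"
    using adm unfolding X_def admissible_sym_def by auto
  have wf: "AE p in lebesgue. \<forall>i. p \<in> ?\<Omega> \<longrightarrow> weak_partial ?\<Omega> i f p = g i p"
    unfolding AE_all_countable using weak_partial_AE_eq[OF open_annulus w(1)] by blast
  have wu: "AE p in lebesgue. \<forall>i j. p \<in> ?\<Omega> \<longrightarrow> weak_partial ?\<Omega> j (u i) p = partial j (u i) p"
    unfolding AE_all_countable using weak_partial_AE_eq[OF open_annulus w(6)] by blast
  \<comment> \<open>The second weak derivative is taken of the chosen representative of the first,
    which equals \<open>g i\<close> only almost everywhere.\<close>
  have wh: "AE p in lebesgue. \<forall>i j. p \<in> ?\<Omega> \<longrightarrow> weak_partial ?\<Omega> j (weak_partial ?\<Omega> i f) p = partial j (g i) p"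
    unfolding AE_all_countable
  proof (intro allI)
    fix i j
    have "AE p in lebesgue. p \<in> ?\<Omega> \<longrightarrow> g i p = weak_partial ?\<Omega> i f p"
      using wf by (auto elim!: eventually_mono)
    then have "has_weak_partial ?\<Omega> j (weak_partial ?\<Omega> i f) (partial j (g i))"
      by (rule has_weak_partial_cong_AE[OF w(3) has_weak_partialD(2)[OF weak_partial_works[OF w(1)]] has_weak_partialD(2)[OF w(3)]]) simp
    then show "AE p in lebesgue. p \<in> ?\<Omega> \<longrightarrow> weak_partial ?\<Omega> j (weak_partial ?\<Omega> i f) p = partial j (g i) p"
      by (rule weak_partial_AE_eq[OF open_annulus])
  qed
  have key: "AE p in lebesgue. p \<in> ?\<Omega> \<longrightarrow> strain r0 X p = 0 \<and> energy_density \<nu> (weak_hessian ?\<Omega> f p) \<le> 8 * k\<^sup>2 + 2"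
    using ruffle_quadratic wf wu wh
  proof eventually_elim
    case (elim p)
    show ?case
    proof
      assume p: "p \<in> ?\<Omega>"
      then obtain a b d where q: "a * d - b\<^sup>2 = -1" "(a + d)\<^sup>2 = 4 * k\<^sup>2"
        "eventually (\<lambda>p. f p = (a * (p $ 1)\<^sup>2 + 2 * b * (p $ 1 * p $ 2) + d * (p $ 2)\<^sup>2) / 2) (nhds p)"
        using elim(1) ne by blast
      note qd = quadratic_derivatives[OF q(3)]
      have "strain r0 X p $ i $ j = 0" for i j
      proof -
        have wp: "weak_partial ?\<Omega> i f p = g i p" "weak_partial ?\<Omega> j (u i) p = partial j (u i) p" for i j
          using elim(2,3) p by blast+
        have "strain r0 X p $ i $ j = partial i (u j) p + partial j (u i) p + g i p * g j p - g1 p $ i $ j"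
          unfolding X_def strain_nth vec_lambda_beta wp ..
        also have "\<dots> = 0"
          unfolding qd(5) quad_strain[OF q(1) qd(1) eventually_nhds_x_imp_x[OF q(3)]] by simp
        finally show ?thesis .
      qed
      then have "strain r0 X p = 0" by (simp add: vec_eq_iff)
      moreover have "energy_density \<nu> (weak_hessian ?\<Omega> f p) \<le> 8 * k\<^sup>2 + 2"
      proof -
        have H: "weak_hessian ?\<Omega> f p $ i $ j = quad_coef a b d i j" for i j
          using elim(4) p by (simp add: weak_hessian_def qd(3))
        have "energy_density \<nu> (weak_hessian ?\<Omega> f p) = 1 / (1 - \<nu>) * (a + d)\<^sup>2 - 2 * (a * d - b\<^sup>2)"
          by (simp add: energy_density_def trace_def det_2 sum_2 H) (simp add: quad_coef_def power2_eq_square)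
        also have "\<dots> = 1 / (1 - \<nu>) * (4 * k\<^sup>2) + 2" by (simp add: q)
        also have "1 / (1 - \<nu>) * (4 * k\<^sup>2) \<le> 2 * (4 * k\<^sup>2)"
          using \<nu> by (intro mult_right_mono) (auto simp: field_simps)
        finally show ?thesis by simp
      qed
      ultimately show "strain r0 X p = 0 \<and> energy_density \<nu> (weak_hessian ?\<Omega> f p) \<le> 8 * k\<^sup>2 + 2" ..
    qed
  qed
  have "stretching_energy r0 \<nu> X = (\<integral>\<^sup>+(p::real^2). 0 \<partial>lebesgue)"
    unfolding stretching_energy_def
  proof (rule nn_integral_cong_AE)
    show "AE p in lebesgue. ennreal (energy_density \<nu> (strain r0 X p)) * indicator ?\<Omega> p = 0"
      using key
    proof eventually_elim
      case (elim p)
      have "energy_density \<nu> 0 = 0" by (simp add: energy_density_def trace_def det_2)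
      then show ?case using elim by (cases "p \<in> ?\<Omega>") auto
    qed
  qed
  then have S: "stretching_energy r0 \<nu> X = 0" by simp
  have "bending_energy r0 \<nu> X \<le> (\<integral>\<^sup>+p. ennreal (8 * k\<^sup>2 + 2) * indicator ?\<Omega> p \<partial>lebesgue)"
    unfolding X_def bending_energy_def prod.case
  proof (rule nn_integral_mono_AE)
    show "AE p in lebesgue. ennreal (energy_density \<nu> (weak_hessian ?\<Omega> f p)) * indicator ?\<Omega> p \<le> ennreal (8 * k\<^sup>2 + 2) * indicator ?\<Omega> p"
      using key
    proof eventually_elim
      case (elim p)
      show ?case
      proof (cases "p \<in> ?\<Omega>")
        case True
        then have "ennreal (energy_density \<nu> (weak_hessian ?\<Omega> f p)) \<le> ennreal (8 * k\<^sup>2 + 2)"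
          using elim by (intro ennreal_leI) blast
        then show ?thesis by (rule mult_right_mono) simp
      qed simp
    qed
  qed
  also have "\<dots> = ennreal (8 * k\<^sup>2 + 2) * emeasure lebesgue ?\<Omega>"
    by (rule nn_integral_cmult_indicator) simp
  also have "emeasure lebesgue ?\<Omega> = ennreal (measure lebesgue ?\<Omega>)"
    using lmeasurable_annulus[of r0] by (intro emeasure_eq_measure2) auto
  also have "ennreal (8 * k\<^sup>2 + 2) * ennreal (measure lebesgue ?\<Omega>) \<le> ennreal (3 * (measure lebesgue ?\<Omega> + 1) * (real n)\<^sup>2)"
  proof -
    \<comment> \<open>Since \<pi> > 3, the slope is at most n/3 and 8 k^2 is at most 8/9 n^2; n
      \<ge> 2 absorbs the remaining 2 into n^2.\<close>
    have "k\<^sup>2 \<le> (real n / pi)\<^sup>2" using slope_bounds by (intro power_mono) auto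
    also have "\<dots> \<le> (real n / 3)\<^sup>2" using pi_gt3 by (intro power_mono divide_left_mono) auto
    finally have k2: "8 * k\<^sup>2 \<le> 8 / 9 * (real n)\<^sup>2" by (simp add: power_divide)
    have "2\<^sup>2 \<le> (real n)\<^sup>2" using n by (intro power_mono) auto
    then have "8 * k\<^sup>2 + 2 \<le> 3 * (real n)\<^sup>2" using k2 by simp
    then have "(8 * k\<^sup>2 + 2) * measure lebesgue ?\<Omega> \<le> 3 * (real n)\<^sup>2 * (measure lebesgue ?\<Omega> + 1)"
      by (intro mult_mono) auto
    then have "ennreal ((8 * k\<^sup>2 + 2) * measure lebesgue ?\<Omega>) \<le> ennreal (3 * (measure lebesgue ?\<Omega> + 1) * (real n)\<^sup>2)"
      by (intro ennreal_leI) (simp only: mult_ac)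
    moreover have "ennreal ((8 * k\<^sup>2 + 2) * measure lebesgue ?\<Omega>) = ennreal (8 * k\<^sup>2 + 2) * ennreal (measure lebesgue ?\<Omega>)"
      by (rule ennreal_mult) auto
    ultimately show ?thesis by (simp only:)
  qed
  finally have B: "bending_energy r0 \<nu> X \<le> ennreal (3 * (measure lebesgue ?\<Omega> + 1) * (real n)\<^sup>2)" .
  have "energy r0 \<nu> \<tau> X \<le> ennreal (\<tau>\<^sup>2) * ennreal (3 * (measure lebesgue ?\<Omega> + 1) * (real n)\<^sup>2)"
    unfolding energy_def S using B by (simp add: mult_left_mono)
  also have "\<dots> = ennreal (3 * (measure lebesgue ?\<Omega> + 1) * (real n)\<^sup>2 * \<tau>\<^sup>2)"
    by (simp add: ennreal_mult[symmetric] mult.commute)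
  finally show "energy r0 \<nu> \<tau> X \<le> ennreal (3 * (measure lebesgue ?\<Omega> + 1) * (real n)\<^sup>2 * \<tau>\<^sup>2)" .
qed

end

section \<open>The two-sided energy bound\<close>

theorem theorem1p3:
  fixes r0 \<nu> :: real
  assumes "0 < r0" and "r0 < 1" and "-1 < \<nu>" and "\<nu> \<le> 1/2"
  shows "\<exists>c C :: real. c > 0 \<and> C > 0 \<and>
    (\<forall>(n::nat) (\<tau>::real). n \<ge> 2 \<longrightarrow> \<tau> > 0 \<longrightarrow>
      min (ennreal (c * real n * \<tau>\<^sup>2)) (flat_energy r0 \<nu> \<tau> / 2)
        \<le> (INF X\<in>admissible_sym r0 n. energy r0 \<nu> \<tau> X) \<and>
      (INF X\<in>admissible_sym r0 n. energy r0 \<nu> \<tau> X)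
        \<le> min (ennreal (C * (real n)\<^sup>2 * \<tau>\<^sup>2)) (flat_energy r0 \<nu> \<tau>))"
proof -
  define K where "K = (8 + 2 / r0\<^sup>2) * (pi\<^sup>2 / (1 + \<nu>))"
  have K: "K > 0" unfolding K_def using assms by (intro mult_pos_pos divide_pos_pos) (auto intro: add_pos_nonneg)
  \<comment> \<open>If \<open>flat_value\<close> is not positive, the infimum over flat deformations
    is 0 and so is the minimum on the left; the value 1 only keeps \<open>c\<close>
    positive.\<close>
  define c where "c = (if flat_value r0 \<nu> > 0 then flat_value r0 \<nu> / (2 * K) else 1)"
  define C where "C = 3 * (measure lebesgue (annulus r0) + 1)"
  have "c > 0" using K by (simp add: c_def)
  moreover have "C > 0" by (simp add: C_def add_nonneg_pos)
  moreover have "min (ennreal (c * real n * \<tau>\<^sup>2)) (flat_energy r0 \<nu> \<tau> / 2) \<le> (INF X\<in>admissible_sym r0 n. energy r0 \<nu> \<tau> X)"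
    if n: "n \<ge> 2" and \<tau>: "\<tau> > 0" for n :: nat and \<tau> :: real
  proof (cases "flat_value r0 \<nu> > 0")
    case True
    show ?thesis
      using energy_lower_bound[OF assms n \<tau> _ True] True
      by (intro INF_greatest) (simp add: c_def K_def)
  next
    case False
    then have "flat_energy r0 \<nu> \<tau> = 0"
      using flat_energy_le[OF assms, of \<tau>] by (simp add: ennreal_neg)
    then show ?thesis by (simp add: min.coboundedI2)
  qed
  moreover have "(INF X\<in>admissible_sym r0 n. energy r0 \<nu> \<tau> X) \<le> min (ennreal (C * (real n)\<^sup>2 * \<tau>\<^sup>2)) (flat_energy r0 \<nu> \<tau>)"
    if n: "n \<ge> 2" and \<tau>: "\<tau> > 0" for n :: nat and \<tau> :: real
  proof (rule min.boundedI)
    show "(INF X\<in>admissible_sym r0 n. energy r0 \<nu> \<tau> X) \<le> ennreal (C * (real n)\<^sup>2 * \<tau>\<^sup>2)"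
      unfolding C_def using ruffle_energy[OF n refl refl assms] by (rule INF_lower2)
    show "(INF X\<in>admissible_sym r0 n. energy r0 \<nu> \<tau> X) \<le> flat_energy r0 \<nu> \<tau>"
      unfolding flat_energy_def by (rule INF_superset_mono[OF admissible_flat_subset_sym]) simp
  qed
  ultimately show ?thesis by blast
qed

end
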